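(* Let $\mathbf{A}\in\mathbb{R}^{n\times n}$ be an instance of a weighted generalized random dot product graph with signature $(p,q)$ satisfying the regularity conditions (i)--(iii) of the context, with latent point cloud $\mathbf{X}\in\mathbb{R}^{n\times d}$ and spectral embedding $\mathbf{X}_{\mathbf{A}}\in\mathbb{R}^{n\times d}$. Then there exists a sequence of (random) matrices $\mathbf{Q}_n\in\mathbb{O}(p,q)$ such that, almost surely, $$\left\|\mathbf{X}_{\mathbf{A}}\mathbf{Q}_n-\mathbf{X}\right\|_{2\to\infty}=\mathrm{O}\left(n^{-1/2}\log^{3\alpha+3/2}(n)\right)\quad\text{as } n\to\infty,$$ where $\alpha$ is the constant in condition (iii).
   Context: Let $p,q\ge 0$ be integers with $d=p+q\ge 1$; $\mathbf{I}_{p,q}$ is the $d\times d$ diagonal matrix with $p$ ones followed by $q$ minus ones, and $\mathbb{O}(p,q)=\{\mathbf{M}\in\mathbb{R}^{d\times d}:\mathbf{M}\mathbf{I}_{p,q}\mathbf{M}^\top=\mathbf{I}_{p,q}\}$. Model. Let $\mathcal{Z}$ be a sample space with probability distribution $F$, and let $\{H(\mathbf{z}_1,\mathbf{z}_2):\mathbf{z}_1,\mathbf{z}_2\in\mathcal{Z}\}$ be a family of real-valued distributions with $H(\mathbf{z}_1,\mathbf{z}_2)=H(\mathbf{z}_2,\mathbf{z}_1)$, for which there is a map $\phi:\mathcal{Z}\to\mathbb{R}^d$ such that, for all $\mathbf{z}_1,\mathbf{z}_2$, $A\sim H(\mathbf{z}_1,\mathbf{z}_2)$ implies $\mathbb{E}(A)=\phi(\mathbf{z}_1)^\top\mathbf{I}_{p,q}\phi(\mathbf{z}_2)$.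 A symmetric random matrix $\mathbf{A}\in\mathbb{R}^{n\times n}$ is a weighted generalized random dot product graph with signature $(p,q)$ if $\mathbf{Z}_1,\ldots,\mathbf{Z}_n$ are i.i.d. from $F$ and, conditionally on them, the entries $\mathbf{A}_{ij}$, $i<j$, are independent with $\mathbf{A}_{ij}\sim H(\mathbf{Z}_i,\mathbf{Z}_j)$; the diagonal is $\mathbf{A}_{ii}=0$. For varying $n$, $\mathbf{A}$ is the leading $n\times n$ block of one infinite random array built from one i.i.d. sequence $\mathbf{Z}_1,\mathbf{Z}_2,\ldots$; $\mathcal{Z},F,H,\phi,p,q$ do not depend on $n$. Write $\mathbf{X}_i=\phi(\mathbf{Z}_i)$ and $\mathbf{X}=[\mathbf{X}_1|\cdots|\mathbf{X}_n]^\top\in\mathbb{R}^{n\times d}$. Regularity conditions. (i) For $\mathbf{Z}\sim F$, the second moment matrix $\mathbf{\Delta}=\mathbb{E}\{\phi(\mathbf{Z})\phi(\mathbf{Z})^\top\}$ has full rank $d$. (ii) There are universal constants $a,b\in\mathbb{R}$ with $\phi(\mathbf{z}_1)^\top\mathbf{I}_{p,q}\phi(\mathbf{z}_2)\in[a,b]$ for all $\mathbf{z}_1,\mathbf{z}_2\in\mathcal{Z}$. (iii) There are universal constants $\alpha>0$ and, for each $\rho\in\mathbb{R}$, $\beta_\rho>0$, such that for all $\mathbf{z}_1,\mathbf{z}_2\in\mathcal{Z}$, if $A\sim H(\mathbf{z}_1,\mathbf{z}_2)$ then $\mathbb{P}\{|A|<\beta_\rho\log^\alpha(t)\}>1-t^{-\rho}$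 for all $t\ge 2$. Spectral embedding. Let $\mathbf{\Lambda}_{\mathbf{A}}\in\mathbb{R}^{d\times d}$ be the diagonal matrix of the $d$ largest eigenvalues in absolute value of $\mathbf{A}$ (positive ones listed before negative ones), and $\mathbf{U}_{\mathbf{A}}\in\mathbb{R}^{n\times d}$ a matrix whose columns are corresponding orthonormal eigenvectors. Then $\mathbf{X}_{\mathbf{A}}=\mathbf{U}_{\mathbf{A}}|\mathbf{\Lambda}_{\mathbf{A}}|^{1/2}$, with $|\cdot|$ the entrywise absolute value. $\|\cdot\|_{2\to\infty}$ is the maximum Euclidean norm of the rows of a matrix. "$Y_n=\mathrm{O}(r_n)$ almost surely" means that with probability one there are finite (possibly random) $c,N$ with $|Y_n|\le c\,r_n$ for all $n\ge N$. *)

theory Defs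
  imports
    "HOL-Probability.Probability"
    "HOL-Library.Landau_Symbols"
    "Jordan_Normal_Form.Matrix"
    "Jordan_Normal_Form.Char_Poly"
    "Jordan_Normal_Form.DL_Rank"
begin

unbundle no vec_syntax
unbundle no inner_syntax
hide_const (open) Finite_Cartesian_Product.vec Finite_Cartesian_Product.mat
  Finite_Cartesian_Product.row

definition Ipq :: "nat \<Rightarrow> nat \<Rightarrow> real mat" where
  "Ipq p q = mat_diag (p + q) (\<lambda>i. if i < p then 1 else - 1)"

definition indefinite_orthogonal :: "nat \<Rightarrow> nat \<Rightarrow> real mat set" where
  "indefinite_orthogonal p q =
     {M \<in> carrier_mat (p + q) (p + q). M * Ipq p q * transpose_mat M = Ipq p q}"

text \<open>Only meaningful for matrices with at least one row, since \<^term>\<open>Max {}\<close> is unspecified.\<close>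

definition two_inf_norm :: "real mat \<Rightarrow> real" where
  "two_inf_norm B = Max ((\<lambda>i. sqrt (row B i \<bullet> row B i)) ` {..<dim_row B})"

text \<open>
  \<open>Y\<close> is a spectral embedding of \<open>B\<close> into \<open>d\<close> dimensions. The list \<open>es\<close> enumerates all
  eigenvalues of \<open>B\<close> with multiplicity, its first \<open>d\<close> entries being the selected ones.
  Since the selection need not be unique (ties, signs, bases of eigenspaces), this is a relation.
  The order inside the positive block, and inside the negative block, is free; so is the
  position of selected eigenvalues that are zero.
\<close>

definition spectral_embedding :: "nat \<Rightarrow> real mat \<Rightarrow> real mat \<Rightarrow> bool" where
  "spectral_embedding d B Y \<longleftrightarrow>
     (\<exists>es U. let n = dim_row B in
        length es = n \<and> char_poly B = (\<Prod>e\<leftarrow>es. [:- e, 1:]) \<and>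
        (\<forall>i<d. \<forall>j\<in>{d..<n}. \<bar>es ! j\<bar> \<le> \<bar>es ! i\<bar>) \<and>
        (\<forall>i<d. \<forall>j<d. es ! i > 0 \<and> es ! j < 0 \<longrightarrow> i < j) \<and>
        U \<in> carrier_mat n d \<and> transpose_mat U * U = 1\<^sub>m d \<and>
        (\<forall>i<d. B *\<^sub>v col U i = es ! i \<cdot>\<^sub>v col U i) \<and>
        Y = U * mat_diag d (\<lambda>i. sqrt \<bar>es ! i\<bar>))"

definition random_matrix :: "'w measure \<Rightarrow> nat \<Rightarrow> nat \<Rightarrow> ('w \<Rightarrow> real mat) \<Rightarrow> bool" where
  "random_matrix M r c Y \<longleftrightarrow>
     (\<forall>\<omega>\<in>space M. Y \<omega> \<in> carrier_mat r c) \<and>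
     (\<forall>i<r. \<forall>j<c. (\<lambda>\<omega>. Y \<omega> $$ (i, j)) \<in> borel_measurable M)"

text \<open>
  The sample space is \<^term>\<open>space F\<close>. The mapping property of \<open>H\<close> says that every \<open>H z1 z2\<close> is a
  probability distribution on the Borel sets and that \<open>H\<close> is a Markov kernel, as is needed for
  \<open>H (Z i) (Z j)\<close> to be a conditional distribution.
\<close>

locale wgrdpg_family = prob_space F
  for F :: "'z measure" and H :: "'z \<Rightarrow> 'z \<Rightarrow> real measure"
    and \<phi> :: "'z \<Rightarrow> real vec" and p q :: nat +
  assumes dim_pos: "p + q \<ge> 1"
    and H_kernel: "(\<lambda>(z1, z2). H z1 z2) \<in> F \<Otimes>\<^sub>M F \<rightarrow>\<^sub>M prob_algebra borel"
    and H_sym: "\<And>z1 z2. z1 \<in> space F \<Longrightarrow> z2 \<in> space F \<Longrightarrow> H z1 z2 = H z2 z1"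
    and \<phi>_carrier: "\<And>z. z \<in> space F \<Longrightarrow> \<phi> z \<in> carrier_vec (p + q)"
    and \<phi>_measurable: "\<And>i. i < p + q \<Longrightarrow> (\<lambda>z. \<phi> z $ i) \<in> borel_measurable F"
    and H_integrable: "\<And>z1 z2. z1 \<in> space F \<Longrightarrow> z2 \<in> space F \<Longrightarrow> integrable (H z1 z2) (\<lambda>x. x)"
    and H_mean: "\<And>z1 z2. z1 \<in> space F \<Longrightarrow> z2 \<in> space F \<Longrightarrow>
      (\<integral>x. x \<partial>H z1 z2) = \<phi> z1 \<bullet> (Ipq p q *\<^sub>v \<phi> z2)"

text \<open>The \<open>\<sigma>\<close>-algebra on \<open>M\<close> generated by the first \<open>n\<close> variables.\<close>

definition generated_algebra ::
    "'w measure \<Rightarrow> 'z measure \<Rightarrow> (nat \<Rightarrow> 'w \<Rightarrow> 'z) \<Rightarrow> nat \<Rightarrow> 'w measure" where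
  "generated_algebra M F Z n =
     vimage_algebra (space M) (\<lambda>\<omega>. \<lambda>i\<in>{..<n}. Z i \<omega>) (\<Pi>\<^sub>M i\<in>{..<n}. F)"

text \<open>
  One infinite array \<open>A\<close>, indexed from 0, carries the graphs of all sizes. The last assumption
  states, for every \<open>n\<close>, that conditionally on \<open>Z 0, \<dots>, Z (n - 1)\<close> the entries \<open>A i j\<close>,
  \<open>i < j < n\<close>, are independent with \<open>A i j\<close> distributed as \<open>H (Z i) (Z j)\<close>: the conditional
  probability of any product event is the product of the probabilities.
\<close>

locale wgrdpg = prob_space M + family: wgrdpg_family F H \<phi> p q
  for M :: "'w measure"
    and F :: "'z measure" and H :: "'z \<Rightarrow> 'z \<Rightarrow> real measure"
    and \<phi> :: "'z \<Rightarrow> real vec" and p q :: nat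
    and Z :: "nat \<Rightarrow> 'w \<Rightarrow> 'z" and A :: "nat \<Rightarrow> nat \<Rightarrow> 'w \<Rightarrow> real" +
  assumes Z_indep: "indep_vars (\<lambda>_. F) Z UNIV"
    and Z_distr: "\<And>i. distr M F (Z i) = F"
    and A_measurable: "\<And>i j. A i j \<in> borel_measurable M"
    and A_sym: "\<And>i j \<omega>. \<omega> \<in> space M \<Longrightarrow> A i j \<omega> = A j i \<omega>"
    and A_diag: "\<And>i \<omega>. \<omega> \<in> space M \<Longrightarrow> A i i \<omega> = 0"
    and A_cond_indep: "\<And>n (B :: nat \<Rightarrow> nat \<Rightarrow> real set). (\<And>i j. B i j \<in> sets borel) \<Longrightarrow>
      AE \<omega> in M.
        real_cond_exp M (generated_algebra M F Z n)
          (\<lambda>\<omega>'. \<Prod>(i, j) \<in> {(i, j). i < j \<and> j < n}. indicat_real (B i j) (A i j \<omega>')) \<omega>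
        = (\<Prod>(i, j) \<in> {(i, j). i < j \<and> j < n}. measure (H (Z i \<omega>) (Z j \<omega>)) (B i j))"

definition adjacency :: "(nat \<Rightarrow> nat \<Rightarrow> 'w \<Rightarrow> real) \<Rightarrow> nat \<Rightarrow> 'w \<Rightarrow> real mat" where
  "adjacency A n \<omega> = mat n n (\<lambda>(i, j). A i j \<omega>)"

definition point_cloud ::
    "('z \<Rightarrow> real vec) \<Rightarrow> nat \<Rightarrow> (nat \<Rightarrow> 'w \<Rightarrow> 'z) \<Rightarrow> nat \<Rightarrow> 'w \<Rightarrow> real mat" where
  "point_cloud \<phi> d Z n \<omega> = mat n d (\<lambda>(i, j). \<phi> (Z i \<omega>) $ j)"

definition full_rank_second_moment :: "'z measure \<Rightarrow> ('z \<Rightarrow> real vec) \<Rightarrow> nat \<Rightarrow> bool" where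
  "full_rank_second_moment F \<phi> d \<longleftrightarrow>
     (\<forall>i<d. \<forall>j<d. integrable F (\<lambda>z. \<phi> z $ i * \<phi> z $ j)) \<and>
     vec_space.rank d (mat d d (\<lambda>(i, j). \<integral>z. \<phi> z $ i * \<phi> z $ j \<partial>F)) = d"

definition bounded_means :: "'z measure \<Rightarrow> ('z \<Rightarrow> real vec) \<Rightarrow> nat \<Rightarrow> nat \<Rightarrow> bool" where
  "bounded_means F \<phi> p q \<longleftrightarrow>
     (\<exists>a b. \<forall>z1\<in>space F. \<forall>z2\<in>space F. \<phi> z1 \<bullet> (Ipq p q *\<^sub>v \<phi> z2) \<in> {a..b})"

definition log_tails :: "'z measure \<Rightarrow> ('z \<Rightarrow> 'z \<Rightarrow> real measure) \<Rightarrow> real \<Rightarrow> bool" where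
  "log_tails F H \<alpha> \<longleftrightarrow> \<alpha> > 0 \<and>
     (\<forall>\<rho>::real. \<exists>\<beta>>0. \<forall>z1\<in>space F. \<forall>z2\<in>space F. \<forall>t\<ge>2.
        measure (H z1 z2) {x. \<bar>x\<bar> < \<beta> * ln t powr \<alpha>} > 1 - t powr (- \<rho>))"

end

theory Submission
  imports Defs "HOL-Real_Asymp.Real_Asymp"
begin

text \<open>
  Write \<open>P = X J X\<^sup>T\<close> with \<open>J = Ipq p q\<close>, \<open>E = A - P\<close> and \<open>Y\<close> for the spectral embedding, so that
  \<open>A Y = Y \<Lambda>\<close> and \<open>Y\<^sup>T Y = \<bar>\<Lambda>\<bar>\<close>. Solving \<open>(P + E) Y = Y \<Lambda>\<close> for \<open>Y\<close> gives \<open>Y = X K + R\<close> with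
  \<open>K = J X\<^sup>T Y \<Lambda>\<^sup>-\<^sup>1\<close> and \<open>R = E Y \<Lambda>\<^sup>-\<^sup>1\<close>, and \<open>K\<^sup>T J K = sgn \<Lambda> - \<Lambda>\<^sup>-\<^sup>1 Y\<^sup>T E Y \<Lambda>\<^sup>-\<^sup>1\<close> is close to \<open>sgn \<Lambda>\<close>.
  Hence \<open>sgn \<Lambda> = J\<close> by inertia, an indefinite Gram-Schmidt process replaces \<open>K\<close> by a nearby \<open>O\<close> with
  \<open>O\<^sup>T J O = J\<close>, and \<open>Q = O\<^sup>-\<^sup>1\<close> satisfies \<open>Y Q - X = (X (K - O) + R) Q\<close>. No decoupling of \<open>E\<close> from its
  eigenvectors is needed: \<open>R \<Lambda> = E X K + E R\<close>, where \<open>E X\<close> is a sum of independent terms given the latent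
  positions and \<open>E R\<close> is of second order in the operator norm of \<open>E\<close>.

  With entries truncated at \<open>L = \<beta> (ln n)\<^sup>\<alpha>\<close>, Hoeffding's inequality and union bounds give
  operator norm and row bounds of order \<open>sqrt n (ln n)\<^sup>s\<close> with \<open>s = \<alpha> + 1/2\<close>, so the error is of order
  \<open>(ln n)\<^sup>2\<^sup>s / sqrt n\<close>, which is within the claimed rate.
\<close>

section \<open>Spectral decomposition of symmetric matrices\<close>

text \<open>Three obstacles shape the development. Condition (ii) bounds only indefinite inner
  products, which by themselves do not bound \<open>\<phi>\<close>; invertibility of the second
  moment matrix turns them into a bound on every coordinate, and only then do Hoeffding's inequality
  and the Gram-Schmidt constants become uniform. Conditional independence is given through
  conditional probabilities of boxes, whereas the row sums of \<open>E X\<close> have coefficients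
  that depend on the latent variables; hence the joint law is written as a mixture of product
  measures, and every tail bound is proved for fixed latent values. Finally, the embedding is a
  relation with free choices, so the deterministic estimate yields an aligning matrix for each
  outcome separately; a measurable sequence comes from minimising the error up to 1/n over a
  countable dense subset of the group. The deterministic estimate also needs d eigenvalues of order
  n, which a law of large numbers for \<open>X^T X\<close> supplies. The log power obtained is 2s =
  2\<alpha> + 1, below 3\<alpha> + 3/2 because \<alpha> > 0.\<close>

lemma homogeneous_system_nontrivial:
  fixes c :: "'a \<Rightarrow> nat \<Rightarrow> real"
  assumes S: "finite S" "card S < d"
  obtains v where "\<exists>k<d. v k \<noteq> 0" "\<And>j. j \<in> S \<Longrightarrow> (\<Sum>k<d. c j k * v k) = 0"
proof -
  obtain h where h: "bij_betw h {..<card S} S"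
    using ex_bij_betw_nat_finite[OF S(1)] by (auto simp: atLeast0LessThan)
  \<comment> \<open>Padded with zero rows to a square matrix. The last row is zero because
    \<open>card S < d\<close>, so the transpose kills the last unit vector and the determinant
    vanishes.\<close>
  define C where "C = Matrix.mat d d (\<lambda>(j, k). if j < card S then c (h j) k else 0)"
  have C: "C \<in> carrier_mat d d" by (auto simp: C_def)
  have "transpose_mat C *\<^sub>v unit_vec d (d - 1) = 0\<^sub>v d"
    using S(2) by (intro eq_vecI) (auto simp: C_def scalar_prod_def unit_vec_def sum.If_cases if_distrib[of "\<lambda>x. _ * x"] intro!: sum.neutral)
  moreover have "unit_vec d (d - 1) \<noteq> (0\<^sub>v d :: real vec)"
    using S(2) by (intro unit_vec_nonzero) auto
  ultimately have "Determinant.det (transpose_mat C) = 0"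
    using C by (subst det_0_iff_vec_prod_zero_field[of _ d]) (auto intro!: exI[of _ "unit_vec d (d - 1)"])
  then have "Determinant.det C = 0" using det_transpose[OF C] by simp
  then obtain w where w: "w \<in> carrier_vec d" "w \<noteq> 0\<^sub>v d" "C *\<^sub>v w = 0\<^sub>v d"
    using det_0_iff_vec_prod_zero_field[OF C] by auto
  show ?thesis
  proof (rule that[of "\<lambda>k. w $ k"])
    show "\<exists>k<d. w $ k \<noteq> 0"
      using w(1,2) by (metis carrier_vecD eq_vecI index_zero_vec(1) index_zero_vec(2))
    fix j assume "j \<in> S"
    then obtain i where i: "i < card S" "j = h i"
      using h by (auto simp: bij_betw_def)
    have "(C *\<^sub>v w) $ i = 0" using w(3) i S(2) by simp
    moreover have "(C *\<^sub>v w) $ i = (\<Sum>k<d. c j k * w $ k)"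
      using i S(2) w(1) by (auto simp: C_def scalar_prod_def atLeast0LessThan intro!: sum.cong)
    ultimately show "(\<Sum>k<d. c j k * w $ k) = 0" by simp
  qed
qed

text \<open>Reflection in the hyperplane orthogonal to \<open>w = v - e\<close>, with
  \<open>e\<close> the first unit vector, swaps \<open>v\<close> and \<open>e\<close>. It completes
  \<open>v\<close> to an orthonormal basis in closed form, and being symmetric and involutive it is
  its own inverse and transpose in the deflation step.\<close>

lemma householder_reflection:
  fixes v :: "real vec"
  assumes v: "v \<in> carrier_vec n" "v \<bullet> v = 1" and n: "n > 0"
  obtains H where "H \<in> carrier_mat n n" "transpose_mat H = H" "H * H = 1\<^sub>m n" "col H 0 = v"
proof (cases "v = unit_vec n 0")
  case True
  then show ?thesis using n by (intro that[of "1\<^sub>m n"]) auto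
next
  case False
  define w where "w i = v $ i - (if i = 0 then 1 else 0)" for i
  define s where "s = (\<Sum>k<n. w k * w k)"
  have vv: "(\<Sum>k<n. v $ k * v $ k) = 1"
    using v by (auto simp: scalar_prod_def atLeast0LessThan)
  have s: "s = 2 - 2 * v $ 0"
  proof -
    have "s = (\<Sum>k<n. v $ k * v $ k - (if k = 0 then 2 * v $ k - 1 else 0))"
      unfolding s_def w_def by (intro sum.cong) (auto simp: algebra_simps)
    also have "\<dots> = 1 - (2 * v $ 0 - 1)"
      using n by (simp add: sum_subtractf vv sum.delta)
    finally show ?thesis by simp
  qed
  have "s \<noteq> 0"
  proof
    assume "s = 0"
    then have "\<And>k. k < n \<Longrightarrow> w k = 0"
      unfolding s_def by (subst (asm) sum_nonneg_eq_0_iff) auto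
    then have "v = unit_vec n 0" using v(1)
      by (intro eq_vecI) (auto simp: w_def unit_vec_def)
    with False show False ..
  qed
  define H where "H = Matrix.mat n n (\<lambda>(i, j). (if i = j then 1 else 0) - 2 / s * (w i * w j))"
  show ?thesis
  proof (rule that[of H])
    show "H \<in> carrier_mat n n" by (simp add: H_def)
    show "transpose_mat H = H" by (intro eq_matI) (auto simp: H_def)
    show "H * H = 1\<^sub>m n"
    proof (intro eq_matI)
      fix i j assume "i < dim_row (1\<^sub>m n :: real mat)" "j < dim_col (1\<^sub>m n :: real mat)"
      then have ij: "i < n" "j < n" by auto
      have "(H * H) $$ (i, j) = (\<Sum>k<n. ((if i = k then 1 else 0) - 2 / s * (w i * w k)) * ((if k = j then 1 else 0) - 2 / s * (w k * w j)))"
        using ij by (auto simp: H_def scalar_prod_def atLeast0LessThan)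
      also have "\<dots> = (\<Sum>k<n. (if k = i then (if i = j then 1 else 0) - 2 / s * (w k * w j) else 0)
          - (if k = j then 2 / s * (w i * w k) else 0) + (2 / s)^2 * w i * w j * (w k * w k))"
        by (intro sum.cong) (auto simp: algebra_simps power2_eq_square)
      also have "\<dots> = (if i = j then 1 else 0) - 2 / s * (w i * w j) - 2 / s * (w i * w j) + (2 / s)^2 * w i * w j * s"
        using ij by (simp add: sum.distrib sum_subtractf sum.delta sum_distrib_left[symmetric] s_def)
      also have "\<dots> = 1\<^sub>m n $$ (i, j)"
        using ij \<open>s \<noteq> 0\<close> by (auto simp: power2_eq_square field_simps)
      finally show "(H * H) $$ (i, j) = 1\<^sub>m n $$ (i, j)" .
    qed (auto simp: H_def)
    show "col H 0 = v"
    proof (intro eq_vecI)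
      fix i assume "i < dim_vec v"
      then have i: "i < n" using v by auto
      have "2 / s * w 0 = -1" using \<open>s \<noteq> 0\<close> unfolding s w_def by (simp add: field_simps)
      then have "2 / s * (w i * w 0) = - w i"
        by (metis mult.left_commute mult_minus1_right)
      then show "col H 0 $ i = v $ i"
        using i n by (simp add: H_def w_def)
    qed (use v in \<open>auto simp: H_def\<close>)
  qed
qed

text \<open>Deflation: reflecting an eigenvector onto the first axis splits off one eigenvalue and
  leaves a smaller symmetric block whose characteristic polynomial is the remaining product. The
  induction runs along the given list, so the eigenvectors come in the very order in which the
  embedding enumerates the eigenvalues.\<close>

lemma symmetric_spectral_decomposition:
  fixes A :: "real mat"
  assumes "A \<in> carrier_mat n n" "transpose_mat A = A" "char_poly A = (\<Prod>e\<leftarrow>es. [:- e, 1:])"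
  shows "\<exists>W\<in>carrier_mat n n. transpose_mat W * W = 1\<^sub>m n \<and> A * W = W * mat_diag n (\<lambda>i. es ! i)"
  using assms
proof (induct es arbitrary: n A)
  case Nil
  with degree_monic_char_poly[of A n] have "n = 0" by auto
  then show ?case using Nil by (intro bexI[of _ "1\<^sub>m 0"] conjI eq_matI) (auto simp: mat_diag_def)
next
  case (Cons e es n A)
  note A = Cons(2) and sym = Cons(3)
  have cp: "char_poly A = [: -e, 1 :] * (\<Prod>e \<leftarrow> es. [:- e, 1:])" using Cons(4) by simp
  have mon: "monic (\<Prod>e\<leftarrow> es. [:- e, 1:])" by (rule monic_prod_list, auto)
  have "degree (char_poly A) = Suc (degree (\<Prod>e\<leftarrow> es. [:- e, 1:]))" unfolding cp
    by (subst degree_mult_eq, insert mon, auto)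
  with degree_monic_char_poly[OF A] obtain m where n: "n = Suc m" by (cases n) auto
  have "eigenvalue A e"
    unfolding eigenvalue_root_char_poly[OF A] cp by simp
  then obtain u where u: "u \<in> carrier_vec n" "u \<noteq> 0\<^sub>v n" "A *\<^sub>v u = e \<cdot>\<^sub>v u"
    using A by (auto simp: eigenvalue_def eigenvector_def)
  define v where "v = (1 / sqrt (u \<bullet> u)) \<cdot>\<^sub>v u"
  have v: "v \<in> carrier_vec n" using u by (simp add: v_def)
  have uu: "u \<bullet> u > 0" using u(1,2)
    using conjugate_square_greater_0_vec[of u n] by simp
  have vv: "v \<bullet> v = 1" using u(1) uu
    by (simp add: v_def scalar_prod_smult_distrib smult_scalar_prod_distrib)
  have Av: "A *\<^sub>v v = e \<cdot>\<^sub>v v"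
    using A u by (simp add: v_def mult_mat_vec smult_smult_assoc mult.commute)
  obtain H where H: "H \<in> carrier_mat n n" "transpose_mat H = H" "H * H = 1\<^sub>m n" "col H 0 = v"
    using householder_reflection[OF v vv] n by auto
  define B where "B = H * A * H"
  have B: "B \<in> carrier_mat n n" using A H by (auto simp: B_def)
  have symB: "transpose_mat B = B"
  proof -
    have "transpose_mat (H * A * H) = H * (A * H)"
      using A H(1,2) sym transpose_mult[of "H * A" n n H n] transpose_mult[of H n n A n] by simp
    then show ?thesis unfolding B_def using A H(1) by simp
  qed
  have AB: "A * H = H * B"
  proof -
    have "H * B = (H * H) * (A * H)"
      unfolding B_def using A H(1) assoc_mult_mat[OF H(1) H(1), of "A * H" n] by simp
    then show ?thesis using A H(1,3) by simp
  qed
  have Hv: "H *\<^sub>v v = unit_vec n 0"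
  proof -
    have "H *\<^sub>v v = col (H * H) 0"
      using H n by (metis carrier_matD(2) col_mult2 zero_less_Suc)
    then show ?thesis using H n by simp
  qed
  have col0: "col B 0 = e \<cdot>\<^sub>v unit_vec n 0"
  proof -
    have "col B 0 = (H * A) *\<^sub>v v"
      unfolding B_def using H A n by (metis carrier_matD(2) col_mult2 mult_carrier_mat zero_less_Suc)
    also have "\<dots> = H *\<^sub>v (e \<cdot>\<^sub>v v)"
      using H A v Av by simp
    also have "\<dots> = e \<cdot>\<^sub>v unit_vec n 0"
      using H v Hv by (simp add: mult_mat_vec)
    finally show ?thesis .
  qed
  have B0: "B $$ (i, 0) = (if i = 0 then e else 0)" if "i < n" for i
  proof -
    have "B $$ (i, 0) = col B 0 $ i" using B that n by simp
    then show ?thesis unfolding col0 using that n by simp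
  qed
  \<comment> \<open>Symmetry clears the first row as well, so \<open>B\<close> is block diagonal and
    not merely block triangular.\<close>
  have B0': "B $$ (0, i) = (if i = 0 then e else 0)" if "i < n" for i
    using B0[OF that] symB B that n by (metis carrier_matD index_transpose_mat(1) zero_less_Suc)
  define A1 where "A1 = Matrix.mat 1 1 (\<lambda>_. e)"
  define A3 where "A3 = Matrix.mat m m (\<lambda>(i, j). B $$ (Suc i, Suc j))"
  have A1: "A1 \<in> carrier_mat 1 1" by (simp add: A1_def)
  have A3: "A3 \<in> carrier_mat m m" by (simp add: A3_def)
  have Bblock: "B = four_block_mat A1 (0\<^sub>m 1 m) (0\<^sub>m m 1) A3"
    using B n by (intro eq_matI) (auto simp: A1_def A3_def B0 B0')
  have symA3: "transpose_mat A3 = A3"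
  proof (intro eq_matI)
    fix i j assume "i < dim_row A3" "j < dim_col A3"
    then have ij: "i < m" "j < m" by (auto simp: A3_def)
    then have "transpose_mat B $$ (Suc i, Suc j) = B $$ (Suc j, Suc i)" using B n by simp
    then show "transpose_mat A3 $$ (i, j) = A3 $$ (i, j)"
      using ij unfolding symB by (simp add: A3_def)
  qed (auto simp: A3_def)
  have "similar_mat B A"
    unfolding similar_mat_def B_def
    by (rule exI[of _ H], rule exI[of _ H], rule similar_mat_witI[of _ _ n]) (use A H in auto)
  then have "char_poly B = char_poly A" by (rule char_poly_similar)
  moreover have "char_poly B = char_poly A1 * char_poly A3"
    unfolding Bblock by (rule char_poly_four_block_zeros_col[OF A1 _ A3]) auto
  moreover have "char_poly A1 = [: -e,1 :]"
    by (simp add: A1_def char_poly_defs det_def sign_def)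
  ultimately have cp3: "char_poly A3 = (\<Prod> e \<leftarrow> es. [:- e, 1:])"
    unfolding cp by (metis mult_cancel_left pCons_eq_0_iff zero_neq_one)
  from Cons(1)[OF A3 symA3 cp3] obtain W3 where W3: "W3 \<in> carrier_mat m m"
      "transpose_mat W3 * W3 = 1\<^sub>m m" "A3 * W3 = W3 * mat_diag m (\<lambda>i. es ! i)" by auto
  define F where "F = four_block_mat (1\<^sub>m 1) (0\<^sub>m 1 m) (0\<^sub>m m 1) W3"
  have F: "F \<in> carrier_mat n n" using W3 n unfolding F_def
    by (metis four_block_carrier_mat one_carrier_mat plus_1_eq_Suc)
  have FF: "transpose_mat F * F = 1\<^sub>m n"
  proof -
    have tF: "transpose_mat F = four_block_mat (1\<^sub>m 1) (0\<^sub>m 1 m) (0\<^sub>m m 1) (transpose_mat W3)"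
      unfolding F_def using W3(1) by (subst transpose_four_block_mat[of _ 1 1 _ m _ m]) auto
    have "transpose_mat F * F = four_block_mat (1\<^sub>m 1) (0\<^sub>m 1 m) (0\<^sub>m m 1) (1\<^sub>m m)"
      unfolding tF unfolding F_def using W3 by (subst mult_four_block_mat[of _ 1 1 _ m _ m _ _ 1 _ m]) auto
    then show ?thesis using n by simp
  qed
  have D: "mat_diag n (\<lambda>i. (e # es) ! i) = four_block_mat A1 (0\<^sub>m 1 m) (0\<^sub>m m 1) (mat_diag m (\<lambda>i. es ! i))"
    by (intro eq_matI) (auto simp: n A1_def mat_diag_def)
  have Dc: "mat_diag m (\<lambda>i. es ! i) \<in> carrier_mat m m" by simp
  have BF: "B * F = F * mat_diag n (\<lambda>i. (e # es) ! i)"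
    unfolding Bblock F_def D using W3 A1 A3 Dc
    by (subst mult_four_block_mat[of _ 1 1 _ m _ m _ _ 1 _ m], auto simp: left_mult_zero_mat[OF Dc])+
  show ?case
  proof (intro bexI[of _ "H * F"] conjI)
    show "H * F \<in> carrier_mat n n" using H F by auto
    have "transpose_mat (H * F) * (H * F) = transpose_mat F * H * (H * F)"
      using transpose_mult[OF H(1) F] H(2) by simp
    also have "\<dots> = transpose_mat F * ((H * H) * F)"
      using H(1) F by (metis assoc_mult_mat mult_carrier_mat transpose_carrier_mat)
    finally show "transpose_mat (H * F) * (H * F) = 1\<^sub>m n" using FF F H(3) by simp
    have "A * (H * F) = H * (B * F)"
      using assoc_mult_mat[OF A H(1) F] assoc_mult_mat[OF H(1) B F] AB by simp
    also have "\<dots> = H * F * mat_diag n (\<lambda>i. (e # es) ! i)"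
      unfolding BF by (rule assoc_mult_mat[OF H(1) F mat_diag_dim, symmetric])
    finally show "A * (H * F) = H * F * mat_diag n (\<lambda>i. (e # es) ! i)" .
  qed
qed

section \<open>Leading eigenvalues and inertia\<close>

text \<open>Cauchy-Schwarz in the form (sum |v|)^2 \<le> d sum v^2. It converts entrywise closeness
  of matrices into closeness of quadratic forms, both for the inertia argument and for the sample
  Gram matrix.\<close>

lemma abs_bilinear_le:
  fixes v e :: "_ \<Rightarrow> _"
  assumes e: "\<And>k m. k < d \<Longrightarrow> m < d \<Longrightarrow> \<bar>e k m\<bar> \<le> (\<epsilon>::real)" and eps: "\<epsilon> \<ge> 0"
  shows "\<bar>\<Sum>k<d. \<Sum>m<d. v k * e k m * v m\<bar> \<le> \<epsilon> * real d * (\<Sum>k<d. (v k)\<^sup>2)"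
proof -
  have "\<bar>\<Sum>k<d. \<Sum>m<d. v k * e k m * v m\<bar> \<le> (\<Sum>k<d. \<Sum>m<d. \<bar>v k * e k m * v m\<bar>)"
    by (rule order_trans[OF sum_abs], intro sum_mono, rule sum_abs)
  also have "\<dots> \<le> (\<Sum>k<d. \<Sum>m<d. \<epsilon> * (\<bar>v k\<bar> * \<bar>v m\<bar>))"
  proof (intro sum_mono)
    fix k m assume "k \<in> {..<d}" "m \<in> {..<d}"
    then have "\<bar>e k m\<bar> * (\<bar>v k\<bar> * \<bar>v m\<bar>) \<le> \<epsilon> * (\<bar>v k\<bar> * \<bar>v m\<bar>)"
      using e by (intro mult_right_mono) auto
    then show "\<bar>v k * e k m * v m\<bar> \<le> \<epsilon> * (\<bar>v k\<bar> * \<bar>v m\<bar>)" by (simp add: abs_mult mult_ac)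
  qed
  also have "\<dots> = \<epsilon> * (\<Sum>k<d. \<bar>v k\<bar>)\<^sup>2"
    unfolding power2_eq_square sum_product by (simp add: sum_distrib_left)
  also have "\<dots> \<le> \<epsilon> * ((\<Sum>k<d. \<bar>v k\<bar>\<^sup>2) * real (card {..<d}))"
    using eps by (intro mult_left_mono sum_squared_le_sum_of_squares) auto
  finally show ?thesis by (simp add: mult_ac)
qed

text \<open>The Courant-Fischer argument for A^2, by counting dimensions: if fewer than d
  eigenvalues reached \<tau> in absolute value, some nonzero vector in the d-dimensional range of
  \<open>V\<close> would be orthogonal to all their eigenvectors, and \<open>A\<close> would stretch
  it by less than \<tau>. In the application \<open>V\<close> is the matrix of latent
  positions.\<close>

lemma leading_eigenvalues_large:
  fixes A :: "real mat" and V :: "nat \<Rightarrow> nat \<Rightarrow> real"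
  assumes A: "A \<in> carrier_mat n n" and sym: "transpose_mat A = A"
    and cp: "char_poly A = (\<Prod>e\<leftarrow>es. [:- e, 1:])"
    and sorted: "\<And>i j. i < d \<Longrightarrow> j \<in> {d..<n} \<Longrightarrow> \<bar>es ! j\<bar> \<le> \<bar>es ! i\<bar>"
    and d: "d \<le> n"
    and nz: "\<And>v. \<exists>k<d. v k \<noteq> 0 \<Longrightarrow> \<exists>i<n. (\<Sum>k<d. V i k * v k) \<noteq> 0"
    and low: "\<And>v. \<tau> * L2_set (\<lambda>i. \<Sum>k<d. V i k * v k) {..<n}
        \<le> L2_set (\<lambda>i. \<Sum>j<n. A $$ (i, j) * (\<Sum>k<d. V j k * v k)) {..<n}"
    and \<tau>: "\<tau> \<ge> 0" and i0: "i0 < d"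
  shows "\<tau> \<le> \<bar>es ! i0\<bar>"
proof (rule ccontr)
  assume "\<not> \<tau> \<le> \<bar>es ! i0\<bar>"
  define S where "S = {k\<in>{..<n}. \<tau> \<le> \<bar>es ! k\<bar>}"
  have "S \<subseteq> {..<d} - {i0}"
  proof
    fix k assume k: "k \<in> S"
    then have "\<bar>es ! i0\<bar> < \<bar>es ! k\<bar>" "k < n" using \<open>\<not> \<tau> \<le> \<bar>es ! i0\<bar>\<close> by (auto simp: S_def)
    then show "k \<in> {..<d} - {i0}" using sorted[OF i0, of k] by (cases "k < d") auto
  qed
  then have "card S < d" using i0
    by (metis card_Diff1_less card_lessThan card_mono finite_Diff finite_lessThan lessThan_iff order_le_less_trans)
  obtain W where W: "W \<in> carrier_mat n n" "transpose_mat W * W = 1\<^sub>m n"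
     "A * W = W * mat_diag n (\<lambda>i. es ! i)"
    using symmetric_spectral_decomposition[OF A sym cp] by auto
  have WW: "W * transpose_mat W = 1\<^sub>m n"
    using W by (metis mat_mult_left_right_inverse transpose_carrier_mat)
  obtain v where v: "\<exists>k<d. v k \<noteq> 0" "\<And>k. k \<in> S \<Longrightarrow> (\<Sum>l<d. (\<Sum>i<n. W $$ (i, k) * V i l) * v l) = 0"
    using homogeneous_system_nontrivial[of S d "\<lambda>k l. \<Sum>i<n. W $$ (i, k) * V i l"] \<open>card S < d\<close>
    by (auto simp: S_def)
  define x where "x = Matrix.vec n (\<lambda>i. \<Sum>k<d. V i k * v k)"
  have x: "x \<in> carrier_vec n" by (simp add: x_def)
  define y where "y = transpose_mat W *\<^sub>v x"
  have y: "y \<in> carrier_vec n" using W(1) x unfolding y_def by (intro mult_mat_vec_carrier[of _ n n]) auto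
  have parseval: "(transpose_mat W *\<^sub>v z) \<bullet> (transpose_mat W *\<^sub>v z) = z \<bullet> z" if z: "z \<in> carrier_vec n" for z
  proof -
    have "(transpose_mat W *\<^sub>v z) \<bullet> (transpose_mat W *\<^sub>v z) = z \<bullet> (W *\<^sub>v (transpose_mat W *\<^sub>v z))"
      using W(1) z by (intro transpose_vec_mult_scalar[of W n n] mult_mat_vec_carrier[of _ n n]) auto
    also have "W *\<^sub>v (transpose_mat W *\<^sub>v z) = z"
      using W z WW by (metis assoc_mult_mat_vec one_mult_mat_vec transpose_carrier_mat)
    finally show ?thesis .
  qed
  have Ay: "transpose_mat W *\<^sub>v (A *\<^sub>v x) = mat_diag n (\<lambda>i. es ! i) *\<^sub>v y"
  proof -
    have "transpose_mat W * A = transpose_mat (A * W)"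
      using transpose_mult[OF A W(1)] sym by simp
    also have "\<dots> = mat_diag n (\<lambda>i. es ! i) * transpose_mat W"
    proof -
      have "transpose_mat (mat_diag n (\<lambda>i. es ! i)) = mat_diag n (\<lambda>i. es ! i)"
        by (intro eq_matI) (auto simp: mat_diag_def)
      then show ?thesis unfolding W(3) using W(1) by (subst transpose_mult[of _ n n _ n]) auto
    qed
    finally have "transpose_mat W * A = mat_diag n (\<lambda>i. es ! i) * transpose_mat W" .
    then show ?thesis unfolding y_def using A W(1) x
      by (metis assoc_mult_mat_vec mat_diag_dim transpose_carrier_mat)
  qed
  have ycoord: "y $ k = 0" if "k \<in> S" for k
  proof -
    have k: "k < n" using that by (auto simp: S_def)
    have "y $ k = (\<Sum>i<n. W $$ (i, k) * (\<Sum>l<d. V i l * v l))"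
      using k W by (simp add: y_def x_def scalar_prod_def atLeast0LessThan)
    also have "\<dots> = (\<Sum>l<d. (\<Sum>i<n. W $$ (i, k) * V i l) * v l)"
      by (simp add: sum_distrib_left sum_distrib_right mult.assoc) (rule sum.swap)
    finally show ?thesis using v(2)[OF that] by simp
  qed
  have L2x: "(L2_set (\<lambda>i. \<Sum>k<d. V i k * v k) {..<n})\<^sup>2 = (\<Sum>k<n. (y $ k)\<^sup>2)"
  proof -
    have "(L2_set (\<lambda>i. \<Sum>k<d. V i k * v k) {..<n})\<^sup>2 = x \<bullet> x"
      by (simp add: L2_set_def sum_nonneg x_def scalar_prod_def atLeast0LessThan power2_eq_square)
    also have "\<dots> = y \<bullet> y" using parseval[OF x] by (simp add: y_def)
    finally show ?thesis using y by (simp add: scalar_prod_def atLeast0LessThan power2_eq_square)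
  qed
  have L2Ax: "(L2_set (\<lambda>i. \<Sum>j<n. A $$ (i, j) * (\<Sum>k<d. V j k * v k)) {..<n})\<^sup>2 = (\<Sum>k<n. (es ! k)\<^sup>2 * (y $ k)\<^sup>2)"
  proof -
    have "(L2_set (\<lambda>i. \<Sum>j<n. A $$ (i, j) * (\<Sum>k<d. V j k * v k)) {..<n})\<^sup>2 = (A *\<^sub>v x) \<bullet> (A *\<^sub>v x)"
      using A by (simp add: L2_set_def sum_nonneg x_def scalar_prod_def atLeast0LessThan power2_eq_square)
    also have "\<dots> = (mat_diag n (\<lambda>i. es ! i) *\<^sub>v y) \<bullet> (mat_diag n (\<lambda>i. es ! i) *\<^sub>v y)"
      using parseval[of "A *\<^sub>v x"] A x unfolding Ay by simp
    also have "\<dots> = (\<Sum>k<n. ((mat_diag n (\<lambda>i. es ! i) *\<^sub>v y) $ k)\<^sup>2)"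
      by (simp add: scalar_prod_def atLeast0LessThan power2_eq_square mat_diag_def)
    also have "\<dots> = (\<Sum>k<n. (es ! k * y $ k)\<^sup>2)"
      using y by (intro sum.cong refl) (simp add: mat_diag_def scalar_prod_def atLeast0LessThan if_distrib[of "\<lambda>x. x * _"] cong: if_cong)
    finally show ?thesis by (simp add: power_mult_distrib)
  qed
  have "\<tau>\<^sup>2 * (\<Sum>k<n. (y $ k)\<^sup>2) \<le> (\<Sum>k<n. (es ! k)\<^sup>2 * (y $ k)\<^sup>2)"
    using power_mono[OF low[of v], of 2] \<tau> unfolding power_mult_distrib L2x L2Ax by simp
  then have "(\<Sum>k<n. (\<tau>\<^sup>2 - (es ! k)\<^sup>2) * (y $ k)\<^sup>2) \<le> 0"
    by (simp add: sum_distrib_left left_diff_distrib sum_subtractf)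
  \<comment> \<open>In eigencoordinates the assumed lower bound makes this sum at most 0, yet no
    term is negative: \<open>y\<close> vanishes on \<open>S\<close>, and off \<open>S\<close> the
    eigenvalue is below \<tau>. So every term is 0, and strictness off \<open>S\<close> forces
    \<open>y = 0\<close>.\<close>
  moreover have nn: "(\<tau>\<^sup>2 - (es ! k)\<^sup>2) * (y $ k)\<^sup>2 \<ge> 0" if "k < n" for k
  proof (cases "k \<in> S")
    case False
    then have "\<bar>es ! k\<bar> \<le> \<tau>" using that by (auto simp: S_def)
    then have "(es ! k)\<^sup>2 \<le> \<tau>\<^sup>2" by (metis abs_ge_zero power2_abs power_mono)
    then show ?thesis by simp
  qed (simp add: ycoord)
  ultimately have z: "(\<tau>\<^sup>2 - (es ! k)\<^sup>2) * (y $ k)\<^sup>2 = 0" if "k < n" for k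
    using that sum_nonneg_eq_0_iff[of "{..<n}" "\<lambda>k. (\<tau>\<^sup>2 - (es ! k)\<^sup>2) * (y $ k)\<^sup>2"]
      sum_nonneg[of "{..<n}" "\<lambda>k. (\<tau>\<^sup>2 - (es ! k)\<^sup>2) * (y $ k)\<^sup>2"] by fastforce
  have "y $ k = 0" if "k < n" for k
  proof (cases "k \<in> S")
    case False
    then have "\<bar>es ! k\<bar> < \<tau>" using that by (auto simp: S_def)
    then have "(es ! k)\<^sup>2 < \<tau>\<^sup>2" by (metis abs_ge_zero power2_abs power_strict_mono zero_less_numeral)
    then show ?thesis using z[OF that] by simp
  qed (simp add: ycoord)
  then have "L2_set (\<lambda>i. \<Sum>k<d. V i k * v k) {..<n} = 0" using L2x by simp
  then show False using nz[OF v(1)] by (auto simp: L2_set_eq_0_iff)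
qed

text \<open>Sylvester's law of inertia with a tolerance. If \<open>sg\<close> took the value
  \<sigma> more often than \<open>J\<close>, some nonzero \<open>v\<close> supported where
  \<open>sg\<close> is \<sigma> would make \<open>K v\<close> vanish wherever \<open>J\<close> is
  \<sigma>. The form \<open>J\<close> at \<open>K v\<close> then has the sign of -\<sigma> or is 0,
  although it differs from \<sigma> |v|^2 by less than |v|^2.\<close>

lemma inertia_le:
  fixes K :: "nat \<Rightarrow> nat \<Rightarrow> real" and J sg :: "nat \<Rightarrow> real"
  assumes J: "\<And>l. l < d \<Longrightarrow> J l = 1 \<or> J l = -1" and sg: "\<And>l. l < d \<Longrightarrow> sg l = 1 \<or> sg l = -1"
    and near: "\<And>k m. k < d \<Longrightarrow> m < d \<Longrightarrow>
       \<bar>(\<Sum>l<d. J l * K l k * K l m) - (if k = m then sg k else 0)\<bar> \<le> \<epsilon>"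
    and eps: "0 \<le> \<epsilon>" "\<epsilon> * real d < 1" and \<sigma>: "\<sigma> = 1 \<or> \<sigma> = -1"
  shows "card {k\<in>{..<d}. sg k = \<sigma>} \<le> card {l\<in>{..<d}. J l = \<sigma>}"
proof (rule ccontr)
  assume "\<not> ?thesis"
  then have less: "card {l\<in>{..<d}. J l = \<sigma>} < card {k\<in>{..<d}. sg k = \<sigma>}" by simp
  \<comment> \<open>The index set of one linear system with two kinds of equations:
    \<open>Inl l\<close> stands for \<open>(K v) l = 0\<close> and \<open>Inr k\<close> for
    \<open>v k = 0\<close>.\<close>
  define S :: "(nat + nat) set" where "S = Inl ` {l\<in>{..<d}. J l = \<sigma>} \<union> Inr ` {k\<in>{..<d}. sg k \<noteq> \<sigma>}"
  have "card S = card {l\<in>{..<d}. J l = \<sigma>} + card {k\<in>{..<d}. sg k \<noteq> \<sigma>}"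
    unfolding S_def by (subst card_Un_disjoint) (auto simp: card_image)
  also have "\<dots> < card {k\<in>{..<d}. sg k = \<sigma>} + card {k\<in>{..<d}. sg k \<noteq> \<sigma>}" using less by simp
  also have "\<dots> = card ({k\<in>{..<d}. sg k = \<sigma>} \<union> {k\<in>{..<d}. sg k \<noteq> \<sigma>})"
    by (subst card_Un_disjoint) auto
  also have "{k\<in>{..<d}. sg k = \<sigma>} \<union> {k\<in>{..<d}. sg k \<noteq> \<sigma>} = {..<d}" by auto
  finally have S: "card S < d" by simp
  obtain v where v: "\<exists>k<d. v k \<noteq> 0"
    "\<And>j. j \<in> S \<Longrightarrow> (\<Sum>k<d. (case j of Inl l \<Rightarrow> K l k | Inr k' \<Rightarrow> if k = k' then 1 else 0) * v k) = 0"
    using homogeneous_system_nontrivial[of S d "\<lambda>j k. case j of Inl l \<Rightarrow> K l k | Inr k' \<Rightarrow> if k = k' then 1 else 0"] S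
    by (auto simp: S_def)
  define w where "w l = (\<Sum>k<d. K l k * v k)" for l
  have w0: "w l = 0" if "l < d" "J l = \<sigma>" for l
    using v(2)[of "Inl l"] that by (auto simp: S_def w_def)
  have v0: "v k = 0" if "k < d" "sg k \<noteq> \<sigma>" for k
    using v(2)[of "Inr k"] that by (auto simp: S_def if_distrib[of "\<lambda>x. x * _"] cong: if_cong)
  define e where "e k m = (\<Sum>l<d. J l * K l k * K l m) - (if k = m then sg k else 0)" for k m
  have "(\<Sum>l<d. J l * (w l)\<^sup>2) = (\<Sum>l<d. \<Sum>k<d. \<Sum>m<d. v k * (J l * K l k * K l m) * v m)"
    unfolding w_def power2_eq_square sum_product by (simp add: sum_distrib_left mult_ac)
  also have "\<dots> = (\<Sum>k<d. \<Sum>m<d. \<Sum>l<d. v k * (J l * K l k * K l m) * v m)"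
    by (subst sum.swap, rule sum.cong[OF refl], rule sum.swap)
  also have "\<dots> = (\<Sum>k<d. \<Sum>m<d. v k * (\<Sum>l<d. J l * K l k * K l m) * v m)"
    by (simp add: sum_distrib_left sum_distrib_right)
  also have "\<dots> = (\<Sum>k<d. \<Sum>m<d. v k * e k m * v m + (if k = m then sg k * (v k)\<^sup>2 else 0))"
    by (intro sum.cong refl) (auto simp: e_def algebra_simps power2_eq_square)
  also have "\<dots> = (\<Sum>k<d. \<Sum>m<d. v k * e k m * v m) + (\<Sum>k<d. sg k * (v k)\<^sup>2)"
    by (simp add: sum.distrib)
  also have "(\<Sum>k<d. sg k * (v k)\<^sup>2) = \<sigma> * (\<Sum>k<d. (v k)\<^sup>2)"
    unfolding sum_distrib_left by (intro sum.cong refl) (use v0 in force)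
  finally have eq: "(\<Sum>l<d. J l * (w l)\<^sup>2) = (\<Sum>k<d. \<Sum>m<d. v k * e k m * v m) + \<sigma> * (\<Sum>k<d. (v k)\<^sup>2)" .
  have "(\<Sum>l<d. J l * (w l)\<^sup>2) = - \<sigma> * (\<Sum>l<d. (w l)\<^sup>2)"
    unfolding sum_distrib_left by (intro sum.cong refl) (use w0 J \<sigma> in force)
  then have "\<sigma> * (\<Sum>l<d. J l * (w l)\<^sup>2) = - (\<Sum>l<d. (w l)\<^sup>2)" using \<sigma> by auto
  then have "\<sigma> * (\<Sum>l<d. J l * (w l)\<^sup>2) \<le> 0" by (simp add: sum_nonneg)
  moreover have "\<sigma> * (\<Sum>l<d. J l * (w l)\<^sup>2) = \<sigma> * (\<Sum>k<d. \<Sum>m<d. v k * e k m * v m) + (\<Sum>k<d. (v k)\<^sup>2)"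
    unfolding eq using \<sigma> by auto
  moreover have "\<bar>\<Sum>k<d. \<Sum>m<d. v k * e k m * v m\<bar> \<le> \<epsilon> * real d * (\<Sum>k<d. (v k)\<^sup>2)"
    using near eps by (intro abs_bilinear_le) (auto simp: e_def)
  ultimately have "(\<Sum>k<d. (v k)\<^sup>2) \<le> \<epsilon> * real d * (\<Sum>k<d. (v k)\<^sup>2)"
    using \<sigma> by auto
  moreover have "(\<Sum>k<d. (v k)\<^sup>2) > 0"
  proof -
    obtain k where "k < d" "v k \<noteq> 0" using v(1) by auto
    then show ?thesis by (intro sum_pos2[of _ k]) auto
  qed
  ultimately show False using eps(2) by (simp add: mult_le_cancel_right1 not_le)
qed

text \<open>The inequalities of \<open>inertia_le\<close> for the two signs add up to the same total
  d, hence both are equalities. The rule that positive eigenvalues precede negative ones then fixes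
  the pattern of signs and not only their number.\<close>

lemma inertia_sorted:
  fixes K :: "nat \<Rightarrow> nat \<Rightarrow> real" and lam :: "nat \<Rightarrow> real"
  assumes near: "\<And>k m. k < p + q \<Longrightarrow> m < p + q \<Longrightarrow>
       \<bar>(\<Sum>l<p + q. (if l < p then 1 else -1) * K l k * K l m) - (if k = m then sgn (lam k) else 0)\<bar> \<le> \<epsilon>"
    and eps: "0 \<le> \<epsilon>" "\<epsilon> * real (p + q) < 1"
    and lam: "\<And>k. k < p + q \<Longrightarrow> lam k \<noteq> 0"
    and sorted: "\<And>i j. i < p + q \<Longrightarrow> j < p + q \<Longrightarrow> lam i > 0 \<Longrightarrow> lam j < 0 \<Longrightarrow> i < j"
    and k: "k < p + q"
  shows "sgn (lam k) = (if k < p then 1 else -1)"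
proof -
  define d where "d = p + q"
  define J :: "nat \<Rightarrow> real" where "J l = (if l < p then 1 else -1)" for l
  have Jc: "{l\<in>{..<d}. J l = 1} = {..<p}" "{l\<in>{..<d}. J l = -1} = {p..<d}"
    by (auto simp: J_def d_def split: if_splits)
  have sg: "sgn (lam l) = 1 \<or> sgn (lam l) = -1" if "l < d" for l
    using lam[of l] that by (auto simp: d_def sgn_if)
  have "card {k\<in>{..<d}. sgn (lam k) = 1} \<le> card {l\<in>{..<d}. J l = 1}"
    using assms(1) eps sg by (intro inertia_le[where K = K and \<epsilon> = \<epsilon>]) (auto simp: J_def d_def)
  moreover have "card {k\<in>{..<d}. sgn (lam k) = -1} \<le> card {l\<in>{..<d}. J l = -1}"
    using assms(1) eps sg by (intro inertia_le[where K = K and \<epsilon> = \<epsilon>]) (auto simp: J_def d_def)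
  moreover have "card {k\<in>{..<d}. sgn (lam k) = 1} + card {k\<in>{..<d}. sgn (lam k) = -1} = d"
  proof -
    have "card {k\<in>{..<d}. sgn (lam k) = 1} + card {k\<in>{..<d}. sgn (lam k) = -1}
        = card ({k\<in>{..<d}. sgn (lam k) = 1} \<union> {k\<in>{..<d}. sgn (lam k) = -1})"
      by (subst card_Un_disjoint) auto
    also have "{k\<in>{..<d}. sgn (lam k) = 1} \<union> {k\<in>{..<d}. sgn (lam k) = -1} = {..<d}"
      using sg by blast
    finally show ?thesis by simp
  qed
  ultimately have cards: "card {k\<in>{..<d}. sgn (lam k) = 1} = p" "card {k\<in>{..<d}. sgn (lam k) = -1} = q"
    unfolding Jc by (auto simp: d_def)
  show ?thesis
  proof (cases "lam k > 0")
    case True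
    have "{..k} \<subseteq> {k\<in>{..<d}. sgn (lam k) = 1}"
    proof
      fix i assume "i \<in> {..k}"
      then have "i \<le> k" "i < d" using k by (auto simp: d_def)
      then have "\<not> lam i < 0" using sorted[of k i] k True by (auto simp: d_def)
      then show "i \<in> {k\<in>{..<d}. sgn (lam k) = 1}" using lam[of i] \<open>i < d\<close> by (auto simp: d_def)
    qed
    then have "card {..k} \<le> p" unfolding cards(1)[symmetric] by (intro card_mono) auto
    then show ?thesis using True by simp
  next
    case False
    then have neg: "lam k < 0" using lam[OF k] by simp
    have "{k..<d} \<subseteq> {k\<in>{..<d}. sgn (lam k) = -1}"
    proof
      fix i assume i: "i \<in> {k..<d}"
      then have "\<not> lam i > 0" using sorted[of i k] k neg by (auto simp: d_def)
      then show "i \<in> {k\<in>{..<d}. sgn (lam k) = -1}" using lam[of i] i by (auto simp: d_def)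
    qed
    then have "card {k..<d} \<le> q" unfolding cards(2)[symmetric] by (intro card_mono) auto
    then show ?thesis using neg k by (simp add: d_def)
  qed
qed

section \<open>Indefinite Gram-Schmidt and the expansion of the embedding\<close>

lemma abs_inverse_sqrt_minus_one_le:
  fixes x :: real
  assumes "x \<ge> 1 / 2"
  shows "\<bar>1 / sqrt x - 1\<bar> \<le> 2 * \<bar>x - 1\<bar>"
proof -
  define r where "r = sqrt x"
  have r: "r > 0" "x = r * r" using assms by (auto simp: r_def)
  have "\<bar>1 / r - 1\<bar> = \<bar>r - 1\<bar> * (1 / r)"
    using r(1) by (simp add: field_simps abs_if)
  also have "1 / r \<le> 2 * (r + 1)"
  proof -
    have "1 \<le> 2 * (r * r) + 2 * r" using assms r by simp
    then show ?thesis using r(1) by (simp add: field_simps)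
  qed
  then have "\<bar>r - 1\<bar> * (1 / r) \<le> \<bar>r - 1\<bar> * (2 * (r + 1))" by (intro mult_left_mono) auto
  also have "\<dots> = 2 * \<bar>(r - 1) * (r + 1)\<bar>" using r(1) by (simp add: abs_mult)
  also have "(r - 1) * (r + 1) = x - 1" using r(2) by (simp add: algebra_simps)
  finally show ?thesis by (simp add: r_def)
qed

definition indef_inner :: "nat \<Rightarrow> (nat \<Rightarrow> real) \<Rightarrow> (nat \<Rightarrow> real) \<Rightarrow> (nat \<Rightarrow> real) \<Rightarrow> real" where
  "indef_inner d J x y = (\<Sum>l<d. J l * x l * y l)"

lemma abs_indef_inner_le:
  assumes J: "\<And>l. \<bar>J l\<bar> = 1" and x: "\<And>l. l < d \<Longrightarrow> \<bar>x l\<bar> \<le> a" and y: "\<And>l. l < d \<Longrightarrow> \<bar>y l\<bar> \<le> b"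
    and ab: "0 \<le> a"
  shows "\<bar>indef_inner d J x y\<bar> \<le> real d * (a * b)"
proof -
  have "\<bar>indef_inner d J x y\<bar> \<le> (\<Sum>l<d. a * b)"
    unfolding indef_inner_def
    by (rule order_trans[OF sum_abs], rule sum_mono)
       (use ab x y J in \<open>auto simp: abs_mult intro!: mult_mono\<close>)
  then show ?thesis by simp
qed

lemma indef_inner_commute: "indef_inner d J x y = indef_inner d J y x"
  by (simp add: indef_inner_def mult_ac)

lemma indef_inner_diff_left: "indef_inner d J (\<lambda>l. x l - y l) z = indef_inner d J x z - indef_inner d J y z"
  by (simp add: indef_inner_def algebra_simps sum_subtractf)

lemma indef_inner_sum_left: "indef_inner d J (\<lambda>l. \<Sum>a\<in>A. c a * x a l) z = (\<Sum>a\<in>A. c a * indef_inner d J (x a) z)"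
  unfolding indef_inner_def sum_distrib_left sum_distrib_right
  by (subst sum.swap) (simp add: mult_ac)

lemma indef_inner_scale: "indef_inner d J (\<lambda>l. c * x l) (\<lambda>l. e * y l) = c * e * indef_inner d J x y"
  by (simp add: indef_inner_def sum_distrib_left mult_ac)

lemma indef_inner_scale_left: "indef_inner d J (\<lambda>l. c * x l) y = c * indef_inner d J x y"
  by (simp add: indef_inner_def sum_distrib_left mult_ac)

text \<open>An indefinite form may vanish on a nonzero vector, so normalisation can fail in general;
  here the products of the input are already within \<epsilon> of the target, which keeps each
  squared length away from 0. What matters is that the correction is linear in \<epsilon>, with
  \<open>C\<close> and \<delta> depending only on the entry bound and the dimensions. The induction
  adds one vector at a time.\<close>

lemma indefinite_gram_schmidt:
  fixes J :: "nat \<Rightarrow> real"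
  assumes J: "\<And>l. \<bar>J l\<bar> = 1" and B: "B \<ge> 0"
  shows "\<exists>C\<ge>0. \<exists>\<delta>>0. \<forall>\<epsilon> K. 0 \<le> \<epsilon> \<longrightarrow> \<epsilon> \<le> \<delta> \<longrightarrow> (\<forall>a<m. \<forall>l<d. \<bar>K a l\<bar> \<le> B) \<longrightarrow>
     (\<forall>a<m. \<forall>b<m. \<bar>indef_inner d J (K a) (K b) - (if a = b then J a else 0)\<bar> \<le> \<epsilon>) \<longrightarrow>
     (\<exists>Q. (\<forall>a<m. \<forall>l<d. \<bar>Q a l - K a l\<bar> \<le> C * \<epsilon>) \<and>
          (\<forall>a<m. \<forall>b<m. indef_inner d J (Q a) (Q b) = (if a = b then J a else 0)))"
proof (induction m)
  case 0
  then show ?case by (intro exI[of _ 0]) (auto intro!: exI[of _ 1])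
next
  case (Suc m)
  then obtain C \<delta> where C: "C \<ge> 0" and \<delta>: "\<delta> > 0" and IH:
    "\<forall>\<epsilon> K. 0 \<le> \<epsilon> \<longrightarrow> \<epsilon> \<le> \<delta> \<longrightarrow> (\<forall>a<m. \<forall>l<d. \<bar>K a l\<bar> \<le> B) \<longrightarrow>
     (\<forall>a<m. \<forall>b<m. \<bar>indef_inner d J (K a) (K b) - (if a = b then J a else 0)\<bar> \<le> \<epsilon>) \<longrightarrow>
     (\<exists>Q. (\<forall>a<m. \<forall>l<d. \<bar>Q a l - K a l\<bar> \<le> C * \<epsilon>) \<and>
          (\<forall>a<m. \<forall>b<m. indef_inner d J (Q a) (Q b) = (if a = b then J a else 0)))"
    by (elim exE conjE) (rule that; assumption)
  have JJ: "J l * J l = 1" for l using J[of l] by (auto simp: abs_if split: if_splits)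
  \<comment> \<open>Each constant multiplies \<epsilon>: \<open>C0\<close> in the bound for a
    projection coefficient, \<open>C1\<close> for the displacement of the projected vector
    \<open>w\<close> from \<open>K m\<close>, \<open>C2\<close> for the deviation of its signed
    squared length from 1, and \<open>C3\<close> for the total displacement. The last argument of
    the minimum in \<open>\<delta>'\<close> ensures
    \<open>C2 * \<epsilon> \<le> 1 / 2\<close>.\<close>
  define C0 where "C0 = 1 + real d * (B * C)"
  define C1 where "C1 = real m * (C0 * (B + C))"
  define C2 where "C2 = 1 + real d * (C1 * (2 * B + C1))"
  define C3 where "C3 = max C (C1 + 2 * C2 * (B + C1))"
  have C0: "C0 \<ge> 1" using B C by (simp add: C0_def)
  have C1: "C1 \<ge> 0" using B C C0 by (simp add: C1_def)
  have C2: "C2 \<ge> 1" using B C1 by (simp add: C2_def)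
  have C3: "C3 \<ge> 0" using C by (simp add: C3_def)
  note nn = C0 C1 C2 C3
  define \<delta>' where "\<delta>' = min \<delta> (min 1 (1 / (2 * C2)))"
  have "\<delta>' > 0" using \<delta> nn by (auto simp: \<delta>'_def)
  have main: "\<exists>Q. (\<forall>a<Suc m. \<forall>l<d. \<bar>Q a l - K a l\<bar> \<le> C3 * \<epsilon>) \<and>
          (\<forall>a<Suc m. \<forall>b<Suc m. indef_inner d J (Q a) (Q b) = (if a = b then J a else 0))"
    if eps: "0 \<le> \<epsilon>" "\<epsilon> \<le> \<delta>'" and KB: "\<forall>a<Suc m. \<forall>l<d. \<bar>K a l\<bar> \<le> B"
      and KK: "\<forall>a<Suc m. \<forall>b<Suc m. \<bar>indef_inner d J (K a) (K b) - (if a = b then J a else 0)\<bar> \<le> \<epsilon>"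
    for \<epsilon> K
  proof -
    have eps1: "\<epsilon> \<le> \<delta>" "\<epsilon> \<le> 1" "\<epsilon> \<le> 1 / (2 * C2)" using eps by (auto simp: \<delta>'_def)
    have eps2: "C2 * \<epsilon> \<le> 1 / 2" using eps1(3) nn(3) by (simp add: field_simps)
    have "\<exists>Q. (\<forall>a<m. \<forall>l<d. \<bar>Q a l - K a l\<bar> \<le> C * \<epsilon>) \<and>
          (\<forall>a<m. \<forall>b<m. indef_inner d J (Q a) (Q b) = (if a = b then J a else 0))"
      by (rule IH[THEN spec[of _ \<epsilon>], THEN spec[of _ K], THEN mp, THEN mp, THEN mp, THEN mp, OF eps(1) eps1(1)])
         (use KB KK in auto)
    then obtain Q where Q0: "\<forall>a<m. \<forall>l<d. \<bar>Q a l - K a l\<bar> \<le> C * \<epsilon>"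
      "\<forall>a<m. \<forall>b<m. indef_inner d J (Q a) (Q b) = (if a = b then J a else 0)"
      by (elim exE conjE) (rule that; assumption)
    have Q: "\<And>a l. a < m \<Longrightarrow> l < d \<Longrightarrow> \<bar>Q a l - K a l\<bar> \<le> C * \<epsilon>"
      "\<And>a b. a < m \<Longrightarrow> b < m \<Longrightarrow> indef_inner d J (Q a) (Q b) = (if a = b then J a else 0)"
      using Q0 by simp_all
    have QB: "\<bar>Q a l\<bar> \<le> B + C" if "a < m" "l < d" for a l
    proof -
      have "C * \<epsilon> \<le> C" using C eps1(2) by (simp add: mult_left_le)
      moreover have "\<bar>K a l\<bar> \<le> B" using KB that by auto
      ultimately show ?thesis using Q(1)[OF that] by linarith
    qed
    \<comment> \<open>The usual projection coefficient; division by the squared length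
      \<open>J a\<close> of \<open>Q a\<close> is multiplication by \<open>J a\<close>.\<close>
    define c where "c a = J a * indef_inner d J (K m) (Q a)" for a
    have c: "\<bar>c a\<bar> \<le> C0 * \<epsilon>" if a: "a < m" for a
    proof -
      have "indef_inner d J (K m) (Q a) = indef_inner d J (K m) (K a) + indef_inner d J (\<lambda>l. Q a l - K a l) (K m)"
        by (simp add: indef_inner_diff_left indef_inner_commute[of d J "K m" "Q a"] indef_inner_commute[of d J "K m" "K a"])
      moreover have "\<bar>indef_inner d J (K m) (K a)\<bar> \<le> \<epsilon>"
        using KK[THEN spec[of _ m], THEN mp, OF lessI, THEN spec[of _ a]] a by simp
      moreover have "\<bar>indef_inner d J (\<lambda>l. Q a l - K a l) (K m)\<bar> \<le> real d * (C * \<epsilon> * B)"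
        using J Q(1)[OF a] KB C eps by (intro abs_indef_inner_le) auto
      ultimately have "\<bar>indef_inner d J (K m) (Q a)\<bar> \<le> \<epsilon> + real d * (C * \<epsilon> * B)" by linarith
      then show ?thesis using J[of a] by (simp add: c_def abs_mult C0_def algebra_simps)
    qed
    define w where "w l = K m l - (\<Sum>a<m. c a * Q a l)" for l
    have wK: "\<bar>w l - K m l\<bar> \<le> C1 * \<epsilon>" if l: "l < d" for l
    proof -
      have "\<bar>\<Sum>a<m. c a * Q a l\<bar> \<le> (\<Sum>a<m. C0 * \<epsilon> * (B + C))"
        by (rule order_trans[OF sum_abs], rule sum_mono)
           (use c QB l nn eps in \<open>auto simp: abs_mult intro!: mult_mono\<close>)
      then show ?thesis by (simp add: w_def C1_def mult_ac)
    qed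
    have wB: "\<bar>w l\<bar> \<le> B + C1" if l: "l < d" for l
    proof -
      have "C1 * \<epsilon> \<le> C1" using nn eps1(2) by (simp add: mult_left_le)
      moreover have "\<bar>K m l\<bar> \<le> B" using KB that by auto
      ultimately show ?thesis using wK[OF that] by linarith
    qed
    have wQ: "indef_inner d J w (Q b) = 0" if b: "b < m" for b
    proof -
      have "indef_inner d J w (Q b) = indef_inner d J (K m) (Q b) - (\<Sum>a<m. c a * indef_inner d J (Q a) (Q b))"
        unfolding w_def by (simp add: indef_inner_diff_left indef_inner_sum_left)
      also have "(\<Sum>a<m. c a * indef_inner d J (Q a) (Q b)) = (\<Sum>a<m. if a = b then c a * J a else 0)"
        by (intro sum.cong) (auto simp: Q(2) b)
      also have "\<dots> = c b * J b" using b by simp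
      finally show ?thesis using JJ[of b] by (simp add: c_def mult_ac)
    qed
    \<comment> \<open>The squared length of \<open>w\<close> relative to its intended sign. It stays
      at least 1/2, so the square root below is legitimate and the rescaled vector has squared
      length exactly \<open>J m\<close>.\<close>
    define x where "x = J m * indef_inner d J w w"
    have ww: "indef_inner d J w w = J m * x" unfolding x_def using JJ[of m] by (simp add: mult.assoc[symmetric])
    have x1: "\<bar>x - 1\<bar> \<le> C2 * \<epsilon>"
    proof -
      have "x - 1 = J m * (indef_inner d J w w - J m)"
        using JJ[of m] by (simp add: x_def algebra_simps)
      then have "\<bar>x - 1\<bar> = \<bar>indef_inner d J w w - J m\<bar>" using J[of m] by (simp add: abs_mult)
      also have "indef_inner d J w w - J m
          = (indef_inner d J (K m) (K m) - J m) + indef_inner d J (\<lambda>l. w l - K m l) (\<lambda>l. w l + K m l)"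
        by (simp add: indef_inner_def algebra_simps sum_subtractf sum.distrib)
      also have "\<bar>\<dots>\<bar> \<le> \<epsilon> + real d * (C1 * \<epsilon> * (2 * B + C1))"
      proof (rule order_trans[OF abs_triangle_ineq add_mono])
        show "\<bar>indef_inner d J (K m) (K m) - J m\<bar> \<le> \<epsilon>"
          using KK[THEN spec[of _ m], THEN mp, OF lessI, THEN spec[of _ m], THEN mp, OF lessI] by simp
        have "\<bar>w l + K m l\<bar> \<le> 2 * B + C1" if "l < d" for l
          using KB[THEN spec[of _ m], THEN mp, OF lessI, THEN spec[of _ l]] wB[OF that] that by linarith
        then show "\<bar>indef_inner d J (\<lambda>l. w l - K m l) (\<lambda>l. w l + K m l)\<bar> \<le> real d * (C1 * \<epsilon> * (2 * B + C1))"
          using wK J nn eps by (intro abs_indef_inner_le) auto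
      qed
      also have "\<dots> = C2 * \<epsilon>" by (simp add: C2_def algebra_simps)
      finally show ?thesis .
    qed
    have x2: "x \<ge> 1 / 2" using x1 eps2 by linarith
    define s where "s = 1 / sqrt x"
    have ss: "s * s * x = 1" using x2 by (simp add: s_def)
    have s1: "\<bar>s - 1\<bar> \<le> 2 * (C2 * \<epsilon>)"
      using abs_inverse_sqrt_minus_one_le[OF x2] x1 by (simp add: s_def)
    define Q' where "Q' a = (if a = m then (\<lambda>l. s * w l) else Q a)" for a
    show ?thesis
    proof (intro exI[of _ Q'] conjI allI impI)
      fix a l assume a: "a < Suc m" and l: "l < d"
      show "\<bar>Q' a l - K a l\<bar> \<le> C3 * \<epsilon>"
      proof (cases "a = m")
        case True
        have "s * w l - K m l = (s - 1) * w l + (w l - K m l)" by (simp add: algebra_simps)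
        also have "\<bar>\<dots>\<bar> \<le> 2 * (C2 * \<epsilon>) * (B + C1) + C1 * \<epsilon>"
          using s1 wB[OF l] wK[OF l] nn eps
          by (intro order_trans[OF abs_triangle_ineq add_mono]) (auto simp: abs_mult intro!: mult_mono)
        also have "\<dots> = (C1 + 2 * C2 * (B + C1)) * \<epsilon>" by (simp add: algebra_simps)
        also have "\<dots> \<le> C3 * \<epsilon>" using eps by (intro mult_right_mono) (auto simp: C3_def)
        finally show ?thesis using True by (simp add: Q'_def)
      next
        case False
        then have "\<bar>Q a l - K a l\<bar> \<le> C * \<epsilon>" using a l by (intro Q(1)) auto
        also have "\<dots> \<le> C3 * \<epsilon>" using eps by (intro mult_right_mono) (auto simp: C3_def)
        finally show ?thesis using False by (simp add: Q'_def)
      qed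
    next
      fix a b assume a: "a < Suc m" and b: "b < Suc m"
      have e1: "indef_inner d J (\<lambda>l. s * w l) (Q b) = 0" if "b < m" for b
        using wQ[OF that] by (simp add: indef_inner_scale_left)
      have e2: "indef_inner d J (Q a) (\<lambda>l. s * w l) = 0" if "a < m" for a
        using e1[OF that] by (subst indef_inner_commute)
      have e3: "indef_inner d J (\<lambda>l. s * w l) (\<lambda>l. s * w l) = J m"
        using ss by (simp add: indef_inner_scale ww mult_ac)
      show "indef_inner d J (Q' a) (Q' b) = (if a = b then J a else 0)"
        using a b Q(2)[of a b] e1[of b] e2[of a] e3 by (auto simp: Q'_def)
    qed
  qed
  show ?case
    by (rule exI[of _ C3], rule conjI[OF nn(4)], rule exI[of _ \<delta>'], rule conjI[OF \<open>\<delta>' > 0\<close>])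
       (intro allI impI, rule main; assumption)
qed

section \<open>Expansion of the embedding in the latent positions\<close>

lemma abs_sum_mult_le_L2: "\<bar>\<Sum>i\<in>A. f i * g i\<bar> \<le> L2_set f A * L2_set g A"
proof -
  have "\<bar>\<Sum>i\<in>A. f i * g i\<bar> \<le> (\<Sum>i\<in>A. \<bar>f i\<bar> * \<bar>g i\<bar>)"
    by (rule order_trans[OF sum_abs]) (simp add: abs_mult)
  then show ?thesis using L2_set_mult_ineq[of f g A] by linarith
qed

lemma abs_le_L2_set: "finite A \<Longrightarrow> i \<in> A \<Longrightarrow> \<bar>f i\<bar> \<le> L2_set f A"
  using member_le_L2_set[of A i "\<lambda>i. \<bar>f i\<bar>"] by (simp add: L2_set_def)

lemma L2_set_bounded:
  assumes "\<And>i. i \<in> A \<Longrightarrow> \<bar>f i\<bar> \<le> B" "B \<ge> 0"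
  shows "L2_set f A \<le> sqrt (real (card A)) * B"
proof -
  have "L2_set f A = L2_set (\<lambda>i. \<bar>f i\<bar>) A" by (simp add: L2_set_def)
  also have "\<dots> \<le> L2_set (\<lambda>_. B) A" using assms by (intro L2_set_mono) auto
  also have "\<dots> = sqrt (real (card A)) * B" using assms by (subst L2_set_constant) auto
  finally show ?thesis .
qed

text \<open>The eigenvector equation gives \<open>Y = X K + R\<close>; substituting it into \<open>R = E Y lam\<^sup>-\<^sup>1\<close> once more
  replaces the noise acting on the (dependent) eigenvectors by the noise acting on \<open>X\<close>, up to a
  term of second order in \<open>\<eta>\<close>.\<close>

lemma eigenvector_expansion:
  fixes X Y E :: "nat \<Rightarrow> nat \<Rightarrow> real" and J lam :: "nat \<Rightarrow> real"
  assumes J: "\<And>l. \<bar>J l\<bar> = 1"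
    and AY: "\<And>i k. i < n \<Longrightarrow> k < d \<Longrightarrow>
        (\<Sum>j<n. ((\<Sum>l<d. X i l * J l * X j l) + E i j) * Y j k) = lam k * Y i k"
    and YY: "\<And>k m. k < d \<Longrightarrow> m < d \<Longrightarrow> (\<Sum>i<n. Y i k * Y i m) = (if k = m then \<bar>lam k\<bar> else 0)"
    and lam: "\<And>k. k < d \<Longrightarrow> \<tau> \<le> \<bar>lam k\<bar>" and \<tau>: "\<tau> > 0"
    and XB: "\<And>i l. i < n \<Longrightarrow> l < d \<Longrightarrow> \<bar>X i l\<bar> \<le> B" and B: "B \<ge> 0"
    and Eop: "\<And>v. L2_set (\<lambda>i. \<Sum>j<n. E i j * v j) {..<n} \<le> \<eta> * L2_set v {..<n}" and \<eta>: "\<eta> \<ge> 0"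
    and EX: "\<And>i l. i < n \<Longrightarrow> l < d \<Longrightarrow> \<bar>\<Sum>j<n. E i j * X j l\<bar> \<le> \<theta>" and \<theta>: "\<theta> \<ge> 0"
  obtains K R where
    "\<And>i k. i < n \<Longrightarrow> k < d \<Longrightarrow> Y i k = (\<Sum>l<d. X i l * K l k) + R i k"
    "\<And>l k. l < d \<Longrightarrow> k < d \<Longrightarrow> \<bar>K l k\<bar> \<le> B * sqrt n / sqrt \<tau>"
    "\<And>k m. k < d \<Longrightarrow> m < d \<Longrightarrow>
       \<bar>(\<Sum>l<d. J l * K l k * K l m) - (if k = m then sgn (lam k) else 0)\<bar> \<le> \<eta> / \<tau>"
    "\<And>i k. i < n \<Longrightarrow> k < d \<Longrightarrow>
       \<bar>R i k\<bar> \<le> (real d * (\<theta> * (B * sqrt n / sqrt \<tau>)) + \<eta> * (\<eta> / sqrt \<tau>)) / \<tau>"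
proof -
  have JJ: "J l * J l = 1" for l using J[of l] by (auto simp: abs_if split: if_splits)
  define EY where "EY i k = (\<Sum>j<n. E i j * Y j k)" for i k
  define XY where "XY l k = (\<Sum>i<n. X i l * Y i k)" for l k
  define K where "K l k = J l * XY l k / lam k" for l k
  define R where "R i k = EY i k / lam k" for i k
  have lam0: "lam k \<noteq> 0" "\<bar>lam k\<bar> > 0" if "k < d" for k using lam[OF that] \<tau> by auto
  have st: "sqrt \<tau> > 0" using \<tau> by simp
  have L2Y: "L2_set (\<lambda>i. Y i k) {..<n} = sqrt \<bar>lam k\<bar>" if "k < d" for k
    using YY[OF that that] by (simp add: L2_set_def power2_eq_square)
  have L2EY: "L2_set (\<lambda>i. EY i k) {..<n} \<le> \<eta> * sqrt \<bar>lam k\<bar>" if "k < d" for k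
    unfolding EY_def using Eop[of "\<lambda>j. Y j k"] L2Y[OF that] by simp
  have slam: "sqrt \<bar>lam k\<bar> / \<bar>lam k\<bar> = 1 / sqrt \<bar>lam k\<bar>" if "k < d" for k
    by (metis abs_ge_zero real_div_sqrt divide_divide_eq_left divide_self_if lam0(2)[OF that]
        less_irrefl mult.commute real_sqrt_mult_self abs_of_nonneg real_sqrt_ge_zero nonzero_divide_mult_cancel_left)
  have slam2: "1 / sqrt \<bar>lam k\<bar> \<le> 1 / sqrt \<tau>" if "k < d" for k
    using lam[OF that] st by (intro divide_left_mono) auto
  have A: "(\<Sum>l<d. X i l * J l * XY l k) + EY i k = lam k * Y i k" if "i < n" "k < d" for i k
  proof -
    have "(\<Sum>l<d. X i l * J l * XY l k) = (\<Sum>j<n. \<Sum>l<d. X i l * J l * X j l * Y j k)"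
      unfolding XY_def sum_distrib_left by (subst sum.swap) (simp add: mult_ac)
    then have "(\<Sum>l<d. X i l * J l * XY l k) + EY i k = (\<Sum>j<n. ((\<Sum>l<d. X i l * J l * X j l) + E i j) * Y j k)"
      by (simp add: EY_def sum_distrib_right distrib_right sum.distrib)
    then show ?thesis using AY[OF that] by simp
  qed
  have Y: "Y i k = (\<Sum>l<d. X i l * K l k) + R i k" if "i < n" "k < d" for i k
  proof -
    have "(\<Sum>l<d. X i l * K l k) + R i k = ((\<Sum>l<d. X i l * J l * XY l k) + EY i k) / lam k"
      by (simp add: K_def R_def sum_divide_distrib add_divide_distrib mult_ac)
    then show ?thesis unfolding A[OF that] using lam0[OF that(2)] by simp
  qed
  have KB: "\<bar>K l k\<bar> \<le> B * sqrt n / sqrt \<tau>" if "l < d" "k < d" for l k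
  proof -
    have "\<bar>XY l k\<bar> \<le> L2_set (\<lambda>i. X i l) {..<n} * L2_set (\<lambda>i. Y i k) {..<n}"
      unfolding XY_def by (rule abs_sum_mult_le_L2)
    also have "\<dots> \<le> sqrt n * B * sqrt \<bar>lam k\<bar>"
      unfolding L2Y[OF that(2)] using L2_set_bounded[of "{..<n}" "\<lambda>i. X i l" B] XB that B
      by (intro mult_right_mono) auto
    finally have "\<bar>K l k\<bar> \<le> sqrt n * B * sqrt \<bar>lam k\<bar> / \<bar>lam k\<bar>"
      using J lam0[OF that(2)] by (simp add: K_def abs_mult divide_right_mono)
    also have "\<dots> = sqrt n * B * (1 / sqrt \<bar>lam k\<bar>)"
      using slam[OF that(2)] by (metis times_divide_eq_right)
    also have "\<dots> \<le> sqrt n * B * (1 / sqrt \<tau>)"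
      using slam2[OF that(2)] B by (intro mult_left_mono) auto
    finally show ?thesis by (simp add: mult_ac)
  qed
  have RB: "L2_set (\<lambda>i. R i k) {..<n} \<le> \<eta> / sqrt \<tau>" if "k < d" for k
  proof -
    have "L2_set (\<lambda>i. R i k) {..<n} = L2_set (\<lambda>i. EY i k) {..<n} * (1 / \<bar>lam k\<bar>)"
      using lam0[OF that]
      by (subst L2_set_left_distrib) (auto simp: R_def L2_set_def power_divide power_mult_distrib)
    also have "\<dots> \<le> \<eta> * sqrt \<bar>lam k\<bar> * (1 / \<bar>lam k\<bar>)"
      using L2EY[OF that] by (intro mult_right_mono) auto
    also have "\<dots> = \<eta> * (sqrt \<bar>lam k\<bar> / \<bar>lam k\<bar>)" by simp
    also have "\<dots> = \<eta> * (1 / sqrt \<bar>lam k\<bar>)" unfolding slam[OF that] ..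
    also have "\<dots> \<le> \<eta> * (1 / sqrt \<tau>)" using slam2[OF that] \<eta> by (intro mult_left_mono) auto
    finally show ?thesis by simp
  qed
  have gram: "\<bar>(\<Sum>l<d. J l * K l k * K l m) - (if k = m then sgn (lam k) else 0)\<bar> \<le> \<eta> / \<tau>"
    if "k < d" "m < d" for k m
  proof -
    \<comment> \<open>After multiplication by both eigenvalues the left side is the (k, m) entry of
      \<open>Y^T P Y\<close>, and \<open>P Y = Y lam - E Y\<close>. On the diagonal
      \<open>Y^T Y\<close> contributes |lam| lam, which is sgn lam times lam^2.\<close>
    have "(\<Sum>l<d. J l * K l k * K l m) * (lam k * lam m) = (\<Sum>l<d. XY l k * (J l * XY l m))"
      unfolding sum_distrib_right
    proof (intro sum.cong refl)
      fix l
      have "J l * K l k * K l m * (lam k * lam m) = (J l * J l) * (J l * (XY l k * XY l m))"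
        using lam0[OF that(1)] lam0[OF that(2)] by (simp add: K_def)
      then show "J l * K l k * K l m * (lam k * lam m) = XY l k * (J l * XY l m)"
        using JJ by (simp add: mult_ac)
    qed
    also have "\<dots> = (\<Sum>l<d. \<Sum>i<n. Y i k * (X i l * J l * XY l m))"
      unfolding XY_def[of _ k] sum_distrib_right by (simp add: mult_ac)
    also have "\<dots> = (\<Sum>i<n. Y i k * (\<Sum>l<d. X i l * J l * XY l m))"
      by (subst sum.swap) (simp add: sum_distrib_left)
    also have "\<dots> = (\<Sum>i<n. Y i k * (lam m * Y i m - EY i m))"
      using A[OF _ that(2)] by (intro sum.cong refl) (smt (verit) lessThan_iff)
    also have "\<dots> = lam m * (\<Sum>i<n. Y i k * Y i m) - (\<Sum>i<n. Y i k * EY i m)"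
      by (simp add: sum_distrib_left sum_subtractf algebra_simps)
    also have "\<dots> = (if k = m then sgn (lam k) else 0) * (lam k * lam m) - (\<Sum>i<n. Y i k * EY i m)"
      unfolding YY[OF that] by (auto simp: sgn_if)
    finally have "((\<Sum>l<d. J l * K l k * K l m) - (if k = m then sgn (lam k) else 0)) * (lam k * lam m)
        = - (\<Sum>i<n. Y i k * EY i m)" by (simp add: left_diff_distrib)
    from arg_cong[OF this, of abs]
    have "\<bar>(\<Sum>l<d. J l * K l k * K l m) - (if k = m then sgn (lam k) else 0)\<bar> * (\<bar>lam k\<bar> * \<bar>lam m\<bar>)
        = \<bar>\<Sum>i<n. Y i k * EY i m\<bar>" by (simp only: abs_mult abs_minus_cancel)
    also have "\<dots> \<le> L2_set (\<lambda>i. Y i k) {..<n} * L2_set (\<lambda>i. EY i m) {..<n}"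
      by (rule abs_sum_mult_le_L2)
    also have "\<dots> \<le> sqrt \<bar>lam k\<bar> * (\<eta> * sqrt \<bar>lam m\<bar>)"
      unfolding L2Y[OF that(1)] using L2EY[OF that(2)] by (intro mult_left_mono) auto
    finally have "\<bar>(\<Sum>l<d. J l * K l k * K l m) - (if k = m then sgn (lam k) else 0)\<bar>
        \<le> sqrt \<bar>lam k\<bar> * (\<eta> * sqrt \<bar>lam m\<bar>) / (\<bar>lam k\<bar> * \<bar>lam m\<bar>)"
      using lam0[OF that(1)] lam0[OF that(2)] by (simp add: pos_le_divide_eq)
    also have "\<dots> = \<eta> * ((sqrt \<bar>lam k\<bar> / \<bar>lam k\<bar>) * (sqrt \<bar>lam m\<bar> / \<bar>lam m\<bar>))" by (simp add: mult_ac)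
    also have "\<dots> = \<eta> * ((1 / sqrt \<bar>lam k\<bar>) * (1 / sqrt \<bar>lam m\<bar>))"
      unfolding slam[OF that(1)] slam[OF that(2)] ..
    also have "\<dots> \<le> \<eta> * ((1 / sqrt \<tau>) * (1 / sqrt \<tau>))"
      using slam2[OF that(1)] slam2[OF that(2)] \<eta> st by (intro mult_left_mono mult_mono) auto
    also have "\<dots> = \<eta> / \<tau>" using \<tau> by simp
    finally show ?thesis .
  qed
  have Rsup: "\<bar>R i k\<bar> \<le> (real d * (\<theta> * (B * sqrt n / sqrt \<tau>)) + \<eta> * (\<eta> / sqrt \<tau>)) / \<tau>"
    if "i < n" "k < d" for i k
  proof -
    have "EY i k = (\<Sum>j<n. E i j * ((\<Sum>l<d. X j l * K l k) + R j k))"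
      unfolding EY_def using Y that by (intro sum.cong) auto
    also have "\<dots> = (\<Sum>j<n. \<Sum>l<d. E i j * X j l * K l k) + (\<Sum>j<n. E i j * R j k)"
      by (simp add: distrib_left sum.distrib sum_distrib_left mult.assoc)
    also have "(\<Sum>j<n. \<Sum>l<d. E i j * X j l * K l k) = (\<Sum>l<d. (\<Sum>j<n. E i j * X j l) * K l k)"
      by (subst sum.swap) (simp add: sum_distrib_right)
    finally have "EY i k = (\<Sum>l<d. (\<Sum>j<n. E i j * X j l) * K l k) + (\<Sum>j<n. E i j * R j k)" .
    moreover have "\<bar>\<Sum>l<d. (\<Sum>j<n. E i j * X j l) * K l k\<bar> \<le> (\<Sum>l<d. \<theta> * (B * sqrt n / sqrt \<tau>))"
    proof (rule order_trans[OF sum_abs], rule sum_mono)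
      fix l assume "l \<in> {..<d}"
      then show "\<bar>(\<Sum>j<n. E i j * X j l) * K l k\<bar> \<le> \<theta> * (B * sqrt n / sqrt \<tau>)"
        unfolding abs_mult using EX[OF that(1)] KB[OF _ that(2)] \<theta> by (intro mult_mono) auto
    qed
    \<comment> \<open>\<open>R\<close> depends on \<open>E\<close>, so no concentration for a fixed
      vector applies to this entry. It is bounded by the norm of the whole vector: one factor \<eta>
      comes from \<open>E\<close> here, the other is already contained in \<open>RB\<close>.\<close>
    moreover have "\<bar>\<Sum>j<n. E i j * R j k\<bar> \<le> \<eta> * (\<eta> / sqrt \<tau>)"
    proof -
      have "\<bar>\<Sum>j<n. E i j * R j k\<bar> \<le> L2_set (\<lambda>i. \<Sum>j<n. E i j * R j k) {..<n}"
        using that by (intro abs_le_L2_set[of "{..<n}" i "\<lambda>i. \<Sum>j<n. E i j * R j k"]) auto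
      also have "\<dots> \<le> \<eta> * L2_set (\<lambda>i. R i k) {..<n}" by (rule Eop)
      also have "\<dots> \<le> \<eta> * (\<eta> / sqrt \<tau>)" using RB[OF that(2)] \<eta> by (intro mult_left_mono) auto
      finally show ?thesis .
    qed
    ultimately have EYB: "\<bar>EY i k\<bar> \<le> real d * (\<theta> * (B * sqrt n / sqrt \<tau>)) + \<eta> * (\<eta> / sqrt \<tau>)"
      by simp
    have "\<bar>R i k\<bar> = \<bar>EY i k\<bar> / \<bar>lam k\<bar>" by (simp add: R_def)
    also have "\<dots> \<le> (real d * (\<theta> * (B * sqrt n / sqrt \<tau>)) + \<eta> * (\<eta> / sqrt \<tau>)) / \<tau>"
      using EYB lam[OF that(2)] \<tau> by (intro frac_le) auto
    finally show ?thesis .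
  qed
  show ?thesis by (rule that[of K R]) (use Y KB gram Rsup in auto)
qed

text \<open>Scaling by the square roots keeps the columns eigenvectors and turns their Gram matrix
  into |lam|. Besides the ordering of the eigenvalues, this is all that the perturbation argument
  knows about the embedding.\<close>

lemma spectral_embedding_entries:
  assumes emb: "spectral_embedding d A Y" and A: "A \<in> carrier_mat n n"
  obtains es where
    "char_poly A = (\<Prod>e\<leftarrow>es. [:- e, 1:])"
    "\<And>i j. i < d \<Longrightarrow> j \<in> {d..<n} \<Longrightarrow> \<bar>es ! j\<bar> \<le> \<bar>es ! i\<bar>"
    "\<And>i j. i < d \<Longrightarrow> j < d \<Longrightarrow> es ! i > 0 \<Longrightarrow> es ! j < 0 \<Longrightarrow> i < j"
    "Y \<in> carrier_mat n d"
    "\<And>k m. k < d \<Longrightarrow> m < d \<Longrightarrow> (\<Sum>i<n. Y $$ (i, k) * Y $$ (i, m)) = (if k = m then \<bar>es ! k\<bar> else 0)"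
    "\<And>i k. i < n \<Longrightarrow> k < d \<Longrightarrow> (\<Sum>j<n. A $$ (i, j) * Y $$ (j, k)) = es ! k * Y $$ (i, k)"
proof -
  have n: "dim_row A = n" using A by simp
  from emb obtain es U where es: "length es = n" "char_poly A = (\<Prod>e\<leftarrow>es. [:- e, 1:])"
        "\<forall>i<d. \<forall>j\<in>{d..<n}. \<bar>es ! j\<bar> \<le> \<bar>es ! i\<bar>"
        "\<forall>i<d. \<forall>j<d. es ! i > 0 \<and> es ! j < 0 \<longrightarrow> i < j"
        and U: "U \<in> carrier_mat n d" "transpose_mat U * U = 1\<^sub>m d"
        "\<forall>i<d. A *\<^sub>v col U i = es ! i \<cdot>\<^sub>v col U i"
        and Y: "Y = U * mat_diag d (\<lambda>i. sqrt \<bar>es ! i\<bar>)"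
    unfolding spectral_embedding_def Let_def n by auto
  have Yc: "Y \<in> carrier_mat n d" unfolding Y by (intro mult_carrier_mat[OF U(1)]) simp
  have Ye: "Y $$ (i, k) = U $$ (i, k) * sqrt \<bar>es ! k\<bar>" if "i < n" "k < d" for i k
    using that U(1) unfolding Y
    by (simp add: mat_diag_def scalar_prod_def atLeast0LessThan if_distrib[of "\<lambda>x. _ * x"] cong: if_cong)
  have UU: "(\<Sum>i<n. U $$ (i, k) * U $$ (i, m)) = (if k = m then 1 else 0)" if "k < d" "m < d" for k m
  proof -
    have "(transpose_mat U * U) $$ (k, m) = (\<Sum>i<n. U $$ (i, k) * U $$ (i, m))"
      using that U(1) by (simp add: scalar_prod_def atLeast0LessThan)
    then show ?thesis unfolding U(2) using that by simp
  qed
  have YY: "(\<Sum>i<n. Y $$ (i, k) * Y $$ (i, m)) = (if k = m then \<bar>es ! k\<bar> else 0)" if "k < d" "m < d" for k m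
  proof -
    have "(\<Sum>i<n. Y $$ (i, k) * Y $$ (i, m)) = (\<Sum>i<n. U $$ (i, k) * U $$ (i, m)) * (sqrt \<bar>es ! k\<bar> * sqrt \<bar>es ! m\<bar>)"
      unfolding sum_distrib_right by (intro sum.cong) (auto simp: Ye that)
    then show ?thesis unfolding UU[OF that] by simp
  qed
  have AY: "(\<Sum>j<n. A $$ (i, j) * Y $$ (j, k)) = es ! k * Y $$ (i, k)" if "i < n" "k < d" for i k
  proof -
    have "(A *\<^sub>v col U k) $ i = (es ! k \<cdot>\<^sub>v col U k) $ i" using U(3) that by simp
    then have AU: "(\<Sum>j<n. A $$ (i, j) * U $$ (j, k)) = es ! k * U $$ (i, k)"
      using that U(1) A by (simp add: scalar_prod_def atLeast0LessThan)
    have "(\<Sum>j<n. A $$ (i, j) * Y $$ (j, k)) = (\<Sum>j<n. A $$ (i, j) * U $$ (j, k)) * sqrt \<bar>es ! k\<bar>"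
      unfolding sum_distrib_right by (intro sum.cong) (auto simp: Ye that)
    then show ?thesis unfolding AU using Ye[OF that] by simp
  qed
  show ?thesis
  proof (rule that[of es])
    show "\<And>i j. i < d \<Longrightarrow> j \<in> {d..<n} \<Longrightarrow> \<bar>es ! j\<bar> \<le> \<bar>es ! i\<bar>" using es(3) by blast
    show "\<And>i j. i < d \<Longrightarrow> j < d \<Longrightarrow> es ! i > 0 \<Longrightarrow> es ! j < 0 \<Longrightarrow> i < j" using es(4) by blast
  qed (fact es(2) Yc YY AY)+
qed

section \<open>Size of the signal and the deterministic error bound\<close>

lemma L2_set_triangle_diff:
  "L2_set (\<lambda>i. f i + g i) A \<ge> L2_set f A - L2_set g A"
proof -
  have "L2_set f A = L2_set (\<lambda>i. (f i + g i) + - g i) A" by simp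
  also have "\<dots> \<le> L2_set (\<lambda>i. f i + g i) A + L2_set (\<lambda>i. - g i) A" by (rule L2_set_triangle_ineq)
  also have "L2_set (\<lambda>i. - g i) A = L2_set g A" by (simp add: L2_set_def)
  finally show ?thesis by simp
qed

text \<open>A lower bound for \<open>X\<close> dualises to one for its transpose on the range of
  \<open>X\<close>: if x = X v then |x|^2 = <v, X^T x> \<le> |v| |X^T x|, while s |v| \<le> |x|. The
  signs \<open>J\<close> preserve norms, and applying \<open>X\<close> once more contributes the
  second factor s.\<close>

lemma low_rank_lower_bound:
  fixes X :: "nat \<Rightarrow> nat \<Rightarrow> real"
  assumes J: "\<And>l. \<bar>J l\<bar> = 1"
    and low: "\<And>v. s * L2_set v {..<d} \<le> L2_set (\<lambda>i. \<Sum>k<d. X i k * v k) {..<n}" and s: "s > 0"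
  shows "s * s * L2_set (\<lambda>i. \<Sum>k<d. X i k * v k) {..<n}
     \<le> L2_set (\<lambda>i. \<Sum>j<n. (\<Sum>l<d. X i l * J l * X j l) * (\<Sum>k<d. X j k * v k)) {..<n}"
proof -
  define x where "x i = (\<Sum>k<d. X i k * v k)" for i
  define z where "z l = (\<Sum>j<n. X j l * x j)" for l
  define u where "u l = J l * z l" for l
  have J2: "(J l)\<^sup>2 = 1" for l using J[of l] by (metis one_power2 power2_abs)
  have "L2_set u {..<d} = L2_set z {..<d}"
    by (simp add: L2_set_def u_def power_mult_distrib J2)
  moreover have "(\<Sum>j<n. (\<Sum>l<d. X i l * J l * X j l) * x j) = (\<Sum>l<d. X i l * u l)" for i
    unfolding u_def z_def sum_distrib_left sum_distrib_right by (subst sum.swap) (simp add: mult_ac)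
  ultimately have 1: "s * L2_set z {..<d} \<le> L2_set (\<lambda>i. \<Sum>j<n. (\<Sum>l<d. X i l * J l * X j l) * x j) {..<n}"
    using low[of u] by simp
  have "s * L2_set x {..<n} \<le> L2_set z {..<d}"
  proof (cases "L2_set x {..<n} = 0")
    case False
    then have pos: "L2_set x {..<n} > 0" using L2_set_nonneg[of x "{..<n}"] by linarith
    have "(L2_set x {..<n})\<^sup>2 = (\<Sum>i<n. x i * x i)" by (simp add: L2_set_def sum_nonneg power2_eq_square)
    also have "\<dots> = (\<Sum>i<n. \<Sum>k<d. x i * (X i k * v k))" by (simp add: x_def[symmetric] sum_distrib_left[symmetric])
    also have "\<dots> = (\<Sum>k<d. v k * z k)"
      unfolding z_def sum_distrib_left by (subst sum.swap) (simp add: mult_ac)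
    also have "\<dots> \<le> L2_set v {..<d} * L2_set z {..<d}"
      using abs_sum_mult_le_L2[of v z "{..<d}"] by linarith
    finally have "s * (L2_set x {..<n})\<^sup>2 \<le> (s * L2_set v {..<d}) * L2_set z {..<d}"
      using s by (simp add: mult.assoc)
    also have "\<dots> \<le> L2_set x {..<n} * L2_set z {..<d}"
      using low[of v] by (intro mult_right_mono) (auto simp: x_def[abs_def])
    finally have "L2_set x {..<n} * (s * L2_set x {..<n}) \<le> L2_set x {..<n} * L2_set z {..<d}"
      by (simp add: power2_eq_square mult_ac)
    then show ?thesis using pos by (rule mult_left_le_imp_le)
  qed simp
  then have "s * (s * L2_set x {..<n}) \<le> s * L2_set z {..<d}" using s by (intro mult_left_mono) auto
  with 1 show ?thesis by (simp add: x_def[abs_def] mult.assoc)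
qed

text \<open>\<open>Q = J O\<^sup>T J\<close> where the columns of \<open>O\<close> are the vectors \<open>V a\<close>.\<close>

lemma indefinite_orthogonal_of_family:
  fixes V :: "nat \<Rightarrow> nat \<Rightarrow> real" and p q :: nat
  defines "J \<equiv> \<lambda>l::nat. if l < p then 1 else (-1 :: real)"
  assumes V: "\<And>a b. a < p + q \<Longrightarrow> b < p + q \<Longrightarrow> indef_inner (p + q) J (V a) (V b) = (if a = b then J a else 0)"
  defines "Q \<equiv> Matrix.mat (p + q) (p + q) (\<lambda>(a, l). J a * V a l * J l)"
  shows "Q \<in> indefinite_orthogonal p q"
    and "\<And>l m. l < p + q \<Longrightarrow> m < p + q \<Longrightarrow> (\<Sum>a<p + q. V a l * Q $$ (a, m)) = (if l = m then 1 else 0)"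
proof -
  define d where "d = p + q"
  have JJ: "J l * J l = 1" "J l * (J l * x) = x" for l x by (auto simp: J_def)
  have Qc: "Q \<in> carrier_mat d d" by (simp add: Q_def d_def)
  have I: "Ipq p q = mat_diag d J" by (simp add: Ipq_def J_def d_def)
  have QI: "(Q * Ipq p q) $$ (a, l) = J a * V a l" if "a < d" "l < d" for a l
    using that JJ unfolding I
    by (simp add: Q_def d_def[symmetric] mat_diag_def scalar_prod_def atLeast0LessThan if_distrib[of "\<lambda>x. _ * x"] mult_ac cong: if_cong)
  have Ic: "Ipq p q \<in> carrier_mat d d" unfolding I by simp
  have QIQ: "Q * Ipq p q * transpose_mat Q = Ipq p q"
  proof (intro eq_matI)
    fix a b assume "a < dim_row (Ipq p q)" "b < dim_col (Ipq p q)"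
    then have ab: "a < d" "b < d" using Ic by auto
    define P where "P = Q * Ipq p q"
    have "P \<in> carrier_mat d d" using Qc Ic by (simp add: P_def)
    then have "(P * transpose_mat Q) $$ (a, b) = (\<Sum>l<d. P $$ (a, l) * Q $$ (b, l))"
      using ab Qc by (simp add: scalar_prod_def atLeast0LessThan)
    then have "(Q * Ipq p q * transpose_mat Q) $$ (a, b) = (\<Sum>l<d. (Q * Ipq p q) $$ (a, l) * Q $$ (b, l))"
      unfolding P_def .
    also have "\<dots> = (\<Sum>l<d. J a * J b * (J l * V a l * V b l))"
      using ab QI by (intro sum.cong refl) (auto simp: Q_def d_def[symmetric])
    also have "\<dots> = J a * J b * indef_inner d J (V a) (V b)"
      by (simp add: indef_inner_def sum_distrib_left)
    also have "\<dots> = Ipq p q $$ (a, b)"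
      using ab V[of a b] JJ by (auto simp: d_def I mat_diag_def)
    finally show "(Q * Ipq p q * transpose_mat Q) $$ (a, b) = Ipq p q $$ (a, b)" .
  qed (use Qc Ic in auto)
  show "Q \<in> indefinite_orthogonal p q"
    using Qc QIQ by (simp add: indefinite_orthogonal_def d_def)
  define W where "W = Matrix.mat d d (\<lambda>(l, a). V a l)"
  have Wc: "W \<in> carrier_mat d d" by (simp add: W_def)
  have QW: "Q * W = 1\<^sub>m d"
  proof (intro eq_matI)
    fix a b assume "a < dim_row (1\<^sub>m d :: real mat)" "b < dim_col (1\<^sub>m d :: real mat)"
    then have ab: "a < d" "b < d" by auto
    have "(Q * W) $$ (a, b) = (\<Sum>l<d. J a * V a l * J l * V b l)"
      using ab by (simp add: Q_def W_def d_def[symmetric] scalar_prod_def atLeast0LessThan)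
    also have "\<dots> = J a * indef_inner d J (V a) (V b)"
      by (simp add: indef_inner_def sum_distrib_left mult_ac)
    also have "\<dots> = 1\<^sub>m d $$ (a, b)" using ab V[of a b] JJ by (auto simp: d_def)
    finally show "(Q * W) $$ (a, b) = 1\<^sub>m d $$ (a, b)" .
  qed (use Qc Wc in auto)
  \<comment> \<open>Orthogonality of the family gives \<open>Q * W = 1\<close>. The alignment needs
    the other order, which for square matrices follows.\<close>
  have WQ: "W * Q = 1\<^sub>m d" by (rule mat_mult_left_right_inverse[OF Qc Wc QW])
  fix l m assume lm: "l < p + q" "m < p + q"
  have "(W * Q) $$ (l, m) = (\<Sum>a<p + q. V a l * Q $$ (a, m))"
    using lm Qc by (simp add: W_def d_def scalar_prod_def atLeast0LessThan)
  then show "(\<Sum>a<p + q. V a l * Q $$ (a, m)) = (if l = m then 1 else 0)"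
    unfolding WQ using lm by (simp add: d_def)
qed

text \<open>Everything random is condensed into the parameters \<eta> and \<theta> and the Gram
  bound \<open>c\<close>. \<open>C\<close> and \<delta> are fixed before n, so the estimate can be
  applied along a sample path for all large n. The three error terms come from replacing
  \<open>K\<close> by an exact isometry, from \<open>E X\<close>, and from the second-order term
  \<open>E R\<close>.\<close>

theorem spectral_embedding_error:
  fixes p q :: nat and B c :: real
  defines "d \<equiv> p + q" and "J \<equiv> \<lambda>l::nat. if l < p then 1 else (-1 :: real)"
  assumes d: "d \<ge> 1" and B: "B \<ge> 0" and c: "c > 0"
  obtains C \<delta> where "C \<ge> 0" "\<delta> > 0"
    "\<And>n A Y X \<eta> \<theta>. A \<in> carrier_mat n n \<Longrightarrow> transpose_mat A = A \<Longrightarrow> d \<le> n \<Longrightarrow> spectral_embedding d A Y \<Longrightarrow>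
      (\<And>i l. i < n \<Longrightarrow> l < d \<Longrightarrow> \<bar>X i l\<bar> \<le> B) \<Longrightarrow>
      (\<And>v. sqrt (c * real n) * L2_set v {..<d} \<le> L2_set (\<lambda>i. \<Sum>k<d. X i k * v k) {..<n}) \<Longrightarrow>
      (\<And>v. L2_set (\<lambda>i. \<Sum>j<n. (A $$ (i, j) - (\<Sum>l<d. X i l * J l * X j l)) * v j) {..<n} \<le> \<eta> * L2_set v {..<n}) \<Longrightarrow>
      (\<And>i l. i < n \<Longrightarrow> l < d \<Longrightarrow> \<bar>\<Sum>j<n. (A $$ (i, j) - (\<Sum>l<d. X i l * J l * X j l)) * X j l\<bar> \<le> \<theta>) \<Longrightarrow>
      0 \<le> \<eta> \<Longrightarrow> \<eta> \<le> \<delta> * real n \<Longrightarrow> 0 \<le> \<theta> \<Longrightarrow>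
      \<exists>Q\<in>indefinite_orthogonal p q. \<forall>i<n. \<forall>l<d.
        \<bar>(Y * Q) $$ (i, l) - X i l\<bar> \<le> C * (\<eta> / real n + \<theta> / real n + \<eta>\<^sup>2 / (real n * sqrt (real n)))"
proof -
  have J: "\<bar>J l\<bar> = 1" for l by (simp add: J_def)
  \<comment> \<open>The entry bound B sqrt n / sqrt \<tau> for \<open>K\<close> at the eigenvalue
    level \<tau> = c n / 2, which is free of n.\<close>
  define BK where "BK = B * sqrt (2 / c)"
  have BK: "BK \<ge> 0" using B c by (simp add: BK_def)
  obtain Cg \<delta>g where Cg: "Cg \<ge> 0" and \<delta>g: "\<delta>g > 0" and gs:
    "\<forall>\<epsilon> K. 0 \<le> \<epsilon> \<longrightarrow> \<epsilon> \<le> \<delta>g \<longrightarrow> (\<forall>a<d. \<forall>l<d. \<bar>K a l\<bar> \<le> BK) \<longrightarrow>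
     (\<forall>a<d. \<forall>b<d. \<bar>indef_inner d J (K a) (K b) - (if a = b then J a else 0)\<bar> \<le> \<epsilon>) \<longrightarrow>
     (\<exists>Q. (\<forall>a<d. \<forall>l<d. \<bar>Q a l - K a l\<bar> \<le> Cg * \<epsilon>) \<and>
          (\<forall>a<d. \<forall>b<d. indef_inner d J (Q a) (Q b) = (if a = b then J a else 0)))"
    using indefinite_gram_schmidt[where J = J and B = BK and d = d and m = d, OF J BK]
    by (elim exE conjE) (rule that; assumption)
  \<comment> \<open>One requirement per argument: the noise takes at most half of the signal c n, so
    the leading eigenvalues reach \<tau>; the Gram error \<epsilon> = \<eta> / \<tau> is at most the
    \<open>\<delta>g\<close> of Gram-Schmidt; and \<open>\<epsilon> * d \<le> 1 / 2\<close>, which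
    is below the threshold 1 of the inertia argument.\<close>
  define \<delta> where "\<delta> = min (c / 2) (min (c * \<delta>g / 2) (c / (4 * real d)))"
  define BQ where "BQ = BK + Cg * \<delta>g"
  have BQ: "BQ \<ge> 0" using BK Cg \<delta>g by (simp add: BQ_def)
  define C1 where "C1 = real d * B * Cg * (2 / c)"
  define C2 where "C2 = real d * BK * (2 / c)"
  define C3 where "C3 = sqrt (2 / c) * (2 / c)"
  have Cs: "C1 \<ge> 0" "C2 \<ge> 0" "C3 \<ge> 0" using B Cg c BK by (auto simp: C1_def C2_def C3_def)
  define C where "C = real d * BQ * (C1 + C2 + C3)"
  show ?thesis
  proof (rule that[of C \<delta>])
    show "C \<ge> 0" using Cs BQ by (simp add: C_def)
    show "\<delta> > 0" using c \<delta>g d by (simp add: \<delta>_def)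
    fix n A Y X \<eta> \<theta>
    assume A: "A \<in> carrier_mat n n" and symA: "transpose_mat A = A" and dn: "d \<le> n"
      and emb: "spectral_embedding d A Y"
      and XB: "\<And>i l. i < n \<Longrightarrow> l < d \<Longrightarrow> \<bar>X i l\<bar> \<le> B"
      and low: "\<And>v. sqrt (c * real n) * L2_set v {..<d} \<le> L2_set (\<lambda>i. \<Sum>k<d. X i k * v k) {..<n}"
      and Eop: "\<And>v. L2_set (\<lambda>i. \<Sum>j<n. (A $$ (i, j) - (\<Sum>l<d. X i l * J l * X j l)) * v j) {..<n} \<le> \<eta> * L2_set v {..<n}"
      and EX: "\<And>i l. i < n \<Longrightarrow> l < d \<Longrightarrow> \<bar>\<Sum>j<n. (A $$ (i, j) - (\<Sum>l<d. X i l * J l * X j l)) * X j l\<bar> \<le> \<theta>"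
      and \<eta>: "0 \<le> \<eta>" "\<eta> \<le> \<delta> * real n" and \<theta>: "0 \<le> \<theta>"
    have n: "real n > 0" using d dn by simp
    define \<tau> where "\<tau> = c * real n / 2"
    have \<tau>: "\<tau> > 0" using n c by (simp add: \<tau>_def)
    define \<epsilon> where "\<epsilon> = \<eta> / \<tau>"
    have eps: "\<epsilon> = 2 / c * (\<eta> / real n)" by (simp add: \<epsilon>_def \<tau>_def)
    have epsn: "\<eta> / real n \<le> \<delta>" using \<eta> n by (simp add: pos_divide_le_eq)
    have eps0: "\<epsilon> \<ge> 0" using \<eta> \<tau> by (simp add: \<epsilon>_def)
    have eps1: "\<epsilon> \<le> \<delta>g"
    proof -
      have "\<eta> / real n \<le> c * \<delta>g / 2" using epsn by (simp add: \<delta>_def)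
      then have "2 / c * (\<eta> / real n) \<le> 2 / c * (c * \<delta>g / 2)" using c by (intro mult_left_mono) auto
      then show ?thesis unfolding eps using c by simp
    qed
    have eps2: "\<epsilon> * real d < 1"
    proof -
      have "\<eta> / real n \<le> c / (4 * real d)" using epsn by (simp add: \<delta>_def)
      then have "2 / c * (\<eta> / real n) \<le> 2 / c * (c / (4 * real d))" using c by (intro mult_left_mono) auto
      then have "\<epsilon> * real d \<le> 2 / c * (c / (4 * real d)) * real d" unfolding eps by (intro mult_right_mono) auto
      also have "\<dots> = 1 / 2" using c d by simp
      finally show ?thesis by simp
    qed
    have \<eta>\<tau>: "\<tau> \<le> c * real n - \<eta>"
    proof -
      have "\<eta> / real n \<le> c / 2" using epsn by (simp add: \<delta>_def)
      then have "\<eta> \<le> c / 2 * real n" using n by (simp add: pos_divide_le_eq)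
      then show ?thesis by (simp add: \<tau>_def)
    qed
    define E where "E i j = A $$ (i, j) - (\<Sum>l<d. X i l * J l * X j l)" for i j
    obtain es where es: "char_poly A = (\<Prod>e\<leftarrow>es. [:- e, 1:])"
      "\<And>i j. i < d \<Longrightarrow> j \<in> {d..<n} \<Longrightarrow> \<bar>es ! j\<bar> \<le> \<bar>es ! i\<bar>"
      "\<And>i j. i < d \<Longrightarrow> j < d \<Longrightarrow> es ! i > 0 \<Longrightarrow> es ! j < 0 \<Longrightarrow> i < j"
      "Y \<in> carrier_mat n d"
      "\<And>k m. k < d \<Longrightarrow> m < d \<Longrightarrow> (\<Sum>i<n. Y $$ (i, k) * Y $$ (i, m)) = (if k = m then \<bar>es ! k\<bar> else 0)"
      "\<And>i k. i < n \<Longrightarrow> k < d \<Longrightarrow> (\<Sum>j<n. A $$ (i, j) * Y $$ (j, k)) = es ! k * Y $$ (i, k)"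
      using spectral_embedding_entries[OF emb A] by blast
    have large: "\<tau> \<le> \<bar>es ! k\<bar>" if k: "k < d" for k
    proof (rule leading_eigenvalues_large[OF A symA es(1,2) dn _ _ _ k])
      show "\<exists>i<n. (\<Sum>k<d. X i k * v k) \<noteq> 0" if "\<exists>k<d. v k \<noteq> 0" for v
      proof (rule ccontr)
        assume "\<not> ?thesis"
        then have "L2_set (\<lambda>i. \<Sum>k<d. X i k * v k) {..<n} = 0" by (auto simp: L2_set_eq_0_iff)
        then have "sqrt (c * real n) * L2_set v {..<d} \<le> 0" using low[of v] by simp
        then have "L2_set v {..<d} \<le> 0" using c n by (simp add: mult_le_0_iff)
        then have "L2_set v {..<d} = 0" using L2_set_nonneg[of v "{..<d}"] by linarith
        then show False using that by (auto simp: L2_set_eq_0_iff)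
      qed
      show "\<tau> * L2_set (\<lambda>i. \<Sum>k<d. X i k * v k) {..<n}
        \<le> L2_set (\<lambda>i. \<Sum>j<n. A $$ (i, j) * (\<Sum>k<d. X j k * v k)) {..<n}" for v
      proof -
        let ?x = "\<lambda>i. \<Sum>k<d. X i k * v k"
        have "c * real n * L2_set ?x {..<n} \<le> L2_set (\<lambda>i. \<Sum>j<n. (\<Sum>l<d. X i l * J l * X j l) * ?x j) {..<n}"
          using low_rank_lower_bound[where J = J and s = "sqrt (c * real n)" and X = X and v = v and n = n and d = d, OF J low] c n
          by simp
        moreover have "L2_set (\<lambda>i. \<Sum>j<n. E i j * ?x j) {..<n} \<le> \<eta> * L2_set ?x {..<n}"
          unfolding E_def by (rule Eop)
        moreover have "(\<lambda>i. \<Sum>j<n. A $$ (i, j) * ?x j)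
            = (\<lambda>i. (\<Sum>j<n. (\<Sum>l<d. X i l * J l * X j l) * ?x j) + (\<Sum>j<n. E i j * ?x j))"
          by (simp add: E_def sum.distrib[symmetric] distrib_right[symmetric])
        ultimately have "(c * real n - \<eta>) * L2_set ?x {..<n} \<le> L2_set (\<lambda>i. \<Sum>j<n. A $$ (i, j) * ?x j) {..<n}"
          using L2_set_triangle_diff[of "\<lambda>i. \<Sum>j<n. (\<Sum>l<d. X i l * J l * X j l) * ?x j" "{..<n}" "\<lambda>i. \<Sum>j<n. E i j * ?x j"]
          by (simp add: left_diff_distrib)
        moreover have "\<tau> * L2_set ?x {..<n} \<le> (c * real n - \<eta>) * L2_set ?x {..<n}"
          using \<eta>\<tau> by (intro mult_right_mono) auto
        ultimately show ?thesis by linarith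
      qed
    qed (use \<tau> in auto)
    have AY: "(\<Sum>j<n. ((\<Sum>l<d. X i l * J l * X j l) + E i j) * Y $$ (j, k)) = es ! k * Y $$ (i, k)"
      if "i < n" "k < d" for i k
      using es(6)[OF that] by (simp add: E_def)
    note Eop' = Eop[folded E_def] and EX' = EX[folded E_def]
    have "\<exists>K R. (\<forall>i k. i < n \<longrightarrow> k < d \<longrightarrow> Y $$ (i, k) = (\<Sum>l<d. X i l * K l k) + R i k) \<and>
      (\<forall>l k. l < d \<longrightarrow> k < d \<longrightarrow> \<bar>K l k\<bar> \<le> B * sqrt n / sqrt \<tau>) \<and>
      (\<forall>k m. k < d \<longrightarrow> m < d \<longrightarrow>
         \<bar>(\<Sum>l<d. J l * K l k * K l m) - (if k = m then sgn (es ! k) else 0)\<bar> \<le> \<eta> / \<tau>) \<and>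
      (\<forall>i k. i < n \<longrightarrow> k < d \<longrightarrow>
         \<bar>R i k\<bar> \<le> (real d * (\<theta> * (B * sqrt n / sqrt \<tau>)) + \<eta> * (\<eta> / sqrt \<tau>)) / \<tau>)"
    proof (rule eigenvector_expansion[where Y = "\<lambda>i k. Y $$ (i, k)" and lam = "\<lambda>k. es ! k" and J = J and X = X and E = E
              and n = n and d = d and \<tau> = \<tau> and B = B and \<eta> = \<eta> and \<theta> = \<theta>], goal_cases)
      case (12 K R)
      show ?case
        by (rule exI[of _ K], rule exI[of _ R]) (intro conjI allI impI; (rule 12; assumption))
    qed (fact J AY es(5) large \<tau> XB B Eop' \<eta>(1) EX' \<theta>)+
    then obtain K R where KR: "\<forall>i k. i < n \<longrightarrow> k < d \<longrightarrow> Y $$ (i, k) = (\<Sum>l<d. X i l * K l k) + R i k"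
      "\<forall>l k. l < d \<longrightarrow> k < d \<longrightarrow> \<bar>K l k\<bar> \<le> B * sqrt n / sqrt \<tau>"
      "\<forall>k m. k < d \<longrightarrow> m < d \<longrightarrow>
         \<bar>(\<Sum>l<d. J l * K l k * K l m) - (if k = m then sgn (es ! k) else 0)\<bar> \<le> \<eta> / \<tau>"
      "\<forall>i k. i < n \<longrightarrow> k < d \<longrightarrow>
         \<bar>R i k\<bar> \<le> (real d * (\<theta> * (B * sqrt n / sqrt \<tau>)) + \<eta> * (\<eta> / sqrt \<tau>)) / \<tau>"
      by (elim exE conjE) (rule that; assumption)
    note Y = KR(1)[rule_format] and KB0 = KR(2)[rule_format] and gram = KR(3)[rule_format] and RB0 = KR(4)[rule_format]
    have st: "1 / sqrt \<tau> = sqrt (2 / c) / sqrt n"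
      using c n by (simp add: \<tau>_def real_sqrt_divide real_sqrt_mult)
    have "B * sqrt n / sqrt \<tau> = B * sqrt n * (1 / sqrt \<tau>)" by simp
    also have "\<dots> = BK" unfolding st using n by (simp add: BK_def)
    finally have BKe: "B * sqrt n / sqrt \<tau> = BK" .
    have KB: "\<bar>K l k\<bar> \<le> BK" if "l < d" "k < d" for l k using KB0[OF that] BKe by simp
    have sg: "sgn (es ! k) = J k" if "k < d" for k
      unfolding J_def
    proof (rule inertia_sorted[where K = K and \<epsilon> = \<epsilon> and q = q])
      show "es ! k \<noteq> 0" if "k < p + q" for k using large[of k] \<tau> that by (auto simp: d_def)
      show "\<bar>(\<Sum>l<p + q. (if l < p then 1 else -1) * K l k * K l m) - (if k = m then sgn (es ! k) else 0)\<bar> \<le> \<epsilon>"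
        if "k < p + q" "m < p + q" for k m
        using gram[of k m] that unfolding d_def J_def \<epsilon>_def by blast
      show "i < j" if "i < p + q" "j < p + q" "es ! i > 0" "es ! j < 0" for i j
        using es(3)[of i j] that unfolding d_def by blast
      show "k < p + q" using that by (simp add: d_def)
    qed (use eps0 eps2 in \<open>simp_all add: d_def\<close>)
    \<comment> \<open>With the signs of the eigenvalues identified as \<open>J\<close>, the columns
      of \<open>K\<close> are nearly orthonormal for the form that defines the group, as
      Gram-Schmidt requires.\<close>
    have gramJ: "\<bar>indef_inner d J (\<lambda>l. K l a) (\<lambda>l. K l b) - (if a = b then J a else 0)\<bar> \<le> \<epsilon>"
      if "a < d" "b < d" for a b
      using gram[OF that] unfolding indef_inner_def \<epsilon>_def sg[OF that(1)] .
    have "\<exists>V. (\<forall>a<d. \<forall>l<d. \<bar>V a l - (\<lambda>a l. K l a) a l\<bar> \<le> Cg * \<epsilon>) \<and>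
          (\<forall>a<d. \<forall>b<d. indef_inner d J (V a) (V b) = (if a = b then J a else 0))"
      by (rule gs[THEN spec[of _ \<epsilon>], THEN spec[of _ "\<lambda>a l. K l a"], THEN mp, THEN mp, THEN mp, THEN mp, OF eps0 eps1])
         (intro allI impI KB gramJ; assumption)+
    then obtain V where V0: "\<forall>a<d. \<forall>l<d. \<bar>V a l - K l a\<bar> \<le> Cg * \<epsilon>"
      "\<forall>a<d. \<forall>b<d. indef_inner d J (V a) (V b) = (if a = b then J a else 0)"
      by (elim exE conjE) (rule that; assumption)
    have V1: "\<bar>K l a - V a l\<bar> \<le> Cg * \<epsilon>" if "a < d" "l < d" for a l
      using V0(1) that by (simp add: abs_minus_commute)
    have V2: "\<bar>V a l\<bar> \<le> BQ" if "a < d" "l < d" for a l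
    proof -
      have "Cg * \<epsilon> \<le> Cg * \<delta>g" using Cg eps1 by (intro mult_left_mono) auto
      then show ?thesis using V1[OF that] KB[OF that(2,1)] unfolding BQ_def by linarith
    qed
    define Q where "Q = Matrix.mat d d (\<lambda>(a, l). J a * V a l * J l)"
    have Qio: "Q \<in> indefinite_orthogonal p q"
      and VQ: "\<And>l m. l < d \<Longrightarrow> m < d \<Longrightarrow> (\<Sum>a<d. V a l * Q $$ (a, m)) = (if l = m then 1 else 0)"
      using indefinite_orthogonal_of_family[of p q V] V0(2) unfolding Q_def d_def J_def by auto
    have QB: "\<bar>Q $$ (a, m)\<bar> \<le> BQ" if "a < d" "m < d" for a m
      using V2[OF that] that J by (simp add: Q_def abs_mult)
    define rate where "rate = \<eta> / real n + \<theta> / real n + \<eta>\<^sup>2 / (real n * sqrt (real n))"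
    have rates: "0 \<le> \<eta> / real n" "0 \<le> \<theta> / real n" "0 \<le> \<eta>\<^sup>2 / (real n * sqrt (real n))"
      using \<eta> \<theta> n by auto
    have RB: "\<bar>R i k\<bar> \<le> C2 * (\<theta> / real n) + C3 * (\<eta>\<^sup>2 / (real n * sqrt (real n)))" if "i < n" "k < d" for i k
    proof -
      have "(real d * (\<theta> * BK) + \<eta> * (\<eta> / sqrt \<tau>)) / \<tau> = (real d * (\<theta> * BK) + \<eta> * \<eta> * (1 / sqrt \<tau>)) / \<tau>" by simp
      also have "\<dots> = C2 * (\<theta> / real n) + C3 * (\<eta>\<^sup>2 / (real n * sqrt (real n)))"
        unfolding st using n c by (simp add: C2_def C3_def \<tau>_def power2_eq_square field_simps)
      finally show ?thesis using RB0[OF that] BKe by simp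
    qed
    have "\<bar>(Y * Q) $$ (i, m) - X i m\<bar> \<le> C * rate" if im: "i < n" "m < d" for i m
    proof -
      define D where "D a = (\<Sum>l<d. X i l * (K l a - V a l)) + R i a" for a
      have Qc: "Q \<in> carrier_mat d d" by (simp add: Q_def)
      have "X i m = (\<Sum>l<d. X i l * (\<Sum>a<d. V a l * Q $$ (a, m)))"
        using im by (simp add: VQ if_distrib[of "\<lambda>x. _ * x"] cong: if_cong)
      also have "\<dots> = (\<Sum>a<d. (\<Sum>l<d. X i l * V a l) * Q $$ (a, m))"
        unfolding sum_distrib_left sum_distrib_right by (subst sum.swap) (simp add: mult_ac)
      finally have Xe: "X i m = (\<Sum>a<d. (\<Sum>l<d. X i l * V a l) * Q $$ (a, m))" .
      have "(Y * Q) $$ (i, m) = (\<Sum>a<d. Y $$ (i, a) * Q $$ (a, m))"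
        using im es(4) Qc by (simp add: scalar_prod_def atLeast0LessThan)
      then have "(Y * Q) $$ (i, m) - X i m = (\<Sum>a<d. (Y $$ (i, a) - (\<Sum>l<d. X i l * V a l)) * Q $$ (a, m))"
        unfolding Xe by (simp add: left_diff_distrib sum_subtractf)
      also have "\<dots> = (\<Sum>a<d. D a * Q $$ (a, m))"
        using Y im by (intro sum.cong refl) (simp add: D_def right_diff_distrib sum_subtractf)
      also have "\<bar>\<dots>\<bar> \<le> (\<Sum>a<d. (C1 + C2 + C3) * rate * BQ)"
      proof (rule order_trans[OF sum_abs], rule sum_mono)
        fix a assume "a \<in> {..<d}"
        then have a: "a < d" by simp
        have "\<bar>\<Sum>l<d. X i l * (K l a - V a l)\<bar> \<le> (\<Sum>l<d. B * (Cg * \<epsilon>))"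
        proof (rule order_trans[OF sum_abs], rule sum_mono)
          fix l assume "l \<in> {..<d}"
          then show "\<bar>X i l * (K l a - V a l)\<bar> \<le> B * (Cg * \<epsilon>)"
            unfolding abs_mult using XB[OF im(1)] V1[OF a] B by (intro mult_mono) auto
        qed
        also have "\<dots> = C1 * (\<eta> / real n)" by (simp add: C1_def eps mult_ac)
        finally have "\<bar>D a\<bar> \<le> C1 * (\<eta> / real n) + (C2 * (\<theta> / real n) + C3 * (\<eta>\<^sup>2 / (real n * sqrt (real n))))"
          using RB[OF im(1) a] unfolding D_def by linarith
        also have "\<dots> \<le> C1 * rate + (C2 * rate + C3 * rate)"
          using rates Cs unfolding rate_def by (intro add_mono mult_left_mono) linarith+
        finally have "\<bar>D a\<bar> \<le> (C1 + C2 + C3) * rate" by (simp add: algebra_simps)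
        moreover have "(C1 + C2 + C3) * rate \<ge> 0" using Cs rates unfolding rate_def by simp
        ultimately show "\<bar>D a * Q $$ (a, m)\<bar> \<le> (C1 + C2 + C3) * rate * BQ"
          unfolding abs_mult using QB[OF a im(2)] by (intro mult_mono) auto
      qed
      also have "\<dots> = C * rate" by (simp add: C_def mult_ac)
      finally show ?thesis .
    qed
    with Qio show "\<exists>Q\<in>indefinite_orthogonal p q. \<forall>i<n. \<forall>l<d.
        \<bar>(Y * Q) $$ (i, l) - X i l\<bar> \<le> C * (\<eta> / real n + \<theta> / real n + \<eta>\<^sup>2 / (real n * sqrt (real n)))"
      unfolding rate_def by blast
  qed
qed

section \<open>The law of the entries given the latent variables\<close>

text \<open>Coordinates of a product measure are independent, so Hoeffding's inequality applies
  directly. \<open>V\<close> is only an upper bound for the sum of squares: the coefficients will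
  depend on the latent values, while the tail has to be uniform in them.\<close>

lemma Hoeffding_PiM:
  fixes N :: "'e \<Rightarrow> real measure" and g :: "real \<Rightarrow> real" and c :: "'e \<Rightarrow> real"
  assumes I: "finite I" and N: "\<And>e. e \<in> I \<Longrightarrow> prob_space (N e)" "\<And>e. e \<in> I \<Longrightarrow> sets (N e) = sets borel"
    and g: "g \<in> borel_measurable borel" "\<And>x. \<bar>g x\<bar> \<le> L" and L: "L > 0"
    and c: "(\<Sum>e\<in>I. (c e)\<^sup>2) \<le> V" and V: "V > 0" and t: "t > 0"
  shows "measure (PiM I N) {a\<in>space (PiM I N). t \<le> \<bar>\<Sum>e\<in>I. c e * (g (a e) - (\<integral>x. g x \<partial>N e))\<bar>}
      \<le> 2 * exp (- t\<^sup>2 / (2 * L\<^sup>2 * V))"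
proof (cases "(\<Sum>e\<in>I. (c e)\<^sup>2) = 0")
  \<comment> \<open>Treated apart because the variance proxy would be 0; the event is then empty, as
    t is positive.\<close>
  case True
  then have "c e = 0" if "e \<in> I" for e using I that by (simp add: sum_nonneg_eq_0_iff)
  then have "{a\<in>space (PiM I N). t \<le> \<bar>\<Sum>e\<in>I. c e * (g (a e) - (\<integral>x. g x \<partial>N e))\<bar>} = {}"
    using t by auto
  then show ?thesis by (simp only: measure_empty) simp
next
  case False
  then have pos: "(\<Sum>e\<in>I. (c e)\<^sup>2) > 0" using sum_nonneg[of I "\<lambda>e. (c e)\<^sup>2"] by fastforce
  have Ine: "I \<noteq> {}" using False by auto
  interpret P: prob_space "PiM I N" by (intro prob_space_PiM N)
  have gm: "(\<lambda>a. a e) \<in> borel_measurable (PiM I N)" if "e \<in> I" for e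
    using measurable_component_singleton[of e I N] that N(2)[OF that] by (simp cong: measurable_cong_sets)
  have gm': "(\<lambda>a. g (a e)) \<in> borel_measurable (PiM I N)" if "e \<in> I" for e
    using gm[OF that] g(1) by (rule measurable_compose)
  have distr_e: "distr (PiM I N) borel (\<lambda>a. a e) = N e" if "e \<in> I" for e
  proof -
    have "distr (PiM I N) borel (\<lambda>a. a e) = distr (PiM I N) (N e) (\<lambda>a. a e)"
      using N(2)[OF that] by (intro distr_cong) auto
    then show ?thesis using distr_PiM_component[of I N e] N(1) that by simp
  qed
  have "P.indep_vars (\<lambda>_. borel) (\<lambda>e a. a e) I"
  proof (subst P.indep_vars_iff_distr_eq_PiM'[OF Ine])
    show "(\<lambda>a. a e) \<in> borel_measurable (PiM I N)" if "e \<in> I" for e using gm[OF that] .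
    have "distr (PiM I N) (Pi\<^sub>M I (\<lambda>_. borel)) (\<lambda>x. \<lambda>e\<in>I. x e) = distr (PiM I N) (PiM I N) (\<lambda>x. x)"
      using N(2) by (intro distr_cong sets_PiM_cong) (auto simp: space_PiM PiE_iff extensional_def fun_eq_iff restrict_def)
    also have "\<dots> = PiM I N" by (rule distr_id)
    also have "\<dots> = (\<Pi>\<^sub>M e\<in>I. distr (PiM I N) borel (\<lambda>a. a e))"
      using distr_e by (intro PiM_cong) auto
    finally show "distr (PiM I N) (Pi\<^sub>M I (\<lambda>_. borel)) (\<lambda>x. \<lambda>e\<in>I. x e) = (\<Pi>\<^sub>M e\<in>I. distr (PiM I N) borel (\<lambda>a. a e))" .
  qed
  then have indep: "P.indep_vars (\<lambda>_. borel) (\<lambda>e a. c e * g (a e)) I"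
    by (rule P.indep_vars_compose2[where Y = "\<lambda>e x. c e * g x"]) (use g(1) in measurable)
  have ex: "P.expectation (\<lambda>a. c e * g (a e)) = c e * (\<integral>x. g x \<partial>N e)" if "e \<in> I" for e
  proof -
    have "(\<integral>x. g x \<partial>N e) = (\<integral>a. g (a e) \<partial>PiM I N)"
      unfolding distr_e[OF that, symmetric] using g(1) gm[OF that] by (subst integral_distr) auto
    then show ?thesis by simp
  qed
  interpret H: Hoeffding_ineq "PiM I N" I "\<lambda>e a. c e * g (a e)" "\<lambda>e. - \<bar>c e\<bar> * L" "\<lambda>e. \<bar>c e\<bar> * L"
    "\<Sum>e\<in>I. c e * (\<integral>x. g x \<partial>N e)"
  proof unfold_locales
    show "finite I" by fact
    show "P.indep_vars (\<lambda>_. borel) (\<lambda>e a. c e * g (a e)) I" by fact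
    have "\<bar>c e * g x\<bar> \<le> \<bar>c e\<bar> * L" for e x unfolding abs_mult by (intro mult_left_mono g(2)) auto
    then have "c e * g x \<in> {- \<bar>c e\<bar> * L..\<bar>c e\<bar> * L}" for e x by (simp add: abs_le_iff minus_le_iff)
    then show "AE x in PiM I N. c i * g (x i) \<in> {- \<bar>c i\<bar> * L..\<bar>c i\<bar> * L}" for i by simp
    show "(\<Sum>e\<in>I. c e * (\<integral>x. g x \<partial>N e)) \<equiv> \<Sum>i\<in>I. P.expectation (\<lambda>a. c i * g (a i))"
      by (intro eq_reflection sum.cong refl) (simp only: ex)
  qed
  \<comment> \<open>Each summand ranges over an interval of length 2 |c e| L, whence the final
    exponent -t^2 / (2 L^2 V).\<close>
  have w: "(\<Sum>e\<in>I. (\<bar>c e\<bar> * L - - \<bar>c e\<bar> * L)\<^sup>2) = 4 * L\<^sup>2 * (\<Sum>e\<in>I. (c e)\<^sup>2)"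
    unfolding sum_distrib_left by (intro sum.cong refl) (simp add: power2_eq_square)
  have "(\<Sum>e\<in>I. c e * (g (a e) - (\<integral>x. g x \<partial>N e))) = (\<Sum>e\<in>I. c e * g (a e)) - (\<Sum>e\<in>I. c e * (\<integral>x. g x \<partial>N e))" for a
    by (simp add: right_diff_distrib sum_subtractf)
  then have "measure (PiM I N) {a\<in>space (PiM I N). t \<le> \<bar>\<Sum>e\<in>I. c e * (g (a e) - (\<integral>x. g x \<partial>N e))\<bar>}
     \<le> 2 * exp (- 2 * t\<^sup>2 / (4 * L\<^sup>2 * (\<Sum>e\<in>I. (c e)\<^sup>2)))"
    using H.Hoeffding_ineq_abs_ge[of t] t L pos unfolding w by simp
  also have "- 2 * t\<^sup>2 / (4 * L\<^sup>2 * (\<Sum>e\<in>I. (c e)\<^sup>2)) \<le> - t\<^sup>2 / (2 * L\<^sup>2 * V)"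
  proof -
    have "t\<^sup>2 / (2 * L\<^sup>2 * V) \<le> t\<^sup>2 / (2 * L\<^sup>2 * (\<Sum>e\<in>I. (c e)\<^sup>2))"
      using L pos c by (intro divide_left_mono mult_left_mono mult_pos_pos) auto
    then show ?thesis by simp
  qed
  finally show ?thesis by simp
qed

definition upper_pairs :: "nat \<Rightarrow> (nat \<times> nat) set" where
  "upper_pairs n = {(i, j). i < j \<and> j < n}"

lemma finite_upper_pairs [simp]: "finite (upper_pairs n)"
  by (rule finite_subset[of _ "{..<n} \<times> {..<n}"]) (auto simp: upper_pairs_def)

context wgrdpg_family
begin

lemma H_prob: "z1 \<in> space F \<Longrightarrow> z2 \<in> space F \<Longrightarrow> prob_space (H z1 z2)"
  and sets_H: "z1 \<in> space F \<Longrightarrow> z2 \<in> space F \<Longrightarrow> sets (H z1 z2) = sets borel"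
  using measurable_space[OF H_kernel, of "(z1, z2)"]
  by (auto simp: space_pair_measure space_prob_algebra)

lemma H_kernel_comp:
  assumes "f \<in> N \<rightarrow>\<^sub>M F" "g \<in> N \<rightarrow>\<^sub>M F"
  shows "(\<lambda>x. H (f x) (g x)) \<in> N \<rightarrow>\<^sub>M prob_algebra borel"
  using measurable_compose[OF measurable_Pair[OF assms] H_kernel] by simp

text \<open>The conditional law of the entries above the diagonal given the latent values
  \<open>z\<close>, kept as a kernel in \<open>z\<close> so that it can be integrated against the
  law of the latent variables.\<close>

definition noise_kernel :: "nat \<Rightarrow> (nat \<Rightarrow> 'z) \<Rightarrow> (nat \<times> nat \<Rightarrow> real) measure" where
  "noise_kernel n z = (\<Pi>\<^sub>M e\<in>upper_pairs n. H (z (fst e)) (z (snd e)))"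

lemma space_PiM_F: "z \<in> space (\<Pi>\<^sub>M i\<in>{..<n}. F) \<Longrightarrow> i < n \<Longrightarrow> z i \<in> space F"
  by (auto simp: space_PiM)

lemma upper_pairs_space:
  assumes "z \<in> space (\<Pi>\<^sub>M i\<in>{..<n}. F)" "e \<in> upper_pairs n"
  shows "z (fst e) \<in> space F" "z (snd e) \<in> space F"
  using assms by (auto simp: upper_pairs_def intro!: space_PiM_F)

lemma noise_kernel_prob: "z \<in> space (\<Pi>\<^sub>M i\<in>{..<n}. F) \<Longrightarrow> prob_space (noise_kernel n z)"
  unfolding noise_kernel_def by (intro prob_space_PiM H_prob upper_pairs_space)

lemma sets_noise_kernel: "z \<in> space (\<Pi>\<^sub>M i\<in>{..<n}. F) \<Longrightarrow>
    sets (noise_kernel n z) = sets (\<Pi>\<^sub>M e\<in>upper_pairs n. borel)"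
  unfolding noise_kernel_def by (intro sets_PiM_cong refl sets_H upper_pairs_space)

lemma emeasure_noise_kernel_box:
  assumes z: "z \<in> space (\<Pi>\<^sub>M i\<in>{..<n}. F)" and B: "\<And>e. e \<in> upper_pairs n \<Longrightarrow> B e \<in> sets borel"
  shows "emeasure (noise_kernel n z) (Pi\<^sub>E (upper_pairs n) B)
     = (\<Prod>e\<in>upper_pairs n. emeasure (H (z (fst e)) (z (snd e))) (B e))"
proof -
  let ?N = "\<lambda>e. H (z (fst e)) (z (snd e))"
  have B': "B e \<in> sets (?N e)" if "e \<in> upper_pairs n" for e
    using B that sets_H upper_pairs_space[OF z] by auto
  have "emeasure (noise_kernel n z) (prod_emb (upper_pairs n) ?N (upper_pairs n) (Pi\<^sub>E (upper_pairs n) B))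
    = (\<Prod>e\<in>upper_pairs n. emeasure (?N e) (B e))"
    unfolding noise_kernel_def
    by (rule emeasure_PiM_emb) (use upper_pairs_space[OF z] H_prob B' in auto)
  then show ?thesis
    using B'[THEN sets.sets_into_space] by (subst (asm) prod_emb_PiE_same_index) auto
qed

text \<open>Boxes form an intersection-stable generator, and on a box the kernel is a finite product
  of measurable evaluations of \<open>H\<close>.\<close>

lemma noise_kernel_measurable:
  "noise_kernel n \<in> (\<Pi>\<^sub>M i\<in>{..<n}. F) \<rightarrow>\<^sub>M prob_algebra (\<Pi>\<^sub>M e\<in>upper_pairs n. borel)"
proof (rule measurable_prob_algebra_generated[OF sets_PiM Int_stable_prod_algebra prod_algebra_sets_into_space
      noise_kernel_prob sets_noise_kernel])
  fix A :: "(nat \<times> nat \<Rightarrow> real) set"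
  assume "A \<in> prod_algebra (upper_pairs n) (\<lambda>_. borel)"
  then obtain B where A: "A = Pi\<^sub>E (upper_pairs n) B" and B: "B \<in> (\<Pi> e\<in>upper_pairs n. sets borel)"
    by (auto simp: prod_algebra_eq_finite)
  have "(\<lambda>z. \<Prod>e\<in>upper_pairs n. emeasure (H (z (fst e)) (z (snd e))) (B e)) \<in> borel_measurable (\<Pi>\<^sub>M i\<in>{..<n}. F)"
  proof (rule borel_measurable_prod_ennreal)
    fix e assume e: "e \<in> upper_pairs n"
    then have ij: "fst e \<in> {..<n}" "snd e \<in> {..<n}" by (auto simp: upper_pairs_def)
    have "(\<lambda>z. H (z (fst e)) (z (snd e))) \<in> (\<Pi>\<^sub>M i\<in>{..<n}. F) \<rightarrow>\<^sub>M subprob_algebra borel"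
      using ij by (intro measurable_prob_algebraD H_kernel_comp measurable_component_singleton)
    then show "(\<lambda>z. emeasure (H (z (fst e)) (z (snd e))) (B e)) \<in> borel_measurable (\<Pi>\<^sub>M i\<in>{..<n}. F)"
      using B e by (intro measurable_emeasure_subprob_algebra[THEN measurable_compose[rotated]]) auto
  qed
  then show "(\<lambda>z. emeasure (noise_kernel n z) A) \<in> borel_measurable (\<Pi>\<^sub>M i\<in>{..<n}. F)"
    unfolding A using B by (subst measurable_cong[OF emeasure_noise_kernel_box]) auto
qed auto

end

section \<open>Disintegration of the joint law of latent variables and entries\<close>

context wgrdpg
begin

definition latent :: "nat \<Rightarrow> 'w \<Rightarrow> nat \<Rightarrow> 'z" where
  "latent n \<omega> = (\<lambda>i\<in>{..<n}. Z i \<omega>)"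

definition entries :: "nat \<Rightarrow> 'w \<Rightarrow> nat \<times> nat \<Rightarrow> real" where
  "entries n \<omega> = (\<lambda>e\<in>upper_pairs n. A (fst e) (snd e) \<omega>)"

lemma Z_measurable [measurable]: "Z i \<in> M \<rightarrow>\<^sub>M F"
  using Z_indep by (auto simp: indep_vars_def)

lemma A_borel [measurable]: "A i j \<in> borel_measurable M"
  by (rule A_measurable)

lemma Z_space: "\<omega> \<in> space M \<Longrightarrow> Z i \<omega> \<in> space F"
  using measurable_space[OF Z_measurable] .

lemma latent_measurable [measurable]: "latent n \<in> M \<rightarrow>\<^sub>M (\<Pi>\<^sub>M i\<in>{..<n}. F)"
  unfolding latent_def by measurable

lemma entries_measurable [measurable]: "entries n \<in> M \<rightarrow>\<^sub>M (\<Pi>\<^sub>M e\<in>upper_pairs n. borel)"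
  unfolding entries_def by measurable

text \<open>\<open>A_cond_indep\<close> integrated over an event of the algebra generated by the
  latent variables: the conditional expectation of the indicator of a box is the product of the
  masses of its sides, and its integral over the event is the joint probability.\<close>

lemma cond_prob_box:
  assumes C: "C \<in> sets (\<Pi>\<^sub>M i\<in>{..<n}. F)" and B: "\<And>e. e \<in> upper_pairs n \<Longrightarrow> B e \<in> sets borel"
  shows "emeasure M {\<omega>\<in>space M. latent n \<omega> \<in> C \<and> entries n \<omega> \<in> Pi\<^sub>E (upper_pairs n) B}
    = (\<integral>\<^sup>+\<omega>. indicator C (latent n \<omega>) * emeasure (family.noise_kernel n (latent n \<omega>)) (Pi\<^sub>E (upper_pairs n) B) \<partial>M)"
proof -
  define G where "G = generated_algebra M F Z n"
  \<comment> \<open>The model assumption quantifies over families of Borel sets indexed by all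
    pairs, so the box is extended by the whole line off \<open>upper_pairs n\<close>.\<close>
  define B' where "B' i j = (if (i, j) \<in> upper_pairs n then B (i, j) else UNIV)" for i j
  have B'm: "B' i j \<in> sets borel" for i j using B by (auto simp: B'_def)
  have lat: "latent n = (\<lambda>\<omega>. \<lambda>i\<in>{..<n}. Z i \<omega>)" by (simp add: latent_def fun_eq_iff)
  have G: "G = vimage_algebra (space M) (latent n) (\<Pi>\<^sub>M i\<in>{..<n}. F)"
    unfolding G_def generated_algebra_def lat ..
  have latsp: "latent n \<in> space M \<rightarrow> space (\<Pi>\<^sub>M i\<in>{..<n}. F)"
    using measurable_space[OF latent_measurable] by auto
  have "subalgebra M G"
    unfolding subalgebra_def G
  proof
    show "space (vimage_algebra (space M) (latent n) (\<Pi>\<^sub>M i\<in>{..<n}. F)) = space M" by simp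
    show "sets (vimage_algebra (space M) (latent n) (\<Pi>\<^sub>M i\<in>{..<n}. F)) \<subseteq> sets M"
      unfolding sets_vimage_algebra2[OF latsp] using latent_measurable by (auto intro: measurable_sets)
  qed
  then interpret G: finite_measure_subalgebra M G by unfold_locales
  define C' where "C' = latent n -` C \<inter> space M"
  have C'G: "C' \<in> sets G" unfolding C'_def G using C by (rule in_vimage_algebra)
  have C'M: "C' \<in> sets M" unfolding C'_def using C by measurable
  define f where "f \<omega> = (\<Prod>(i, j)\<in>upper_pairs n. indicat_real (B' i j) (A i j \<omega>))" for \<omega>
  define h where "h \<omega> = (\<Prod>(i, j)\<in>upper_pairs n. measure (H (Z i \<omega>) (Z j \<omega>)) (B' i j))" for \<omega>
  have f01: "f \<omega> = indicat_real {\<omega>. \<forall>(i,j)\<in>upper_pairs n. A i j \<omega> \<in> B' i j} \<omega>" for \<omega>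
  proof (cases "\<forall>(i,j)\<in>upper_pairs n. A i j \<omega> \<in> B' i j")
    case True
    then show ?thesis unfolding f_def by (auto simp: indicator_def intro!: prod.neutral)
  next
    case False
    then obtain i j where "(i, j) \<in> upper_pairs n" "A i j \<omega> \<notin> B' i j" by auto
    then have "f \<omega> = 0" unfolding f_def by (intro prod_zero) (auto intro!: bexI[of _ "(i, j)"])
    then show ?thesis using False by simp
  qed
  have fm: "f \<in> borel_measurable M"
    unfolding f_def case_prod_beta using B'm
    by (intro borel_measurable_prod borel_measurable_indicator') auto
  have fint: "integrable M f"
    by (rule integrable_const_bound[where B = 1]) (use fm f01 in \<open>auto simp: indicator_def\<close>)
  have ae: "AE \<omega> in M. real_cond_exp M G f \<omega> = h \<omega>"
    using A_cond_indep[of B', OF B'm, of n] unfolding G_def f_def[abs_def] h_def upper_pairs_def .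
  have hm: "h \<in> borel_measurable M"
    unfolding h_def case_prod_beta
  proof (rule borel_measurable_prod)
    fix e :: "nat \<times> nat"
    have "(\<lambda>\<omega>. H (Z (fst e) \<omega>) (Z (snd e) \<omega>)) \<in> M \<rightarrow>\<^sub>M prob_algebra borel"
      by (intro family.H_kernel_comp Z_measurable)
    then show "(\<lambda>\<omega>. measure (H (Z (fst e) \<omega>) (Z (snd e) \<omega>)) (B' (fst e) (snd e))) \<in> borel_measurable M"
      using measurable_compose[OF _ measurable_measure_prob_algebra[OF B'm]] by blast
  qed
  have h01: "0 \<le> h \<omega>" "h \<omega> \<le> 1" if "\<omega> \<in> space M" for \<omega>
  proof -
    show "0 \<le> h \<omega>" unfolding h_def by (intro prod_nonneg) auto
    show "h \<omega> \<le> 1" unfolding h_def using that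
      by (intro prod_le_1) (auto intro!: prob_space.prob_le_1 family.H_prob Z_space)
  qed
  have "(\<integral>\<omega>\<in>C'. f \<omega> \<partial>M) = (\<integral>\<omega>\<in>C'. real_cond_exp M G f \<omega> \<partial>M)"
    by (rule G.real_cond_exp_intA[OF fint C'G])
  also have "\<dots> = (\<integral>\<omega>\<in>C'. h \<omega> \<partial>M)"
    unfolding set_lebesgue_integral_def
    by (rule integral_cong_AE) (use ae C'M hm in \<open>auto intro!: borel_measurable_scaleR\<close>)
  finally have eq: "(\<integral>\<omega>. indicat_real C' \<omega> * f \<omega> \<partial>M) = (\<integral>\<omega>. indicat_real C' \<omega> * h \<omega> \<partial>M)"
    by (simp add: set_lebesgue_integral_def)
  have S: "indicat_real C' \<omega> * f \<omega> = indicat_real {\<omega>\<in>space M. latent n \<omega> \<in> C \<and> entries n \<omega> \<in> Pi\<^sub>E (upper_pairs n) B} \<omega>"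
    if "\<omega> \<in> space M" for \<omega>
    using that unfolding f01
    by (auto simp: indicator_def C'_def entries_def B'_def PiE_iff split: if_splits)
  have Sm: "{\<omega>\<in>space M. latent n \<omega> \<in> C \<and> entries n \<omega> \<in> Pi\<^sub>E (upper_pairs n) B} \<in> sets M"
  proof -
    have "Pi\<^sub>E (upper_pairs n) B \<in> sets (\<Pi>\<^sub>M e\<in>upper_pairs n. borel)"
      using B by (intro sets_PiM_I_finite) auto
    then show ?thesis using C by measurable
  qed
  have "emeasure M {\<omega>\<in>space M. latent n \<omega> \<in> C \<and> entries n \<omega> \<in> Pi\<^sub>E (upper_pairs n) B}
     = ennreal (\<integral>\<omega>. indicat_real C' \<omega> * f \<omega> \<partial>M)"
    using Sm by (subst Bochner_Integration.integral_cong[OF refl S]) (auto simp: emeasure_eq_measure)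
  also have "\<dots> = (\<integral>\<^sup>+\<omega>. ennreal (indicat_real C' \<omega> * h \<omega>) \<partial>M)"
    unfolding eq
  proof (rule nn_integral_eq_integral[symmetric])
    have "(\<lambda>\<omega>. indicat_real C' \<omega> * h \<omega>) \<in> borel_measurable M" using C'M hm by measurable
    then show "integrable M (\<lambda>\<omega>. indicat_real C' \<omega> * h \<omega>)"
      by (rule integrable_const_bound[where B = 1, rotated]) (auto intro!: AE_I2 simp: h01 indicator_def)
    show "AE \<omega> in M. 0 \<le> indicat_real C' \<omega> * h \<omega>" by (auto intro!: AE_I2 simp: h01)
  qed
  also have "\<dots> = (\<integral>\<^sup>+\<omega>. indicator C (latent n \<omega>) * emeasure (family.noise_kernel n (latent n \<omega>)) (Pi\<^sub>E (upper_pairs n) B) \<partial>M)"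
  proof (rule nn_integral_cong)
    fix \<omega> assume w: "\<omega> \<in> space M"
    have lw: "latent n \<omega> \<in> space (\<Pi>\<^sub>M i\<in>{..<n}. F)" using latsp w by auto
    have "emeasure (family.noise_kernel n (latent n \<omega>)) (Pi\<^sub>E (upper_pairs n) B)
      = (\<Prod>e\<in>upper_pairs n. emeasure (H (latent n \<omega> (fst e)) (latent n \<omega> (snd e))) (B e))"
      using B by (rule family.emeasure_noise_kernel_box[OF lw])
    also have "\<dots> = (\<Prod>e\<in>upper_pairs n. ennreal (measure (H (Z (fst e) \<omega>) (Z (snd e) \<omega>)) (B' (fst e) (snd e))))"
    proof (rule prod.cong[OF refl])
      fix e assume e: "e \<in> upper_pairs n"
      interpret He: prob_space "H (Z (fst e) \<omega>) (Z (snd e) \<omega>)"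
        using w by (intro family.H_prob Z_space)
      show "emeasure (H (latent n \<omega> (fst e)) (latent n \<omega> (snd e))) (B e)
         = ennreal (measure (H (Z (fst e) \<omega>) (Z (snd e) \<omega>)) (B' (fst e) (snd e)))"
        using e by (auto simp: latent_def B'_def upper_pairs_def He.emeasure_eq_measure)
    qed
    also have "\<dots> = ennreal (h \<omega>)"
      unfolding h_def case_prod_beta by (intro prod_ennreal) auto
    finally show "ennreal (indicat_real C' \<omega> * h \<omega>)
       = indicator C (latent n \<omega>) * emeasure (family.noise_kernel n (latent n \<omega>)) (Pi\<^sub>E (upper_pairs n) B)"
      using w by (auto simp: C'_def indicator_def)
  qed
  finally show ?thesis .
qed

text \<open>Uniqueness of measures on an intersection-stable generator: latent events times boxes
  generate the product algebra, and on them \<open>cond_prob_box\<close> gives equality. The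
  extension to all joint events is what admits sums whose coefficients depend on the latent
  variables.\<close>

lemma joint_law:
  fixes n :: nat
  defines "PF \<equiv> (\<Pi>\<^sub>M i\<in>{..<n}. F)" and "PB \<equiv> (\<Pi>\<^sub>M e\<in>upper_pairs n. borel :: real measure)"
  shows "distr M (PF \<Otimes>\<^sub>M PB) (\<lambda>\<omega>. (latent n \<omega>, entries n \<omega>))
    = distr M PF (latent n) \<bind> (\<lambda>z. distr (family.noise_kernel n z) (PF \<Otimes>\<^sub>M PB) (Pair z))"
proof -
  let ?D = "distr M (PF \<Otimes>\<^sub>M PB) (\<lambda>\<omega>. (latent n \<omega>, entries n \<omega>))"
  let ?k = "\<lambda>z. distr (family.noise_kernel n z) (PF \<Otimes>\<^sub>M PB) (Pair z)"
  let ?N = "distr M PF (latent n)"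
  have lat: "latent n \<in> M \<rightarrow>\<^sub>M PF" unfolding PF_def by measurable
  have ent: "entries n \<in> M \<rightarrow>\<^sub>M PB" unfolding PB_def by measurable
  have km: "family.noise_kernel n \<in> PF \<rightarrow>\<^sub>M prob_algebra PB"
    unfolding PF_def PB_def by (rule family.noise_kernel_measurable)
  have k: "?k \<in> PF \<rightarrow>\<^sub>M prob_algebra (PF \<Otimes>\<^sub>M PB)"
    by (rule measurable_distr_prob_space2[OF km]) simp
  have N: "?N \<in> space (prob_algebra PF)"
    using prob_space_distr[OF lat] by (simp add: space_prob_algebra)
  have pairm: "(\<lambda>\<omega>. (latent n \<omega>, entries n \<omega>)) \<in> M \<rightarrow>\<^sub>M PF \<Otimes>\<^sub>M PB"
    using lat ent by (rule measurable_Pair)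
  define E where "E = {a \<times> b |a b. a \<in> sets PF \<and> b \<in> prod_algebra (upper_pairs n) (\<lambda>_. borel :: real measure)}"
  have PBsp: "space PB \<in> prod_algebra (upper_pairs n) (\<lambda>_. borel :: real measure)"
    unfolding PB_def space_PiM by (rule space_in_prod_algebra)
  have setsPB: "sets PB = sigma_sets (space PB) (prod_algebra (upper_pairs n) (\<lambda>_. borel :: real measure))"
    unfolding PB_def sets_PiM space_PiM ..
  have sets: "sets (PF \<Otimes>\<^sub>M PB) = sigma_sets (space PF \<times> space PB) E"
  proof -
    have paS: "prod_algebra (upper_pairs n) (\<lambda>_. borel :: real measure) \<subseteq> Pow (space PB)"
      unfolding PB_def space_PiM by (rule prod_algebra_sets_into_space)
    have "sets PF = sets (sigma (space PF) (sets PF))"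
      using sets.sigma_sets_eq[of PF] sets.space_closed[of PF] by (simp add: sets_measure_of)
    moreover have "sets PB = sets (sigma (space PB) (prod_algebra (upper_pairs n) (\<lambda>_. borel :: real measure)))"
      using setsPB paS by (simp add: sets_measure_of)
    ultimately have "sets (PF \<Otimes>\<^sub>M PB) = sets (sigma (space PF) (sets PF) \<Otimes>\<^sub>M
        sigma (space PB) (prod_algebra (upper_pairs n) (\<lambda>_. borel :: real measure)))"
      by (rule sets_pair_measure_cong)
    also have "\<dots> = sets (sigma (space PF \<times> space PB) E)"
      unfolding E_def
    proof (subst sigma_prod)
      show "\<exists>E\<subseteq>sets PF. countable E \<and> space PF = \<Union>E" by (intro exI[of _ "{space PF}"]) auto
      show "\<exists>E\<subseteq>prod_algebra (upper_pairs n) (\<lambda>_. borel :: real measure). countable E \<and> space PB = \<Union>E"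
        using PBsp by (intro exI[of _ "{space PB}"]) auto
    qed (use paS sets.space_closed[of PF] in auto)
    also have "\<dots> = sigma_sets (space PF \<times> space PB) E"
    proof (rule sets_measure_of)
      show "E \<subseteq> Pow (space PF \<times> space PB)"
        using sets.sets_into_space[of _ PF] prod_algebra_sets_into_space[of "upper_pairs n" "\<lambda>_. borel :: real measure"]
        by (fastforce simp: E_def PB_def space_PiM)
    qed
    finally show ?thesis .
  qed
  show ?thesis
  proof (rule measure_eqI_generator_eq[where E = E and \<Omega> = "space PF \<times> space PB" and A = "\<lambda>_. space PF \<times> space PB"])
    show "Int_stable E"
    proof (unfold Int_stable_def, intro ballI)
      fix x y assume "x \<in> E" "y \<in> E"
      then obtain a b a' b' where "x = a \<times> b" "y = a' \<times> b'" "a \<in> sets PF" "a' \<in> sets PF"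
         "b \<in> prod_algebra (upper_pairs n) (\<lambda>_. borel :: real measure)"
         "b' \<in> prod_algebra (upper_pairs n) (\<lambda>_. borel :: real measure)"
        by (auto simp: E_def)
      moreover from this have "b \<inter> b' \<in> prod_algebra (upper_pairs n) (\<lambda>_. borel :: real measure)"
        using Int_stable_prod_algebra[of "upper_pairs n" "\<lambda>_. borel :: real measure"] by (auto simp: Int_stable_def)
      ultimately show "x \<inter> y \<in> E"
        unfolding E_def Times_Int_Times
        by (intro CollectI exI[of _ "a \<inter> a'"] exI[of _ "b \<inter> b'"]) auto
    qed
    show "E \<subseteq> Pow (space PF \<times> space PB)"
      using sets.sets_into_space[of _ PF] prod_algebra_sets_into_space[of "upper_pairs n" "\<lambda>_. borel :: real measure"]
      by (fastforce simp: E_def PB_def space_PiM)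
    show "sets ?D = sigma_sets (space PF \<times> space PB) E" using sets by simp
    show "sets (?N \<bind> ?k) = sigma_sets (space PF \<times> space PB) E"
      using sets sets_bind'[OF N k] by simp
    show "range (\<lambda>_. space PF \<times> space PB) \<subseteq> E" using PBsp by (auto simp: E_def)
    show "\<Union> (range (\<lambda>_. space PF \<times> space PB)) = space PF \<times> space PB" by simp
    show "emeasure ?D (space PF \<times> space PB) \<noteq> \<infinity>" for i :: nat
      using finite_measure.emeasure_finite[OF prob_space.finite_measure[OF prob_space_distr[OF pairm]]] by simp
    fix S assume "S \<in> E"
    then obtain a B where S: "S = a \<times> Pi\<^sub>E (upper_pairs n) B" and a: "a \<in> sets PF"
      and B: "\<And>e. e \<in> upper_pairs n \<Longrightarrow> B e \<in> sets borel"
      by (auto simp: E_def prod_algebra_eq_finite)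
    have Bs: "Pi\<^sub>E (upper_pairs n) B \<in> sets PB"
      unfolding PB_def using B by (intro sets_PiM_I_finite) auto
    have Ss: "S \<in> sets (PF \<Otimes>\<^sub>M PB)" unfolding S using a Bs by simp
    have kS: "emeasure (?k z) S = indicator a z * emeasure (family.noise_kernel n z) (Pi\<^sub>E (upper_pairs n) B)"
      if z: "z \<in> space PF" for z
    proof -
      have "Pair z \<in> family.noise_kernel n z \<rightarrow>\<^sub>M PF \<Otimes>\<^sub>M PB"
        using z family.sets_noise_kernel[of z n] unfolding PF_def PB_def by (simp cong: measurable_cong_sets)
      then have "emeasure (?k z) S = emeasure (family.noise_kernel n z) (Pair z -` S \<inter> space (family.noise_kernel n z))"
        using Ss by (rule emeasure_distr)
      also have "Pair z -` S \<inter> space (family.noise_kernel n z) = (if z \<in> a then Pi\<^sub>E (upper_pairs n) B else {})"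
        using sets.sets_into_space[OF Bs] sets_eq_imp_space_eq[OF family.sets_noise_kernel[of z n]] z
        unfolding S PF_def PB_def by auto
      finally show ?thesis by auto
    qed
    have "emeasure ?D S = emeasure M {\<omega>\<in>space M. latent n \<omega> \<in> a \<and> entries n \<omega> \<in> Pi\<^sub>E (upper_pairs n) B}"
      using Ss by (subst emeasure_distr[OF pairm]) (auto simp: S intro!: arg_cong[where f = "emeasure M"])
    also have "\<dots> = (\<integral>\<^sup>+\<omega>. indicator a (latent n \<omega>) * emeasure (family.noise_kernel n (latent n \<omega>)) (Pi\<^sub>E (upper_pairs n) B) \<partial>M)"
      using a B unfolding PF_def by (rule cond_prob_box)
    also have "\<dots> = (\<integral>\<^sup>+\<omega>. emeasure (?k (latent n \<omega>)) S \<partial>M)"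
      using measurable_space[OF lat] by (intro nn_integral_cong) (simp add: kS)
    also have "\<dots> = (\<integral>\<^sup>+z. emeasure (?k z) S \<partial>?N)"
    proof (rule nn_integral_distr[symmetric, OF lat])
      show "(\<lambda>z. emeasure (?k z) S) \<in> borel_measurable ?N"
        using measurable_compose[OF measurable_prob_algebraD[OF k] measurable_emeasure_subprob_algebra[OF Ss]] by simp
    qed
    also have "\<dots> = emeasure (?N \<bind> ?k) S"
      by (rule emeasure_bind_prob_algebra[OF N k Ss, symmetric])
    finally show "emeasure ?D S = emeasure (?N \<bind> ?k) S" .
  qed
qed

text \<open>By \<open>joint_law\<close> the probability of a joint event is the average of its
  conditional probabilities, so a bound uniform in the latent values passes to the average.\<close>

lemma prob_le_of_conditional:
  fixes n :: nat
  defines "PF \<equiv> (\<Pi>\<^sub>M i\<in>{..<n}. F)" and "PB \<equiv> (\<Pi>\<^sub>M e\<in>upper_pairs n. borel :: real measure)"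
  assumes S: "S \<in> sets (PF \<Otimes>\<^sub>M PB)"
    and le: "\<And>z. z \<in> space PF \<Longrightarrow> measure (family.noise_kernel n z) {a\<in>space PB. (z, a) \<in> S} \<le> \<epsilon>" and eps: "\<epsilon> \<ge> 0"
  shows "prob {\<omega>\<in>space M. (latent n \<omega>, entries n \<omega>) \<in> S} \<le> \<epsilon>"
proof -
  let ?k = "\<lambda>z. distr (family.noise_kernel n z) (PF \<Otimes>\<^sub>M PB) (Pair z)"
  let ?N = "distr M PF (latent n)"
  have lat: "latent n \<in> M \<rightarrow>\<^sub>M PF" unfolding PF_def by measurable
  have ent: "entries n \<in> M \<rightarrow>\<^sub>M PB" unfolding PB_def by measurable
  have km: "family.noise_kernel n \<in> PF \<rightarrow>\<^sub>M prob_algebra PB"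
    unfolding PF_def PB_def by (rule family.noise_kernel_measurable)
  have k: "?k \<in> PF \<rightarrow>\<^sub>M prob_algebra (PF \<Otimes>\<^sub>M PB)"
    by (rule measurable_distr_prob_space2[OF km]) simp
  have N: "?N \<in> space (prob_algebra PF)"
    using prob_space_distr[OF lat] by (simp add: space_prob_algebra)
  interpret N: prob_space ?N by (rule prob_space_distr[OF lat])
  have pairm: "(\<lambda>\<omega>. (latent n \<omega>, entries n \<omega>)) \<in> M \<rightarrow>\<^sub>M PF \<Otimes>\<^sub>M PB"
    using lat ent by (rule measurable_Pair)
  have "emeasure M {\<omega>\<in>space M. (latent n \<omega>, entries n \<omega>) \<in> S}
     = emeasure (distr M (PF \<Otimes>\<^sub>M PB) (\<lambda>\<omega>. (latent n \<omega>, entries n \<omega>))) S"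
    using S by (subst emeasure_distr[OF pairm]) (auto intro!: arg_cong[where f = "emeasure M"])
  also have "\<dots> = emeasure (?N \<bind> ?k) S"
    unfolding PF_def PB_def by (subst joint_law) simp
  also have "\<dots> = (\<integral>\<^sup>+z. emeasure (?k z) S \<partial>?N)"
    by (rule emeasure_bind_prob_algebra[OF N k S])
  also have "\<dots> \<le> (\<integral>\<^sup>+z. ennreal \<epsilon> \<partial>?N)"
  proof (rule nn_integral_mono)
    fix z assume "z \<in> space ?N"
    then have z: "z \<in> space PF" by simp
    have sp: "space (family.noise_kernel n z) = space PB"
      using sets_eq_imp_space_eq[OF family.sets_noise_kernel[of z n]] z unfolding PF_def PB_def by simp
    interpret K: prob_space "family.noise_kernel n z" using z unfolding PF_def by (rule family.noise_kernel_prob)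
    have "Pair z \<in> family.noise_kernel n z \<rightarrow>\<^sub>M PF \<Otimes>\<^sub>M PB"
      using z family.sets_noise_kernel[of z n] unfolding PF_def PB_def by (simp cong: measurable_cong_sets)
    then have "emeasure (?k z) S = emeasure (family.noise_kernel n z) (Pair z -` S \<inter> space (family.noise_kernel n z))"
      using S by (rule emeasure_distr)
    also have "Pair z -` S \<inter> space (family.noise_kernel n z) = {a\<in>space PB. (z, a) \<in> S}" using sp by auto
    finally show "emeasure (?k z) S \<le> ennreal \<epsilon>"
      using le[OF z] by (simp add: K.emeasure_eq_measure ennreal_leI)
  qed
  also have "\<dots> = ennreal \<epsilon>" using N.emeasure_space_1 by simp
  finally show ?thesis using eps by (simp add: emeasure_eq_measure)
qed

text \<open>Given \<open>z\<close> the coefficients \<open>c z\<close> are constants, so Hoeffding's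
  inequality holds conditionally with one bound for all \<open>z\<close>. The measurability claim is
  recorded for the union bounds, which need each event to be in \<open>sets M\<close>.\<close>

lemma noise_concentration:
  fixes g :: "real \<Rightarrow> real" and c :: "(nat \<Rightarrow> 'z) \<Rightarrow> nat \<times> nat \<Rightarrow> real"
  assumes g: "g \<in> borel_measurable borel" "\<And>x. \<bar>g x\<bar> \<le> L" and L: "L > 0"
    and cm: "\<And>e. e \<in> upper_pairs n \<Longrightarrow> (\<lambda>z. c z e) \<in> borel_measurable (\<Pi>\<^sub>M i\<in>{..<n}. F)"
    and c: "\<And>z. z \<in> space (\<Pi>\<^sub>M i\<in>{..<n}. F) \<Longrightarrow> (\<Sum>e\<in>upper_pairs n. (c z e)\<^sup>2) \<le> V"
    and V: "V > 0" and t: "t > 0"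
  shows "{\<omega>\<in>space M. t \<le> \<bar>\<Sum>(i, j)\<in>upper_pairs n. c (latent n \<omega>) (i, j) *
             (g (A i j \<omega>) - (\<integral>x. g x \<partial>H (Z i \<omega>) (Z j \<omega>)))\<bar>} \<in> sets M" (is "?S \<in> _")
    and "prob {\<omega>\<in>space M. t \<le> \<bar>\<Sum>(i, j)\<in>upper_pairs n. c (latent n \<omega>) (i, j) *
             (g (A i j \<omega>) - (\<integral>x. g x \<partial>H (Z i \<omega>) (Z j \<omega>)))\<bar>}
      \<le> 2 * exp (- t\<^sup>2 / (2 * L\<^sup>2 * V))"
proof -
  define PF where "PF = (\<Pi>\<^sub>M i\<in>{..<n}. F)"
  define PB where "PB = Pi\<^sub>M (upper_pairs n) (\<lambda>_. borel :: real measure)"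
  define T where "T z a = (\<Sum>e\<in>upper_pairs n. c z e * (g (a e) - (\<integral>x. g x \<partial>H (z (fst e)) (z (snd e)))))" for z a
  define S where "S = {x\<in>space (PF \<Otimes>\<^sub>M PB). t \<le> \<bar>T (fst x) (snd x)\<bar>}"
  have Tm: "(\<lambda>x. T (fst x) (snd x)) \<in> borel_measurable (PF \<Otimes>\<^sub>M PB)"
    unfolding T_def
  proof (rule borel_measurable_sum)
    fix e assume e: "e \<in> upper_pairs n"
    then have ij: "fst e \<in> {..<n}" "snd e \<in> {..<n}" by (auto simp: upper_pairs_def)
    have 1: "(\<lambda>x. c (fst x) e) \<in> borel_measurable (PF \<Otimes>\<^sub>M PB)"
      using measurable_compose[OF measurable_fst cm[OF e]] unfolding PF_def .
    have 2: "(\<lambda>x. g (snd x e)) \<in> borel_measurable (PF \<Otimes>\<^sub>M PB)"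
      using measurable_compose[OF measurable_compose[OF measurable_snd measurable_component_singleton[OF e]] g(1)]
      unfolding PB_def .
    have "(\<lambda>z. H (z (fst e)) (z (snd e))) \<in> PF \<rightarrow>\<^sub>M subprob_algebra borel"
      unfolding PF_def using ij by (intro measurable_prob_algebraD family.H_kernel_comp measurable_component_singleton)
    from measurable_compose[OF measurable_compose[OF measurable_fst this] integral_measurable_subprob_algebra[OF g(1)]]
    have 3: "(\<lambda>x. \<integral>y. g y \<partial>H (fst x (fst e)) (fst x (snd e))) \<in> borel_measurable (PF \<Otimes>\<^sub>M PB)" .
    show "(\<lambda>x. c (fst x) e * (g (snd x e) - (\<integral>y. g y \<partial>H (fst x (fst e)) (fst x (snd e))))) \<in> borel_measurable (PF \<Otimes>\<^sub>M PB)"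
      using 1 2 3 by (intro borel_measurable_times borel_measurable_diff)
  qed
  have S: "S \<in> sets (PF \<Otimes>\<^sub>M PB)" unfolding S_def using Tm by measurable
  have lat: "latent n \<in> M \<rightarrow>\<^sub>M PF" unfolding PF_def by measurable
  have ent: "entries n \<in> M \<rightarrow>\<^sub>M PB" unfolding PB_def by measurable
  have pairm: "(\<lambda>\<omega>. (latent n \<omega>, entries n \<omega>)) \<in> M \<rightarrow>\<^sub>M PF \<Otimes>\<^sub>M PB"
    using lat ent by (rule measurable_Pair)
  have "T (latent n \<omega>) (entries n \<omega>) = (\<Sum>(i, j)\<in>upper_pairs n. c (latent n \<omega>) (i, j) *
             (g (A i j \<omega>) - (\<integral>x. g x \<partial>H (Z i \<omega>) (Z j \<omega>))))" for \<omega>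
    unfolding T_def case_prod_beta
    by (intro sum.cong refl) (auto simp: latent_def entries_def upper_pairs_def)
  then have eq: "?S = {\<omega>\<in>space M. (latent n \<omega>, entries n \<omega>) \<in> S}"
    using measurable_space[OF pairm] by (auto simp: S_def)
  show "?S \<in> sets M"
    unfolding eq using measurable_sets[OF pairm S] by (simp add: vimage_def Int_def conj_commute)
  show "prob ?S \<le> 2 * exp (- t\<^sup>2 / (2 * L\<^sup>2 * V))"
    unfolding eq
  proof (rule prob_le_of_conditional[OF S[unfolded PF_def PB_def]])
    fix z assume z: "z \<in> space (\<Pi>\<^sub>M i\<in>{..<n}. F)"
    have sp: "space (family.noise_kernel n z) = space PB"
      using sets_eq_imp_space_eq[OF family.sets_noise_kernel[OF z]] unfolding PB_def .
    have "measure (family.noise_kernel n z) {a\<in>space (family.noise_kernel n z). t \<le> \<bar>T z a\<bar>} \<le> 2 * exp (- t\<^sup>2 / (2 * L\<^sup>2 * V))"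
      unfolding family.noise_kernel_def T_def
      by (rule Hoeffding_PiM)
         (use family.H_prob family.sets_H family.upper_pairs_space[OF z] c[OF z] g L V t in auto)
    also have "{a\<in>space (family.noise_kernel n z). t \<le> \<bar>T z a\<bar>} = {a\<in>space (\<Pi>\<^sub>M e\<in>upper_pairs n. borel). (z, a) \<in> S}"
      unfolding sp using z by (auto simp: S_def PF_def PB_def space_pair_measure)
    finally show "measure (family.noise_kernel n z) {a\<in>space (\<Pi>\<^sub>M e\<in>upper_pairs n. borel). (z, a) \<in> S}
      \<le> 2 * exp (- t\<^sup>2 / (2 * L\<^sup>2 * V))" .
  qed simp
qed

end

section \<open>Nets and truncation\<close>

text \<open>Reduces double sums over a symmetric array to its independent entries; both the bilinear
  forms on the net and the row sums are brought into this shape before concentration is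
  applied.\<close>

lemma sum_square_upper_pairs:
  fixes f :: "nat \<Rightarrow> nat \<Rightarrow> real"
  shows "(\<Sum>i<n. \<Sum>j<n. f i j) = (\<Sum>(i, j)\<in>upper_pairs n. f i j + f j i) + (\<Sum>i<n. f i i)"
proof -
  have "(\<Sum>i<n. \<Sum>j<n. f i j) = (\<Sum>(i, j)\<in>{..<n} \<times> {..<n}. f i j)"
    by (simp add: sum.cartesian_product)
  also have "{..<n} \<times> {..<n} = (upper_pairs n \<union> prod.swap ` upper_pairs n) \<union> (\<lambda>i. (i, i)) ` {..<n}"
    by (auto simp: upper_pairs_def image_iff)
  also have "(\<Sum>(i, j)\<in>\<dots>. f i j) = (\<Sum>(i, j)\<in>upper_pairs n \<union> prod.swap ` upper_pairs n. f i j) + (\<Sum>(i, j)\<in>(\<lambda>i. (i, i)) ` {..<n}. f i j)"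
  proof (rule sum.union_disjoint)
    show "(upper_pairs n \<union> prod.swap ` upper_pairs n) \<inter> (\<lambda>i. (i, i)) ` {..<n} = {}" by (auto simp: upper_pairs_def)
  qed simp_all
  also have "(\<Sum>(i, j)\<in>(\<lambda>i. (i, i)) ` {..<n}. f i j) = (\<Sum>i<n. f i i)"
    by (subst sum.reindex) (auto simp: inj_on_def)
  also have "(\<Sum>(i, j)\<in>upper_pairs n \<union> prod.swap ` upper_pairs n. f i j)
     = (\<Sum>(i, j)\<in>upper_pairs n. f i j) + (\<Sum>(i, j)\<in>prod.swap ` upper_pairs n. f i j)"
  proof (rule sum.union_disjoint)
    show "upper_pairs n \<inter> prod.swap ` upper_pairs n = {}" by (auto simp: upper_pairs_def)
  qed simp_all
  also have "(\<Sum>(i, j)\<in>prod.swap ` upper_pairs n. f i j) = (\<Sum>(i, j)\<in>upper_pairs n. f j i)"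
    by (subst sum.reindex) (auto simp: inj_on_def case_prod_beta)
  finally show ?thesis by (simp add: sum.distrib case_prod_beta)
qed

lemma sum_upper_pairs_le:
  fixes f :: "nat \<Rightarrow> nat \<Rightarrow> real"
  assumes "\<And>i j. f i j \<ge> 0"
  shows "(\<Sum>(i, j)\<in>upper_pairs n. f i j + f j i) \<le> (\<Sum>i<n. \<Sum>j<n. f i j)"
  unfolding sum_square_upper_pairs using assms by (simp add: sum_nonneg)

definition grid :: "nat \<Rightarrow> real set" where
  "grid n = (\<lambda>k::int. of_int k / real n) ` {- int n..int n}"

text \<open>Cubical rather than spherical, so that its points are counted at once. The radius 2
  leaves room for the rounding of vectors in the unit ball, and extensionality off
  \<open>{..<n}\<close> keeps the set finite.\<close>

definition grid_net :: "nat \<Rightarrow> (nat \<Rightarrow> real) set" where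
  "grid_net n = {u \<in> Pi\<^sub>E {..<n} (\<lambda>_. grid n). L2_set u {..<n} \<le> 2}"

lemma finite_grid_net: "finite (grid_net n)"
  unfolding grid_net_def by (rule finite_subset[of _ "Pi\<^sub>E {..<n} (\<lambda>_. grid n)"]) (auto simp: grid_def intro: finite_PiE)

lemma card_grid_net: "card (grid_net n) \<le> (2 * n + 1) ^ n"
proof -
  have "card (grid_net n) \<le> card (Pi\<^sub>E {..<n} (\<lambda>_. grid n))"
    unfolding grid_net_def by (intro card_mono) (auto simp: grid_def intro: finite_PiE)
  also have "\<dots> = card (grid n) ^ n" by (simp add: card_PiE)
  also have "card (grid n) \<le> card {- int n..int n}" unfolding grid_def by (rule card_image_le) simp
  then have "card (grid n) ^ n \<le> (2 * n + 1) ^ n" by (intro power_mono) auto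
  finally show ?thesis .
qed

lemma grid_net_round:
  assumes n: "n \<ge> 1" and x: "L2_set x {..<n} \<le> 1"
  obtains u where "u \<in> grid_net n" "L2_set (\<lambda>i. x i - u i) {..<n} \<le> 1 / sqrt n"
proof -
  define u where "u = (\<lambda>i\<in>{..<n}. of_int \<lfloor>real n * x i\<rfloor> / real n)"
  have xi: "\<bar>x i\<bar> \<le> 1" if "i < n" for i
    using abs_le_L2_set[of "{..<n}" i x] x that by simp
  have "u \<in> Pi\<^sub>E {..<n} (\<lambda>_. grid n)"
  proof (rule PiE_I)
    fix i assume i: "i \<in> {..<n}"
    have "\<bar>real n * x i\<bar> \<le> real n" using xi[of i] i n by (simp add: abs_mult mult_left_le)
    then have "- real n \<le> real n * x i" "real n * x i \<le> real n" by (auto simp: abs_le_iff)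
    then have "- int n \<le> \<lfloor>real n * x i\<rfloor>" "\<lfloor>real n * x i\<rfloor> \<le> int n"
      by (simp_all add: le_floor_iff floor_le_iff)
    then show "u i \<in> grid n" using i by (auto simp: u_def grid_def)
  qed (auto simp: u_def)
  have err: "L2_set (\<lambda>i. x i - u i) {..<n} \<le> 1 / sqrt n"
  proof -
    have "\<bar>x i - u i\<bar> \<le> 1 / real n" if "i \<in> {..<n}" for i
    proof -
      have "x i - u i = (real n * x i - of_int \<lfloor>real n * x i\<rfloor>) / real n"
        using that n by (simp add: u_def diff_divide_distrib)
      moreover have "\<bar>real n * x i - of_int \<lfloor>real n * x i\<rfloor>\<bar> \<le> 1" by linarith
      ultimately show ?thesis using n by (simp add: divide_right_mono)
    qed
    then have "L2_set (\<lambda>i. x i - u i) {..<n} \<le> sqrt (real n) * (1 / real n)"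
      using L2_set_bounded[of "{..<n}" "\<lambda>i. x i - u i" "1 / real n"] by simp
    also have "\<dots> = 1 / sqrt n" using n by (simp add: real_div_sqrt field_simps)
    finally show ?thesis .
  qed
  have "L2_set u {..<n} \<le> 2"
  proof -
    have "L2_set u {..<n} = L2_set (\<lambda>i. x i + - (x i - u i)) {..<n}" by simp
    also have "\<dots> \<le> L2_set x {..<n} + L2_set (\<lambda>i. - (x i - u i)) {..<n}" by (rule L2_set_triangle_ineq)
    also have "L2_set (\<lambda>i. - (x i - u i)) {..<n} = L2_set (\<lambda>i. x i - u i) {..<n}" by (simp add: L2_set_def power2_commute)
    also have "1 / sqrt n \<le> 1" using n by simp
    then have "L2_set x {..<n} + L2_set (\<lambda>i. x i - u i) {..<n} \<le> 2" using x err by linarith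
    finally show ?thesis .
  qed
  with \<open>u \<in> Pi\<^sub>E _ _\<close> err show ?thesis by (intro that[of u]) (auto simp: grid_net_def)
qed

lemma sum_abs_le_L2_set: "(\<Sum>i<n. \<bar>u i\<bar>) \<le> sqrt (real n) * L2_set u {..<n}"
  using L2_set_mult_ineq[of "\<lambda>_. 1" u "{..<n}"] by (simp add: L2_set_constant)

text \<open>The trivial operator norm bound \<open>M * n\<close>. It would be too large for the
  noise itself, but it is applied to rounding errors, which carry an extra factor 1 / sqrt
  n.\<close>

lemma bilinear_abs_le:
  fixes E :: "nat \<Rightarrow> nat \<Rightarrow> real"
  assumes E: "\<And>i j. i < n \<Longrightarrow> j < n \<Longrightarrow> \<bar>E i j\<bar> \<le> M" and M: "M \<ge> 0"
  shows "\<bar>\<Sum>i<n. \<Sum>j<n. u i * E i j * w j\<bar> \<le> M * real n * (L2_set u {..<n} * L2_set w {..<n})"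
proof -
  have "\<bar>\<Sum>i<n. \<Sum>j<n. u i * E i j * w j\<bar> \<le> (\<Sum>i<n. \<Sum>j<n. M * (\<bar>u i\<bar> * \<bar>w j\<bar>))"
  proof (rule order_trans[OF sum_abs], rule sum_mono, rule order_trans[OF sum_abs], rule sum_mono)
    fix i j assume "i \<in> {..<n}" "j \<in> {..<n}"
    then have "\<bar>E i j\<bar> * (\<bar>u i\<bar> * \<bar>w j\<bar>) \<le> M * (\<bar>u i\<bar> * \<bar>w j\<bar>)" using E by (intro mult_right_mono) auto
    then show "\<bar>u i * E i j * w j\<bar> \<le> M * (\<bar>u i\<bar> * \<bar>w j\<bar>)" by (simp add: abs_mult mult_ac)
  qed
  also have "\<dots> = M * ((\<Sum>i<n. \<bar>u i\<bar>) * (\<Sum>j<n. \<bar>w j\<bar>))"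
    unfolding sum_product by (simp add: sum_distrib_left)
  also have "\<dots> \<le> M * ((sqrt n * L2_set u {..<n}) * (sqrt n * L2_set w {..<n}))"
    using M by (intro mult_left_mono mult_mono sum_abs_le_L2_set) (auto intro!: sum_nonneg mult_nonneg_nonneg)
  also have "\<dots> = M * real n * (L2_set u {..<n} * L2_set w {..<n})"
    by simp
  finally show ?thesis .
qed

text \<open>With \<open>y\<close> and \<open>x\<close> the normalisations of \<open>v\<close> and
  \<open>E v\<close>, the bilinear form at \<open>x\<close> and \<open>y\<close> equals the ratio of
  the two norms. Rounding both vectors to the grid leaves a form bounded by \<open>T\<close>; the
  grid is so fine that the trivial bound handles the remainder.\<close>

lemma operator_bound_of_net:
  fixes E :: "nat \<Rightarrow> nat \<Rightarrow> real"
  assumes n: "n \<ge> 1" and E: "\<And>i j. i < n \<Longrightarrow> j < n \<Longrightarrow> \<bar>E i j\<bar> \<le> M" and M: "M \<ge> 0"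
    and net: "\<And>u w. u \<in> grid_net n \<Longrightarrow> w \<in> grid_net n \<Longrightarrow> \<bar>\<Sum>i<n. \<Sum>j<n. u i * E i j * w j\<bar> \<le> T"
  shows "L2_set (\<lambda>i. \<Sum>j<n. E i j * v j) {..<n} \<le> (T + 3 * M * sqrt n) * L2_set v {..<n}"
proof (cases "L2_set v {..<n} = 0 \<or> L2_set (\<lambda>i. \<Sum>j<n. E i j * v j) {..<n} = 0")
  case True
  have T: "T \<ge> 0"
  proof -
    obtain u where "u \<in> grid_net n" using grid_net_round[OF n, of "\<lambda>_. 0"] by (auto simp: L2_set_def)
    then show ?thesis using net[of u u] by linarith
  qed
  from True show ?thesis
  proof
    assume "L2_set v {..<n} = 0"
    then have "\<And>j. j < n \<Longrightarrow> v j = 0" by (auto simp: L2_set_eq_0_iff)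
    then show ?thesis using T M by (simp add: L2_set_def)
  next
    assume "L2_set (\<lambda>i. \<Sum>j<n. E i j * v j) {..<n} = 0"
    then show ?thesis using T M by simp
  qed
next
  case False
  define a where "a = L2_set v {..<n}"
  define b where "b = L2_set (\<lambda>i. \<Sum>j<n. E i j * v j) {..<n}"
  have a: "a > 0" and b: "b > 0" using False by (auto simp: a_def b_def order.strict_iff_order)
  define y where "y j = v j / a" for j
  define x where "x i = (\<Sum>j<n. E i j * v j) / b" for i
  define bil where "bil u w = (\<Sum>i<n. \<Sum>j<n. u i * E i j * w j)" for u w
  have bil: "\<bar>bil u w\<bar> \<le> M * real n * (L2_set u {..<n} * L2_set w {..<n})" for u w
    unfolding bil_def using bilinear_abs_le[OF E M] .
  have y: "L2_set y {..<n} \<le> 1"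
  proof -
    have "L2_set y {..<n} = a * (1 / a)" unfolding y_def using a
      by (subst a_def, subst L2_set_left_distrib) auto
    then show ?thesis using a by simp
  qed
  have x: "L2_set x {..<n} \<le> 1"
  proof -
    have "L2_set x {..<n} = b * (1 / b)" unfolding x_def using b
      by (subst b_def, subst L2_set_left_distrib) auto
    then show ?thesis using b by simp
  qed
  have "bil x y = (\<Sum>i<n. (\<Sum>j<n. E i j * v j)\<^sup>2) / (a * b)"
    unfolding bil_def x_def y_def power2_eq_square sum_divide_distrib
    by (simp add: sum_distrib_left sum_divide_distrib mult_ac)
  also have "(\<Sum>i<n. (\<Sum>j<n. E i j * v j)\<^sup>2) = b\<^sup>2" by (simp add: b_def L2_set_def sum_nonneg)
  also have "b\<^sup>2 / (a * b) = b / a" using b by (simp add: power2_eq_square)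
  finally have ba: "bil x y = b / a" .
  obtain u where u: "u \<in> grid_net n" "L2_set (\<lambda>i. x i - u i) {..<n} \<le> 1 / sqrt n"
    using grid_net_round[OF n x] .
  obtain w where w: "w \<in> grid_net n" "L2_set (\<lambda>i. y i - w i) {..<n} \<le> 1 / sqrt n"
    using grid_net_round[OF n y] .
  have u2: "L2_set u {..<n} \<le> 2" using u by (simp add: grid_net_def)
  \<comment> \<open>The two remainders cost at most M sqrt n and 2 M sqrt n; the 2 is the norm bound
    for the net point \<open>u\<close>.\<close>
  have "bil x y = bil u w + bil (\<lambda>i. x i - u i) y + bil u (\<lambda>i. y i - w i)"
    unfolding bil_def by (simp add: sum.distrib[symmetric] algebra_simps)
  moreover have "\<bar>bil u w\<bar> \<le> T" unfolding bil_def using net u w by auto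
  moreover have "\<bar>bil (\<lambda>i. x i - u i) y\<bar> \<le> M * real n * (1 / sqrt n * 1)"
    by (rule order_trans[OF bil], intro mult_left_mono mult_mono) (use u y M in auto)
  moreover have "\<bar>bil u (\<lambda>i. y i - w i)\<bar> \<le> M * real n * (2 * (1 / sqrt n))"
    by (rule order_trans[OF bil], intro mult_left_mono mult_mono) (use w u2 M in auto)
  moreover have "M * real n * (1 / sqrt n * 1) + M * real n * (2 * (1 / sqrt n)) = 3 * M * (real n / sqrt n)"
    by (simp add: field_simps)
  ultimately have "b / a \<le> T + 3 * M * sqrt n" using ba real_div_sqrt[of "real n"] by (simp only: of_nat_0_le_iff)
  then show ?thesis using a by (simp add: pos_divide_le_eq a_def b_def)
qed

text \<open>Slices at logarithmic levels: x^2 is at most the square of the level above |x|, and the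
  chance of exceeding the k-th level is at most (k + 2)^(-3), so the series converges.
  \<open>C\<close> depends on \<alpha> and \<beta> alone, which makes the second moments of all
  \<open>H z1 z2\<close> uniformly bounded.\<close>

lemma log_tail_second_moment:
  assumes "\<alpha> > 0" "\<beta> > 0"
  obtains C where "C \<ge> 0" "\<And>N. prob_space N \<Longrightarrow> sets N = sets borel \<Longrightarrow>
     (\<And>t. t \<ge> 2 \<Longrightarrow> measure N {x. \<bar>x\<bar> < \<beta> * ln t powr \<alpha>} > 1 - t powr (-3)) \<Longrightarrow>
     integrable N (\<lambda>x::real. x\<^sup>2) \<and> (\<integral>x. x\<^sup>2 \<partial>N) \<le> C"
proof -
  \<comment> \<open>The shift by 2 respects the restriction of the tail condition to t \<ge>
    2.\<close>
  define b where "b k = \<beta> * ln (real k + 2) powr \<alpha>" for k :: nat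
  have b: "b k > 0" for k using assms by (simp add: b_def)
  have summ: "summable (\<lambda>k. (b (Suc k))\<^sup>2 * (real k + 2) powr (-3))"
  proof (rule summable_comparison_test_bigo)
    show "summable (\<lambda>k. norm (real k powr (-2)))" by (simp add: summable_real_powr_iff)
    show "(\<lambda>k. (b (Suc k))\<^sup>2 * (real k + 2) powr (-3)) \<in> O(\<lambda>k. real k powr (-2))"
      unfolding b_def using assms by real_asymp
  qed
  define C where "C = (b 0)\<^sup>2 + (\<Sum>k. (b (Suc k))\<^sup>2 * (real k + 2) powr (-3))"
  have sn: "(\<Sum>k. (b (Suc k))\<^sup>2 * (real k + 2) powr (-3)) \<ge> 0" by (intro suminf_nonneg summ) auto
  show ?thesis
  proof (rule that[of C])
    show "C \<ge> 0" using sn by (simp add: C_def)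
    fix N :: "real measure" assume N: "prob_space N" and sets: "sets N = sets borel"
      and tail: "\<And>t. t \<ge> 2 \<Longrightarrow> measure N {x. \<bar>x\<bar> < \<beta> * ln t powr \<alpha>} > 1 - t powr (-3)"
    interpret prob_space N by fact
    have sp: "space N = UNIV" using sets_eq_imp_space_eq[OF sets] by simp
    note [measurable_cong] = sets
    have Sm: "{x. b k \<le> \<bar>x\<bar>} \<in> sets N" for k using sp by measurable
    have T: "emeasure N {x. b k \<le> \<bar>x\<bar>} \<le> ennreal ((real k + 2) powr (-3))" for k
    proof -
      have "{x. b k \<le> \<bar>x\<bar>} = space N - {x. \<bar>x\<bar> < b k}" using sp by auto
      moreover have "prob (space N - {x. \<bar>x\<bar> < b k}) = 1 - prob {x. \<bar>x\<bar> < b k}"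
        by (rule prob_compl) (use sp in measurable)
      ultimately have "prob {x. b k \<le> \<bar>x\<bar>} \<le> (real k + 2) powr (-3)"
        using tail[of "real k + 2"] by (simp add: b_def)
      then show ?thesis by (simp add: emeasure_eq_measure ennreal_leI)
    qed
    have point: "ennreal (x\<^sup>2) \<le> ennreal ((b 0)\<^sup>2) + (\<Sum>k. ennreal ((b (Suc k))\<^sup>2) * indicator {x. b k \<le> \<bar>x\<bar>} x)" for x
    proof (cases "\<bar>x\<bar> < b 0")
      case True
      then have "x\<^sup>2 \<le> (b 0)\<^sup>2" by (metis abs_ge_zero less_imp_le power2_abs power_mono)
      then have "ennreal (x\<^sup>2) \<le> ennreal ((b 0)\<^sup>2)" by (rule ennreal_leI)
      then show ?thesis by (rule order_trans) simp
    next
      case False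
      have "filterlim b at_top sequentially" unfolding b_def using assms by real_asymp
      then have "eventually (\<lambda>k. \<bar>x\<bar> < b k) sequentially" by (rule filterlim_at_top_dense[THEN iffD1, rule_format])
      then obtain m where "\<bar>x\<bar> < b m" by (auto simp: eventually_sequentially)
      \<comment> \<open>The first level exceeding |x|. It is not level 0, so its predecessor
        \<open>k\<close> satisfies \<open>b k \<le> \<bar>x\<bar>\<close>, and the k-th term of the
        series alone dominates x^2.\<close>
      define m where "m = (LEAST m. \<bar>x\<bar> < b m)"
      have m: "\<bar>x\<bar> < b m" unfolding m_def by (rule LeastI) fact
      have "m \<noteq> 0" using m False by (cases "m = 0") simp_all
      then obtain k where k: "m = Suc k" by (cases m) auto
      have "b k \<le> \<bar>x\<bar>" using not_less_Least[of k "\<lambda>m. \<bar>x\<bar> < b m"] k by (simp add: m_def)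
      have le_suminf: "f k \<le> suminf f" for f :: "nat \<Rightarrow> ennreal"
        using sum_le_suminf[of f "{k}"] by simp
      have "x\<^sup>2 \<le> (b (Suc k))\<^sup>2" using m k by (metis abs_ge_zero less_imp_le power2_abs power_mono)
      then have "ennreal (x\<^sup>2) \<le> ennreal ((b (Suc k))\<^sup>2) * indicator {x. b k \<le> \<bar>x\<bar>} x"
        using \<open>b k \<le> \<bar>x\<bar>\<close> by (simp add: ennreal_leI)
      also have "\<dots> \<le> (\<Sum>k. ennreal ((b (Suc k))\<^sup>2) * indicator {x. b k \<le> \<bar>x\<bar>} x)"
        by (rule le_suminf)
      finally show ?thesis by (rule order_trans) simp
    qed
    have "(\<integral>\<^sup>+x. ennreal (x\<^sup>2) \<partial>N) \<le> (\<integral>\<^sup>+x. ennreal ((b 0)\<^sup>2) + (\<Sum>k. ennreal ((b (Suc k))\<^sup>2) * indicator {x. b k \<le> \<bar>x\<bar>} x) \<partial>N)"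
      by (intro nn_integral_mono point)
    also have "\<dots> = ennreal ((b 0)\<^sup>2) + (\<Sum>k. (\<integral>\<^sup>+x. ennreal ((b (Suc k))\<^sup>2) * indicator {x. b k \<le> \<bar>x\<bar>} x \<partial>N))"
    proof -
      have Fm: "(\<lambda>x. ennreal ((b (Suc k))\<^sup>2) * indicator {x. b k \<le> \<bar>x\<bar>} x) \<in> borel_measurable N" for k
        using Sm[of k] by (intro borel_measurable_times_ennreal borel_measurable_indicator borel_measurable_const)
      have "(\<integral>\<^sup>+x. ennreal ((b 0)\<^sup>2) + (\<Sum>k. ennreal ((b (Suc k))\<^sup>2) * indicator {x. b k \<le> \<bar>x\<bar>} x) \<partial>N)
        = (\<integral>\<^sup>+x. ennreal ((b 0)\<^sup>2) \<partial>N) + (\<integral>\<^sup>+x. (\<Sum>k. ennreal ((b (Suc k))\<^sup>2) * indicator {x. b k \<le> \<bar>x\<bar>} x) \<partial>N)"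
        by (rule nn_integral_add) (use Fm in \<open>auto intro!: borel_measurable_suminf_order\<close>)
      also have "(\<integral>\<^sup>+x. (\<Sum>k. ennreal ((b (Suc k))\<^sup>2) * indicator {x. b k \<le> \<bar>x\<bar>} x) \<partial>N)
         = (\<Sum>k. (\<integral>\<^sup>+x. ennreal ((b (Suc k))\<^sup>2) * indicator {x. b k \<le> \<bar>x\<bar>} x \<partial>N))"
        by (rule nn_integral_suminf) (rule Fm)
      finally show ?thesis using emeasure_space_1 by simp
    qed
    also have "(\<lambda>k. (\<integral>\<^sup>+x. ennreal ((b (Suc k))\<^sup>2) * indicator {x. b k \<le> \<bar>x\<bar>} x \<partial>N))
      = (\<lambda>k. ennreal ((b (Suc k))\<^sup>2) * emeasure N {x. b k \<le> \<bar>x\<bar>})"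
      by (intro ext nn_integral_cmult_indicator) (rule Sm)
    also have "(\<Sum>k. ennreal ((b (Suc k))\<^sup>2) * emeasure N {x. b k \<le> \<bar>x\<bar>}) \<le> (\<Sum>k. ennreal ((b (Suc k))\<^sup>2) * ennreal ((real k + 2) powr (-3)))"
      by (intro suminf_le mult_left_mono T) auto
    also have "\<dots> = (\<Sum>k. ennreal ((b (Suc k))\<^sup>2 * (real k + 2) powr (-3)))"
      by (simp add: ennreal_mult')
    also have "\<dots> = ennreal (\<Sum>k. (b (Suc k))\<^sup>2 * (real k + 2) powr (-3))"
      by (rule suminf_ennreal2[OF _ summ]) simp
    also have "ennreal ((b 0)\<^sup>2) + \<dots> = ennreal C" unfolding C_def using sn by (simp add: ennreal_plus)
    finally have fin: "(\<integral>\<^sup>+x. ennreal (x\<^sup>2) \<partial>N) \<le> ennreal C" by (simp add: add_left_mono)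
    have int: "integrable N (\<lambda>x::real. x\<^sup>2)"
    proof (rule integrableI_nonneg)
      show "(\<integral>\<^sup>+x. ennreal (x\<^sup>2) \<partial>N) < \<infinity>" using fin by (simp add: order_le_less_trans)
    qed auto
    moreover have "(\<integral>x. x\<^sup>2 \<partial>N) \<le> C"
      using fin nn_integral_eq_integral[OF int] \<open>C \<ge> 0\<close> by simp
    ultimately show "integrable N (\<lambda>x::real. x\<^sup>2) \<and> (\<integral>x. x\<^sup>2 \<partial>N) \<le> C" ..
  qed
qed

definition trunc :: "real \<Rightarrow> real \<Rightarrow> real" where
  "trunc L x = (if \<bar>x\<bar> < L then x else 0)"

lemma trunc_measurable [measurable]: "trunc L \<in> borel_measurable borel"
  unfolding trunc_def by measurable

lemma abs_trunc_le: "L \<ge> 0 \<Longrightarrow> \<bar>trunc L x\<bar> \<le> L"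
  by (simp add: trunc_def)

text \<open>The bias of truncation, by \<open>2 \<bar>x\<bar> 1 \<le> x\<^sup>2 / s + s 1\<close> on the event \<open>\<bar>x\<bar> \<ge> L\<close>.\<close>

lemma truncation_bias:
  assumes N: "prob_space N" and sets: "sets N = sets borel"
    and int1: "integrable N (\<lambda>x::real. x)" and int2: "integrable N (\<lambda>x::real. x\<^sup>2)"
    and s: "s > 0" and L: "L \<ge> 0"
  shows "\<bar>(\<integral>x. trunc L x \<partial>N) - (\<integral>x. x \<partial>N)\<bar> \<le> ((\<integral>x. x\<^sup>2 \<partial>N) / s + s * measure N {x. L \<le> \<bar>x\<bar>}) / 2"
proof -
  interpret prob_space N by fact
  note [measurable_cong] = sets
  have sp: "space N = UNIV" using sets_eq_imp_space_eq[OF sets] by simp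
  have it: "integrable N (trunc L)"
    by (rule integrable_const_bound[where B = L]) (use abs_trunc_le[OF L] in auto)
  have Sm: "{x. L \<le> \<bar>x\<bar>} \<in> sets N" using sp by measurable
  have "\<bar>(\<integral>x. trunc L x \<partial>N) - (\<integral>x. x \<partial>N)\<bar> = \<bar>\<integral>x. trunc L x - x \<partial>N\<bar>"
    using it int1 by simp
  also have "\<dots> \<le> (\<integral>x. \<bar>trunc L x - x\<bar> \<partial>N)" by (rule integral_abs_bound)
  also have "\<dots> \<le> (\<integral>x. (x\<^sup>2 / s + s * indicator {x. L \<le> \<bar>x\<bar>} x) / 2 \<partial>N)"
  proof (rule integral_mono)
    show "integrable N (\<lambda>x. \<bar>trunc L x - x\<bar>)" using it int1 by simp
    show "integrable N (\<lambda>x. (x\<^sup>2 / s + s * indicator {x. L \<le> \<bar>x\<bar>} x) / 2)"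
      using int2 Sm by (simp add: emeasure_eq_measure)
    fix x :: real
    have "0 \<le> (\<bar>x\<bar> - s)\<^sup>2 / s" using s by simp
    also have "(\<bar>x\<bar> - s)\<^sup>2 / s = (x\<^sup>2 + s\<^sup>2 - 2 * \<bar>x\<bar> * s) / s" by (simp add: power2_diff)
    also have "\<dots> = x\<^sup>2 / s + s - 2 * \<bar>x\<bar>"
      using s by (simp add: add_divide_distrib diff_divide_distrib power2_eq_square)
    finally have "2 * \<bar>x\<bar> \<le> x\<^sup>2 / s + s" by simp
    then show "\<bar>trunc L x - x\<bar> \<le> (x\<^sup>2 / s + s * indicator {x. L \<le> \<bar>x\<bar>} x) / 2"
      using s by (auto simp: trunc_def indicator_def)
  qed
  also have "\<dots> = ((\<integral>x. x\<^sup>2 \<partial>N) / s + s * measure N {x. L \<le> \<bar>x\<bar>}) / 2"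
    using int2 Sm by (simp add: emeasure_eq_measure)
  finally show ?thesis .
qed

section \<open>Bounds on the noise\<close>

text \<open>The origin of the threshold 3 in the bounds that follow: from there on, powers of ln n
  increase with the exponent and are at least 1 for exponents \<ge> 0.\<close>

lemma ln_ge_one:
  assumes "n \<ge> 3"
  shows "ln (real n) \<ge> 1"
proof -
  have "exp 1 \<le> real n" using assms exp_le by linarith
  then show ?thesis using assms by (simp add: ln_ge_iff)
qed

text \<open>\<open>D\<close> collects what concentration does not see. Off the diagonal it is a bias
  of size a / n per entry, with operator norm at most \<open>a\<close> by Cauchy-Schwarz; on the
  diagonal it acts as multiplication by numbers of size \<open>b\<close>. Both are of constant
  order, hence negligible against sqrt n.\<close>

lemma perturbed_operator_bound:
  fixes S D :: "nat \<Rightarrow> nat \<Rightarrow> real"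
  assumes D: "\<And>i j. i < n \<Longrightarrow> j < n \<Longrightarrow> \<bar>D i j\<bar> \<le> (if i = j then b else a / real n)"
    and ab: "a \<ge> 0" "b \<ge> 0"
    and S: "L2_set (\<lambda>i. \<Sum>j<n. S i j * v j) {..<n} \<le> T * L2_set v {..<n}"
  shows "L2_set (\<lambda>i. \<Sum>j<n. (S i j + D i j) * v j) {..<n} \<le> (T + a + b) * L2_set v {..<n}"
proof -
  note s1 = sum_abs_le_L2_set[where u = v and n = n]
  have "\<bar>\<Sum>j<n. D i j * v j\<bar> \<le> a / real n * (\<Sum>j<n. \<bar>v j\<bar>) + b * \<bar>v i\<bar>" if i: "i < n" for i
  proof -
    have "\<bar>\<Sum>j<n. D i j * v j\<bar> \<le> (\<Sum>j<n. a / real n * \<bar>v j\<bar> + (if j = i then b * \<bar>v j\<bar> else 0))"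
    proof (rule order_trans[OF sum_abs], rule sum_mono)
      fix j assume "j \<in> {..<n}"
      then have "\<bar>D i j * v j\<bar> \<le> (if i = j then b else a / real n) * \<bar>v j\<bar>"
        unfolding abs_mult using D i by (intro mult_right_mono) auto
      also have "\<dots> \<le> a / real n * \<bar>v j\<bar> + (if j = i then b * \<bar>v j\<bar> else 0)" using ab by auto
      finally show "\<bar>D i j * v j\<bar> \<le> \<dots>" .
    qed
    also have "\<dots> = a / real n * (\<Sum>j<n. \<bar>v j\<bar>) + b * \<bar>v i\<bar>"
      using i by (simp add: sum.distrib sum_distrib_left)
    finally show ?thesis .
  qed
  then have "L2_set (\<lambda>i. \<bar>\<Sum>j<n. D i j * v j\<bar>) {..<n} \<le> L2_set (\<lambda>i. a / real n * (\<Sum>j<n. \<bar>v j\<bar>) + b * \<bar>v i\<bar>) {..<n}"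
    by (intro L2_set_mono) auto
  also have "\<dots> \<le> L2_set (\<lambda>i. a / real n * (\<Sum>j<n. \<bar>v j\<bar>)) {..<n} + L2_set (\<lambda>i. b * \<bar>v i\<bar>) {..<n}"
    by (rule L2_set_triangle_ineq)
  also have "L2_set (\<lambda>i. b * \<bar>v i\<bar>) {..<n} = b * L2_set v {..<n}"
    using ab by (subst L2_set_right_distrib) (auto simp: L2_set_def power_mult_distrib)
  also have "L2_set (\<lambda>i. a / real n * (\<Sum>j<n. \<bar>v j\<bar>)) {..<n} = sqrt n * (a / real n * (\<Sum>j<n. \<bar>v j\<bar>))"
    using ab by (simp add: L2_set_constant sum_nonneg)
  also have "\<dots> \<le> sqrt n * (a / real n * (sqrt n * L2_set v {..<n}))"
    using s1 ab by (intro mult_left_mono) auto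
  also have "sqrt n * (a / real n * (sqrt n * L2_set v {..<n})) = (sqrt n * sqrt n) * (a / real n) * L2_set v {..<n}"
    by (simp only: mult_ac)
  also have "\<dots> \<le> a * L2_set v {..<n}"
    using ab by (cases "n = 0") simp_all
  also have "L2_set (\<lambda>i. \<bar>\<Sum>j<n. D i j * v j\<bar>) {..<n} = L2_set (\<lambda>i. \<Sum>j<n. D i j * v j) {..<n}"
    by (simp add: L2_set_def)
  finally have Dv: "L2_set (\<lambda>i. \<Sum>j<n. D i j * v j) {..<n} \<le> a * L2_set v {..<n} + b * L2_set v {..<n}" by simp
  have "L2_set (\<lambda>i. \<Sum>j<n. (S i j + D i j) * v j) {..<n} = L2_set (\<lambda>i. (\<Sum>j<n. S i j * v j) + (\<Sum>j<n. D i j * v j)) {..<n}"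
    by (simp add: distrib_right sum.distrib)
  also have "\<dots> \<le> L2_set (\<lambda>i. \<Sum>j<n. S i j * v j) {..<n} + L2_set (\<lambda>i. \<Sum>j<n. D i j * v j) {..<n}"
    by (rule L2_set_triangle_ineq)
  finally show ?thesis using S Dv by (simp add: algebra_simps)
qed

lemma perturbed_row_bound:
  fixes D :: "nat \<Rightarrow> nat \<Rightarrow> real"
  assumes D: "\<And>j. j < n \<Longrightarrow> \<bar>D i j\<bar> \<le> (if i = j then b else a / real n)"
    and ab: "a \<ge> 0" "b \<ge> 0" and x: "\<And>j. j < n \<Longrightarrow> \<bar>x j\<bar> \<le> B" and B: "B \<ge> 0"
  shows "\<bar>\<Sum>j<n. D i j * x j\<bar> \<le> (a + b) * B"
proof -
  have "\<bar>\<Sum>j<n. D i j * x j\<bar> \<le> (\<Sum>j<n. a / real n * B + (if j = i then b * B else 0))"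
  proof (rule order_trans[OF sum_abs], rule sum_mono)
    fix j assume "j \<in> {..<n}"
    then have "\<bar>D i j * x j\<bar> \<le> (if i = j then b else a / real n) * B"
      unfolding abs_mult using D x ab by (intro mult_mono) auto
    also have "\<dots> \<le> a / real n * B + (if j = i then b * B else 0)" using ab B by auto
    finally show "\<bar>D i j * x j\<bar> \<le> \<dots>" .
  qed
  also have "\<dots> = (\<Sum>j<n. a / real n * B) + (if i < n then b * B else 0)"
    by (simp add: sum.distrib)
  also have "\<dots> \<le> a * B + b * B"
    using ab B by (cases "n = 0") auto
  finally show ?thesis by (simp add: distrib_right)
qed

lemma (in wgrdpg_family) inner_Ipq:
  assumes "z1 \<in> space F" "z2 \<in> space F"
  shows "\<phi> z1 \<bullet> (Ipq p q *\<^sub>v \<phi> z2) = (\<Sum>l<p + q. \<phi> z1 $ l * (if l < p then 1 else -1) * \<phi> z2 $ l)"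
proof -
  have "(Ipq p q *\<^sub>v \<phi> z2) $ l = (if l < p then 1 else -1) * \<phi> z2 $ l" if "l < p + q" for l
    using that \<phi>_carrier[OF assms(2)]
    by (simp add: Ipq_def mat_diag_def scalar_prod_def atLeast0LessThan if_distrib[of "\<lambda>x. x * _"] cong: if_cong)
  moreover have "dim_vec (Ipq p q *\<^sub>v \<phi> z2) = p + q" by (simp add: Ipq_def mat_diag_def)
  ultimately show ?thesis
    by (simp add: scalar_prod_def atLeast0LessThan mult.assoc)
qed

lemma (in wgrdpg_family) measure_noise_kernel_component:
  assumes z: "z \<in> space (\<Pi>\<^sub>M i\<in>{..<n}. F)" and e: "e \<in> upper_pairs n" and T: "T \<in> sets borel"
  shows "measure (noise_kernel n z) {a\<in>space (\<Pi>\<^sub>M e\<in>upper_pairs n. borel). a e \<in> T}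
    = measure (H (z (fst e)) (z (snd e))) T"
proof -
  let ?N = "\<lambda>e. H (z (fst e)) (z (snd e))"
  have "distr (Pi\<^sub>M (upper_pairs n) ?N) (?N e) (\<lambda>a. a e) = ?N e"
    by (rule distr_PiM_component) (use upper_pairs_space[OF z] H_prob e in auto)
  moreover have Te: "T \<in> sets (?N e)" using T sets_H upper_pairs_space[OF z e] by auto
  ultimately have "measure (?N e) T = measure (Pi\<^sub>M (upper_pairs n) ?N) ((\<lambda>a. a e) -` T \<inter> space (Pi\<^sub>M (upper_pairs n) ?N))"
    using measure_distr[OF measurable_component_singleton[OF e, of ?N] Te] by simp
  also have "(\<lambda>a. a e) -` T \<inter> space (Pi\<^sub>M (upper_pairs n) ?N) = {a\<in>space (\<Pi>\<^sub>M e\<in>upper_pairs n. borel). a e \<in> T}"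
    using sets_eq_imp_space_eq[OF sets_noise_kernel[OF z]] by (auto simp: noise_kernel_def)
  finally show ?thesis by (simp add: noise_kernel_def)
qed

section \<open>High-probability bounds for truncated entries\<close>

context wgrdpg
begin

text \<open>The tail condition speaks of \<open>H\<close>; disintegration over the latent values
  carries it over to the entries themselves.\<close>

lemma prob_entry_large:
  assumes e: "e \<in> upper_pairs n"
    and tail: "\<And>z1 z2. z1 \<in> space F \<Longrightarrow> z2 \<in> space F \<Longrightarrow> measure (H z1 z2) {x. L \<le> \<bar>x\<bar>} \<le> \<epsilon>" and eps: "\<epsilon> \<ge> 0"
  shows "prob {\<omega>\<in>space M. L \<le> \<bar>A (fst e) (snd e) \<omega>\<bar>} \<le> \<epsilon>"
proof -
  define PF where "PF = (\<Pi>\<^sub>M i\<in>{..<n}. F)"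
  define PB where "PB = Pi\<^sub>M (upper_pairs n) (\<lambda>_. borel :: real measure)"
  define S where "S = {x\<in>space (PF \<Otimes>\<^sub>M PB). snd x e \<in> {y. L \<le> \<bar>y\<bar>}}"
  have Tm: "{y::real. L \<le> \<bar>y\<bar>} \<in> sets borel" by measurable
  have "(\<lambda>x. snd x e) \<in> borel_measurable (PF \<Otimes>\<^sub>M PB)"
    using measurable_compose[OF measurable_snd measurable_component_singleton[OF e]] unfolding PB_def .
  from measurable_sets[OF this Tm] have S: "S \<in> sets (PF \<Otimes>\<^sub>M PB)"
    by (simp add: S_def vimage_def Int_def conj_commute)
  have pairm: "(\<lambda>\<omega>. (latent n \<omega>, entries n \<omega>)) \<in> M \<rightarrow>\<^sub>M PF \<Otimes>\<^sub>M PB"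
    unfolding PF_def PB_def by measurable
  have "prob {\<omega>\<in>space M. (latent n \<omega>, entries n \<omega>) \<in> S} \<le> \<epsilon>"
  proof (rule prob_le_of_conditional[OF S[unfolded PF_def PB_def] _ eps])
    fix z assume z: "z \<in> space (\<Pi>\<^sub>M i\<in>{..<n}. F)"
    have "{a\<in>space (\<Pi>\<^sub>M e\<in>upper_pairs n. borel). (z, a) \<in> S} = {a\<in>space (\<Pi>\<^sub>M e\<in>upper_pairs n. borel). a e \<in> {y. L \<le> \<bar>y\<bar>}}"
      using z by (auto simp: S_def PF_def PB_def space_pair_measure)
    then show "measure (family.noise_kernel n z) {a\<in>space (\<Pi>\<^sub>M e\<in>upper_pairs n. borel). (z, a) \<in> S} \<le> \<epsilon>"
      using family.measure_noise_kernel_component[OF z e Tm] tail family.upper_pairs_space[OF z e] by simp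
  qed
  also have "{\<omega>\<in>space M. (latent n \<omega>, entries n \<omega>) \<in> S} = {\<omega>\<in>space M. L \<le> \<bar>A (fst e) (snd e) \<omega>\<bar>}"
    using measurable_space[OF pairm] e by (auto simp: S_def entries_def)
  finally show ?thesis .
qed

definition trunc_mean :: "real \<Rightarrow> 'z \<Rightarrow> 'z \<Rightarrow> real" where
  "trunc_mean L z1 z2 = (\<integral>x. trunc L x \<partial>H z1 z2)"

text \<open>Centred at the conditional mean of the truncated entry, so that Hoeffding's inequality
  applies exactly; the gap to the true mean is left to the bias term. The diagonal, where nothing is
  random given the latent variables, is set to 0.\<close>

definition trunc_noise :: "real \<Rightarrow> nat \<Rightarrow> nat \<Rightarrow> 'w \<Rightarrow> real" where
  "trunc_noise L i j \<omega> = (if i = j then 0 else trunc L (A i j \<omega>) - trunc_mean L (Z i \<omega>) (Z j \<omega>))"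

lemma trunc_noise_sym: "\<omega> \<in> space M \<Longrightarrow> trunc_noise L i j \<omega> = trunc_noise L j i \<omega>"
  using A_sym[of \<omega> i j] family.H_sym[OF Z_space Z_space, of \<omega> \<omega> i j] by (simp add: trunc_noise_def trunc_mean_def)

lemma abs_trunc_noise_le:
  assumes w: "\<omega> \<in> space M" and L: "L \<ge> 0"
  shows "\<bar>trunc_noise L i j \<omega>\<bar> \<le> 2 * L"
proof -
  interpret Hij: prob_space "H (Z i \<omega>) (Z j \<omega>)" using w by (intro family.H_prob Z_space)
  have m: "trunc L \<in> borel_measurable (H (Z i \<omega>) (Z j \<omega>))"
    using family.sets_H[OF Z_space[OF w] Z_space[OF w]] by (simp cong: measurable_cong_sets)
  have "integrable (H (Z i \<omega>) (Z j \<omega>)) (trunc L)"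
    by (rule Hij.integrable_const_bound[where B = L]) (use abs_trunc_le[OF L] m in auto)
  note int = this
  have b: "- L \<le> trunc L x" "trunc L x \<le> L" for x using abs_trunc_le[OF L, of x] by linarith+
  have "trunc_mean L (Z i \<omega>) (Z j \<omega>) \<le> L" unfolding trunc_mean_def
    using b by (intro Hij.integral_le_const int) auto
  moreover have "- L \<le> trunc_mean L (Z i \<omega>) (Z j \<omega>)" unfolding trunc_mean_def
    using b by (intro Hij.integral_ge_const int) auto
  ultimately have "\<bar>trunc_mean L (Z i \<omega>) (Z j \<omega>)\<bar> \<le> L" by linarith
  then show ?thesis using abs_trunc_le[OF L, of "A i j \<omega>"] L by (auto simp: trunc_noise_def)
qed

lemma trunc_noise_concentration:
  assumes L: "L > 0"
    and cm: "\<And>e. e \<in> upper_pairs n \<Longrightarrow> (\<lambda>z. c z e) \<in> borel_measurable (\<Pi>\<^sub>M i\<in>{..<n}. F)"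
    and c: "\<And>z. z \<in> space (\<Pi>\<^sub>M i\<in>{..<n}. F) \<Longrightarrow> (\<Sum>e\<in>upper_pairs n. (c z e)\<^sup>2) \<le> V"
    and V: "V > 0" and t: "t > 0"
  shows "{\<omega>\<in>space M. t \<le> \<bar>\<Sum>(i, j)\<in>upper_pairs n. c (latent n \<omega>) (i, j) * trunc_noise L i j \<omega>\<bar>} \<in> sets M"
    and "prob {\<omega>\<in>space M. t \<le> \<bar>\<Sum>(i, j)\<in>upper_pairs n. c (latent n \<omega>) (i, j) * trunc_noise L i j \<omega>\<bar>}
      \<le> 2 * exp (- t\<^sup>2 / (2 * L\<^sup>2 * V))"
proof -
  have "(\<Sum>(i, j)\<in>upper_pairs n. c (latent n \<omega>) (i, j) * trunc_noise L i j \<omega>) =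
    (\<Sum>(i, j)\<in>upper_pairs n. c (latent n \<omega>) (i, j) * (trunc L (A i j \<omega>) - (\<integral>x. trunc L x \<partial>H (Z i \<omega>) (Z j \<omega>))))" for \<omega>
    by (intro sum.cong refl) (auto simp: trunc_noise_def trunc_mean_def upper_pairs_def)
  note eq = this
  show "{\<omega>\<in>space M. t \<le> \<bar>\<Sum>(i, j)\<in>upper_pairs n. c (latent n \<omega>) (i, j) * trunc_noise L i j \<omega>\<bar>} \<in> sets M"
    unfolding eq by (rule noise_concentration(1)[OF trunc_measurable _ L cm c V t]) (use abs_trunc_le L in auto)
  show "prob {\<omega>\<in>space M. t \<le> \<bar>\<Sum>(i, j)\<in>upper_pairs n. c (latent n \<omega>) (i, j) * trunc_noise L i j \<omega>\<bar>}
      \<le> 2 * exp (- t\<^sup>2 / (2 * L\<^sup>2 * V))"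
    unfolding eq by (rule noise_concentration(2)[OF trunc_measurable _ L cm c V t]) (use abs_trunc_le L in auto)
qed

text \<open>A crude union bound over a polynomially fine grid, at the cost of a factor \<open>sqrt (ln n)\<close>.\<close>

lemma net_event:
  assumes n: "n \<ge> 3" and L: "L > 0"
  defines "t \<equiv> 20 * L * sqrt (real n * ln (real n))"
  defines "S \<equiv> {\<omega>\<in>space M. \<exists>u\<in>grid_net n. \<exists>w\<in>grid_net n. t \<le> \<bar>\<Sum>i<n. \<Sum>j<n. u i * trunc_noise L i j \<omega> * w j\<bar>}"
  shows "S \<in> sets M" and "prob S \<le> 2 * real n powr (-2)"
proof -
  note lnn = ln_ge_one[OF n]
  have t: "t > 0" using L n lnn by (simp add: t_def)
  \<comment> \<open>By symmetry an entry above the diagonal occurs twice in the bilinear form; this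
    is its total coefficient.\<close>
  define c where "c u w e = u (fst e) * w (snd e) + u (snd e) * w (fst e)" for u w :: "nat \<Rightarrow> real" and e :: "nat \<times> nat"
  define S' where "S' uw = {\<omega>\<in>space M. t \<le> \<bar>\<Sum>(i, j)\<in>upper_pairs n. c (fst uw) (snd uw) (i, j) * trunc_noise L i j \<omega>\<bar>}" for uw
  have bil: "(\<Sum>i<n. \<Sum>j<n. u i * trunc_noise L i j \<omega> * w j) = (\<Sum>(i, j)\<in>upper_pairs n. c u w (i, j) * trunc_noise L i j \<omega>)"
    if "\<omega> \<in> space M" for u w \<omega>
    unfolding sum_square_upper_pairs using trunc_noise_sym[OF that]
    by (auto simp: c_def trunc_noise_def[of L i i for i] algebra_simps intro!: sum.cong)
  have S: "S = (\<Union>uw\<in>grid_net n \<times> grid_net n. S' uw)"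
  proof -
    have "S = {\<omega>\<in>space M. \<exists>u\<in>grid_net n. \<exists>w\<in>grid_net n.
       t \<le> \<bar>\<Sum>(i, j)\<in>upper_pairs n. c u w (i, j) * trunc_noise L i j \<omega>\<bar>}"
      unfolding S_def by (rule Collect_cong, rule conj_cong[OF refl]) (simp only: bil)
    then show ?thesis unfolding S'_def by force
  qed
  \<comment> \<open>32 = 2 * 4 * 4: the factor 2 from (x + y)^2 \<le> 2 x^2 + 2 y^2, and a squared
    norm of at most 4 for each net point.\<close>
  have V: "(\<Sum>e\<in>upper_pairs n. (c u w e)\<^sup>2) \<le> 32" if "u \<in> grid_net n" "w \<in> grid_net n" for u w
  proof -
    have "(\<Sum>e\<in>upper_pairs n. (c u w e)\<^sup>2) \<le> (\<Sum>(i, j)\<in>upper_pairs n. 2 * (u i * w j)\<^sup>2 + 2 * (u j * w i)\<^sup>2)"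
      unfolding case_prod_beta
    proof (rule sum_mono)
      fix e :: "nat \<times> nat"
      have "0 \<le> (u (fst e) * w (snd e) - u (snd e) * w (fst e))\<^sup>2" by simp
      then show "(c u w e)\<^sup>2 \<le> 2 * (u (fst e) * w (snd e))\<^sup>2 + 2 * (u (snd e) * w (fst e))\<^sup>2"
        unfolding c_def power2_sum power2_diff by linarith
    qed
    also have "\<dots> \<le> (\<Sum>i<n. \<Sum>j<n. 2 * (u i * w j)\<^sup>2)" by (rule sum_upper_pairs_le) simp
    also have "\<dots> = 2 * ((\<Sum>i<n. (u i)\<^sup>2) * (\<Sum>j<n. (w j)\<^sup>2))"
      unfolding sum_product by (simp add: power_mult_distrib sum_distrib_left)
    also have "\<dots> = 2 * ((L2_set u {..<n})\<^sup>2 * (L2_set w {..<n})\<^sup>2)" by (simp add: L2_set_def sum_nonneg)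
    also have "\<dots> \<le> 2 * (2\<^sup>2 * 2\<^sup>2)"
      using that by (intro mult_left_mono mult_mono power_mono) (auto simp: grid_net_def)
    finally show ?thesis by simp
  qed
  have S'm: "S' uw \<in> sets M" if "uw \<in> grid_net n \<times> grid_net n" for uw
    unfolding S'_def
    by (rule trunc_noise_concentration(1)[where c = "\<lambda>z. c (fst uw) (snd uw)" and V = 32, OF L _ _ _ t])
       (use V[of "fst uw" "snd uw"] that in auto)
  have S'p: "prob (S' uw) \<le> 2 * exp (- t\<^sup>2 / (2 * L\<^sup>2 * 32))" if "uw \<in> grid_net n \<times> grid_net n" for uw
    unfolding S'_def
    by (rule trunc_noise_concentration(2)[where c = "\<lambda>z. c (fst uw) (snd uw)" and V = 32, OF L _ _ _ t])
       (use V[of "fst uw" "snd uw"] that in auto)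
  show "S \<in> sets M" unfolding S using S'm finite_grid_net by (intro sets.finite_UN) auto
  have "prob S \<le> (\<Sum>uw\<in>grid_net n \<times> grid_net n. prob (S' uw))"
    unfolding S using S'm finite_grid_net by (intro finite_measure_subadditive_finite) auto
  also have "\<dots> \<le> (\<Sum>uw\<in>grid_net n \<times> grid_net n. 2 * exp (- t\<^sup>2 / (2 * L\<^sup>2 * 32)))"
    by (intro sum_mono S'p)
  also have "\<dots> = real (card (grid_net n) * card (grid_net n)) * (2 * exp (- t\<^sup>2 / (2 * L\<^sup>2 * 32)))"
    by (simp add: card_cartesian_product)
  \<comment> \<open>Pairs of net points number at most n^(4n), that is exp (4 n ln n), as 2n + 1
    \<le> n^2 for n \<ge> 3. The factor 20 in \<open>t\<close> makes the Hoeffding exponent 400/64 =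
    6.25 times n ln n, so a surplus of 2.25 n ln n \<ge> 2 ln n remains.\<close>
  also have "\<dots> \<le> exp (4 * real n * ln (real n)) * (2 * exp (- t\<^sup>2 / (2 * L\<^sup>2 * 32)))"
  proof (rule mult_right_mono)
    have "2 * n + 1 \<le> 3 * n" using n by simp
    also have "\<dots> \<le> n * n" using n by simp
    finally have "(2 * n + 1) ^ n \<le> (n * n) ^ n" by (rule power_mono) simp
    then have c1: "card (grid_net n) \<le> (n * n) ^ n" using card_grid_net[of n] by linarith
    have "card (grid_net n) * card (grid_net n) \<le> (n * n) ^ n * (n * n) ^ n" using c1 by (intro mult_mono) auto
    also have "\<dots> = n ^ (n + n + (n + n))" by (simp only: power_mult_distrib power_add)
    also have "n + n + (n + n) = 4 * n" by simp
    finally have "real (card (grid_net n) * card (grid_net n)) \<le> real n ^ (4 * n)"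
      by (metis of_nat_le_iff of_nat_power)
    also have "\<dots> = exp (4 * real n * ln (real n))"
      using n by (subst powr_realpow[symmetric]) (auto simp: powr_def)
    finally show "real (card (grid_net n) * card (grid_net n)) \<le> exp (4 * real n * ln (real n))" .
  qed simp
  also have "\<dots> = 2 * exp (4 * real n * ln (real n) - t\<^sup>2 / (2 * L\<^sup>2 * 32))"
    by (simp add: exp_diff exp_minus field_simps)
  also have "t\<^sup>2 / (2 * L\<^sup>2 * 32) = 400 / 64 * (real n * ln (real n))"
    using L n lnn by (simp add: t_def power_mult_distrib)
  also have "4 * real n * ln (real n) - 400 / 64 * (real n * ln (real n)) \<le> -2 * ln (real n)"
  proof -
    have "1 * ln (real n) \<le> real n * ln (real n)" using n lnn by (intro mult_right_mono) auto
    then show ?thesis using lnn by (simp only: mult.assoc)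
  qed
  then have "2 * exp (4 * real n * ln (real n) - 400 / 64 * (real n * ln (real n))) \<le> 2 * real n powr (-2)"
    using n by (simp add: powr_def)
  finally show "prob S \<le> 2 * real n powr (-2)" .
qed

text \<open>The vector multiplied is a function of the latent variables, so a single Hoeffding bound
  suffices and no net enters. The factor 4 in \<open>t\<close> yields the power -8, ample for the
  union over n rows and p + q columns.\<close>

lemma row_event:
  assumes n: "n \<ge> 3" and L: "L > 0" and B: "B > 0" and k: "k < p + q" and i: "i < n"
    and \<phi>B: "\<And>z. z \<in> space F \<Longrightarrow> \<bar>\<phi> z $ k\<bar> \<le> B"
  defines "t \<equiv> 4 * B * L * sqrt (real n * ln (real n))"
  defines "S \<equiv> {\<omega>\<in>space M. t \<le> \<bar>\<Sum>j<n. trunc_noise L i j \<omega> * \<phi> (Z j \<omega>) $ k\<bar>}"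
  shows "S \<in> sets M" and "prob S \<le> 2 * real n powr (-8)"
proof -
  have lnn: "ln (real n) > 0" using n by simp
  have t: "t > 0" using L n lnn B by (simp add: t_def)
  \<comment> \<open>Row \<open>i\<close> meets the pair \<open>e\<close> through its first or its
    second component, never both, because \<open>fst e < snd e\<close> on
    \<open>upper_pairs n\<close>.\<close>
  define c where "c z e = (if fst e = i then \<phi> (z (snd e)) $ k else 0) + (if snd e = i then \<phi> (z (fst e)) $ k else 0)"
    for z :: "nat \<Rightarrow> 'z" and e :: "nat \<times> nat"
  have row: "(\<Sum>j<n. trunc_noise L i j \<omega> * \<phi> (Z j \<omega>) $ k) = (\<Sum>(a, b)\<in>upper_pairs n. c (latent n \<omega>) (a, b) * trunc_noise L a b \<omega>)"
    if w: "\<omega> \<in> space M" for \<omega>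
  proof -
    have "(\<Sum>j<n. trunc_noise L i j \<omega> * \<phi> (Z j \<omega>) $ k)
      = (\<Sum>a<n. \<Sum>b<n. if a = i then trunc_noise L a b \<omega> * \<phi> (Z b \<omega>) $ k else 0)"
      using i by (subst sum.swap) simp
    also have "\<dots> = (\<Sum>(a, b)\<in>upper_pairs n. (if a = i then trunc_noise L a b \<omega> * \<phi> (Z b \<omega>) $ k else 0)
         + (if b = i then trunc_noise L b a \<omega> * \<phi> (Z a \<omega>) $ k else 0))"
      unfolding sum_square_upper_pairs by (simp add: trunc_noise_def[of L i i] sum.neutral)
    also have "\<dots> = (\<Sum>(a, b)\<in>upper_pairs n. c (latent n \<omega>) (a, b) * trunc_noise L a b \<omega>)"
      using trunc_noise_sym[OF w] by (intro sum.cong refl) (auto simp: c_def latent_def upper_pairs_def algebra_simps)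
    finally show ?thesis .
  qed
  have S: "S = {\<omega>\<in>space M. t \<le> \<bar>\<Sum>(a, b)\<in>upper_pairs n. c (latent n \<omega>) (a, b) * trunc_noise L a b \<omega>\<bar>}"
    unfolding S_def using row by auto
  have cm: "(\<lambda>z. c z e) \<in> borel_measurable (\<Pi>\<^sub>M i\<in>{..<n}. F)" if "e \<in> upper_pairs n" for e
  proof -
    have "fst e \<in> {..<n}" "snd e \<in> {..<n}" using that by (auto simp: upper_pairs_def)
    then have "(\<lambda>z. \<phi> (z (fst e)) $ k) \<in> borel_measurable (\<Pi>\<^sub>M i\<in>{..<n}. F)"
      "(\<lambda>z. \<phi> (z (snd e)) $ k) \<in> borel_measurable (\<Pi>\<^sub>M i\<in>{..<n}. F)"
      using family.\<phi>_measurable[OF k] by (auto intro: measurable_PiM_component_rev[where M = "\<lambda>_. F" and f = "\<lambda>z. \<phi> z $ k"])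
    then show ?thesis unfolding c_def by (cases "fst e = i"; cases "snd e = i") auto
  qed
  have V: "(\<Sum>e\<in>upper_pairs n. (c z e)\<^sup>2) \<le> real n * B\<^sup>2" if z: "z \<in> space (\<Pi>\<^sub>M i\<in>{..<n}. F)" for z
  proof -
    have "(\<Sum>e\<in>upper_pairs n. (c z e)\<^sup>2) = (\<Sum>(a, b)\<in>upper_pairs n. (if a = i then (\<phi> (z b) $ k)\<^sup>2 else 0) + (if b = i then (\<phi> (z a) $ k)\<^sup>2 else 0))"
      by (intro sum.cong refl) (auto simp: c_def upper_pairs_def)
    also have "\<dots> \<le> (\<Sum>a<n. \<Sum>b<n. if a = i then (\<phi> (z b) $ k)\<^sup>2 else 0)" by (rule sum_upper_pairs_le) simp
    also have "\<dots> = (\<Sum>b<n. (\<phi> (z b) $ k)\<^sup>2)" using i by (subst sum.swap) simp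
    also have "\<dots> \<le> (\<Sum>b<n. B\<^sup>2)"
    proof (rule sum_mono)
      fix b assume "b \<in> {..<n}"
      then have "\<bar>\<phi> (z b) $ k\<bar> \<le> B" using \<phi>B family.space_PiM_F[OF z] by auto
      then show "(\<phi> (z b) $ k)\<^sup>2 \<le> B\<^sup>2" by (metis abs_ge_zero power2_abs power_mono)
    qed
    finally show ?thesis by simp
  qed
  have V0: "real n * B\<^sup>2 > 0" using n B by simp
  show "S \<in> sets M" unfolding S by (rule trunc_noise_concentration(1)[OF L cm V V0 t])
  have "prob S \<le> 2 * exp (- t\<^sup>2 / (2 * L\<^sup>2 * (real n * B\<^sup>2)))"
    unfolding S by (rule trunc_noise_concentration(2)[OF L cm V V0 t])
  also have "t\<^sup>2 = 16 * B\<^sup>2 * L\<^sup>2 * (real n * ln (real n))"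
    using n lnn by (simp add: t_def power_mult_distrib)
  also have "- (16 * B\<^sup>2 * L\<^sup>2 * (real n * ln (real n))) / (2 * L\<^sup>2 * (real n * B\<^sup>2)) = -8 * ln (real n)"
    using L B n by (simp add: field_simps)
  also have "exp (-8 * ln (real n)) = real n powr (-8)" using n by (simp add: powr_def)
  finally show "prob S \<le> 2 * real n powr (-8)" .
qed

text \<open>On the diagonal, where \<open>A\<close> vanishes, this is minus the conditional mean.\<close>

definition noise :: "nat \<Rightarrow> nat \<Rightarrow> 'w \<Rightarrow> real" where
  "noise i j \<omega> = A i j \<omega> - (\<Sum>l<p + q. \<phi> (Z i \<omega>) $ l * (if l < p then 1 else -1) * \<phi> (Z j \<omega>) $ l)"

text \<open>Three kinds of bad events are excluded: an entry at or beyond the truncation level, a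
  large bilinear form on the net, a large row sum. Their probabilities are O(n^(-2)), so by
  Borel-Cantelli almost every outcome avoids them for all large n; off them the noise is the
  truncated noise plus a small deterministic correction given the latent variables.\<close>

lemma noise_bounds:
  assumes tails: "log_tails F H \<alpha>"
    and \<phi>B: "\<And>z k. z \<in> space F \<Longrightarrow> k < p + q \<Longrightarrow> \<bar>\<phi> z $ k\<bar> \<le> B" and B: "B > 0"
  shows "\<exists>C\<ge>0. AE \<omega> in M. eventually (\<lambda>n.
     (\<forall>v. L2_set (\<lambda>i. \<Sum>j<n. noise i j \<omega> * v j) {..<n}
        \<le> C * (sqrt (real n) * ln (real n) powr (\<alpha> + 1 / 2)) * L2_set v {..<n}) \<and>
     (\<forall>i<n. \<forall>k<p + q. \<bar>\<Sum>j<n. noise i j \<omega> * \<phi> (Z j \<omega>) $ k\<bar> \<le> C * (sqrt (real n) * ln (real n) powr (\<alpha> + 1 / 2))))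
     sequentially"
proof -
  have \<alpha>: "\<alpha> > 0" using tails by (simp add: log_tails_def)
  have tl: "\<exists>\<beta>>0. \<forall>z1\<in>space F. \<forall>z2\<in>space F. \<forall>t\<ge>2.
      measure (H z1 z2) {x. \<bar>x\<bar> < \<beta> * ln t powr \<alpha>} > 1 - t powr (- \<rho>)" for \<rho>
    using tails unfolding log_tails_def by blast
  \<comment> \<open>Exponent 3 serves the uniform second moment. Exponent 5 fixes the truncation
    level: after a union over at most n^2 entries n^(-3) is left, and in the bias n * n^(-5) is
    below 1/n.\<close>
  obtain \<beta>3 where \<beta>3: "\<beta>3 > 0" and tail3: "\<And>z1 z2 t. z1 \<in> space F \<Longrightarrow> z2 \<in> space F \<Longrightarrow> t \<ge> 2 \<Longrightarrow>
      measure (H z1 z2) {x. \<bar>x\<bar> < \<beta>3 * ln t powr \<alpha>} > 1 - t powr (-3)"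
    using tl[of 3] by blast
  obtain \<beta> where \<beta>: "\<beta> > 0" and tail: "\<And>z1 z2 t. z1 \<in> space F \<Longrightarrow> z2 \<in> space F \<Longrightarrow> t \<ge> 2 \<Longrightarrow>
      measure (H z1 z2) {x. \<bar>x\<bar> < \<beta> * ln t powr \<alpha>} > 1 - t powr (-5)"
    using tl[of 5] by blast
  obtain C2 where C2: "C2 \<ge> 0" "\<And>N. prob_space N \<Longrightarrow> sets N = sets borel \<Longrightarrow>
     (\<And>t. t \<ge> 2 \<Longrightarrow> measure N {x. \<bar>x\<bar> < \<beta>3 * ln t powr \<alpha>} > 1 - t powr (-3)) \<Longrightarrow>
     integrable N (\<lambda>x::real. x\<^sup>2) \<and> (\<integral>x. x\<^sup>2 \<partial>N) \<le> C2"
    using log_tail_second_moment[OF \<alpha> \<beta>3] by blast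
  have second: "integrable (H z1 z2) (\<lambda>x. x\<^sup>2)" "(\<integral>x. x\<^sup>2 \<partial>H z1 z2) \<le> C2" if "z1 \<in> space F" "z2 \<in> space F" for z1 z2
    using C2(2)[OF family.H_prob[OF that] family.sets_H[OF that] tail3[OF that]] by auto
  define L where "L n = \<beta> * ln (real n) powr \<alpha>" for n :: nat
  \<comment> \<open>The truncation level times the Hoeffding scale sqrt (n ln n), up to the factor
    \<beta>.\<close>
  define s where "s n = sqrt (real n) * ln (real n) powr (\<alpha> + 1 / 2)" for n :: nat
  note lnn = ln_ge_one
  have L: "L n > 0" if "n \<ge> 3" for n using lnn[OF that] \<beta> by (simp add: L_def)
  have Ls: "L n * sqrt (real n * ln (real n)) = \<beta> * s n" if "n \<ge> 3" for n
    using lnn[OF that] by (simp add: L_def s_def real_sqrt_mult powr_add powr_half_sqrt)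
  have s1: "s n \<ge> 1" if "n \<ge> 3" for n
  proof -
    have "1 * 1 \<le> sqrt (real n) * ln (real n) powr (\<alpha> + 1 / 2)"
      using that lnn[OF that] \<alpha> by (intro mult_mono ge_one_powr_ge_zero) auto
    then show ?thesis by (simp add: s_def)
  qed
  have Ls': "L n * sqrt (real n) \<le> \<beta> * s n" if "n \<ge> 3" for n
  proof -
    have "sqrt (real n) * 1 \<le> sqrt (real n) * sqrt (ln (real n))" using lnn[OF that] by (intro mult_left_mono) auto
    then have "L n * sqrt (real n) \<le> L n * sqrt (real n * ln (real n))"
      using L[OF that] by (intro mult_left_mono) (auto simp: real_sqrt_mult)
    then show ?thesis using Ls[OF that] by simp
  qed
  have tailL: "measure (H z1 z2) {x. L n \<le> \<bar>x\<bar>} \<le> real n powr (-5)"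
    if z: "z1 \<in> space F" "z2 \<in> space F" and n: "n \<ge> 3" for z1 z2 n
  proof -
    interpret N: prob_space "H z1 z2" by (rule family.H_prob[OF z])
    have sp: "space (H z1 z2) = UNIV" using sets_eq_imp_space_eq[OF family.sets_H[OF z]] by simp
    have "{x. L n \<le> \<bar>x\<bar>} = space (H z1 z2) - {x. \<bar>x\<bar> < L n}" using sp by auto
    moreover have "{x. \<bar>x\<bar> < L n} \<in> sets (H z1 z2)" unfolding family.sets_H[OF z] by measurable
    ultimately have "measure (H z1 z2) {x. L n \<le> \<bar>x\<bar>} = 1 - measure (H z1 z2) {x. \<bar>x\<bar> < L n}"
      using N.prob_compl by simp
    then show ?thesis using tail[OF z, of "real n"] n by (simp add: L_def)
  qed
  define S1 where "S1 n = (\<Union>e\<in>upper_pairs n. {\<omega>\<in>space M. L n \<le> \<bar>A (fst e) (snd e) \<omega>\<bar>})" for n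
  define T2 where "T2 n = 20 * L n * sqrt (real n * ln (real n))" for n
  define S2 where "S2 n = {\<omega>\<in>space M. \<exists>u\<in>grid_net n. \<exists>w\<in>grid_net n.
      T2 n \<le> \<bar>\<Sum>i<n. \<Sum>j<n. u i * trunc_noise (L n) i j \<omega> * w j\<bar>}" for n
  define T3 where "T3 n = 4 * B * L n * sqrt (real n * ln (real n))" for n
  define R where "R n ik = {\<omega>\<in>space M. T3 n \<le> \<bar>\<Sum>j<n. trunc_noise (L n) (fst ik) j \<omega> * \<phi> (Z j \<omega>) $ (snd ik)\<bar>}" for n ik
  define S3 where "S3 n = (\<Union>ik\<in>{..<n} \<times> {..<p + q}. R n ik)" for n
  have S1m: "S1 n \<in> sets M" for n
    unfolding S1_def by (intro sets.finite_UN) auto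
  have S1p: "prob (S1 n) \<le> real n powr (-2)" if n: "n \<ge> 3" for n
  proof -
    have "prob (S1 n) \<le> (\<Sum>e\<in>upper_pairs n. prob {\<omega>\<in>space M. L n \<le> \<bar>A (fst e) (snd e) \<omega>\<bar>})"
      unfolding S1_def by (intro finite_measure_subadditive_finite) auto
    also have "\<dots> \<le> (\<Sum>e\<in>upper_pairs n. real n powr (-5))"
      by (intro sum_mono prob_entry_large) (use tailL n in auto)
    also have "\<dots> \<le> real n ^ 2 * real n powr (-5)"
    proof -
      have "card (upper_pairs n) \<le> card ({..<n} \<times> {..<n})" by (intro card_mono) (auto simp: upper_pairs_def)
      then have "real (card (upper_pairs n)) \<le> real (n * n)"
        by (simp only: card_cartesian_product card_lessThan of_nat_le_iff)
      then have "real (card (upper_pairs n)) \<le> real n ^ 2" by (simp add: power2_eq_square)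
      then show ?thesis by (simp add: mult_right_mono)
    qed
    also have "\<dots> = real n powr (2 + -5)" using n unfolding powr_add by (simp add: powr_numeral)
    also have "\<dots> \<le> real n powr (-2)" using n by (intro powr_mono) auto
    finally show ?thesis .
  qed
  have S2: "S2 n \<in> sets M" "prob (S2 n) \<le> 2 * real n powr (-2)" if n: "n \<ge> 3" for n
    unfolding S2_def T2_def by (fact net_event[OF n L[OF n]])+
  have R: "R n ik \<in> sets M" "prob (R n ik) \<le> 2 * real n powr (-8)"
    if n: "n \<ge> 3" and ik: "ik \<in> {..<n} \<times> {..<p + q}" for n ik
  proof -
    have "fst ik < n" "snd ik < p + q" using ik by auto
    note r = row_event[OF n L[OF n] B this(2,1) \<phi>B[OF _ this(2)]]
    show "R n ik \<in> sets M" "prob (R n ik) \<le> 2 * real n powr (-8)"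
      unfolding R_def T3_def by (rule r; assumption)+
  qed
  have S3m: "S3 n \<in> sets M" if n: "n \<ge> 3" for n
    unfolding S3_def using R(1)[OF n] by (intro sets.finite_UN) auto
  have S3p: "prob (S3 n) \<le> 2 * real (p + q) * real n powr (-2)" if n: "n \<ge> 3" for n
  proof -
    have "prob (S3 n) \<le> (\<Sum>ik\<in>{..<n} \<times> {..<p + q}. prob (R n ik))"
      unfolding S3_def using R(1)[OF n] by (intro finite_measure_subadditive_finite) auto
    also have "\<dots> \<le> (\<Sum>ik\<in>{..<n} \<times> {..<p + q}. 2 * real n powr (-8))"
      by (intro sum_mono R(2)[OF n])
    also have "\<dots> = 2 * real (p + q) * (real n powr 1 * real n powr (-8))"
      using n by (simp add: card_cartesian_product)
    also have "\<dots> = 2 * real (p + q) * real n powr (-7)" unfolding powr_add[symmetric] by simp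
    also have "\<dots> \<le> 2 * real (p + q) * real n powr (-2)"
      using n by (intro mult_left_mono powr_mono) auto
    finally show ?thesis .
  qed
  define S where "S n = (if n \<ge> 3 then S1 n \<union> S2 n \<union> S3 n else {})" for n
  have Sm: "S n \<in> sets M" for n using S1m S2 S3m by (auto simp: S_def)
  have Sp: "prob (S n) \<le> (3 + 2 * real (p + q)) * real n powr (-2)" for n
  proof (cases "n \<ge> 3")
    case True
    have "prob (S n) \<le> prob (S1 n \<union> S2 n) + prob (S3 n)"
      using True S1m S2 S3m by (auto simp: S_def intro!: measure_Un_le)
    also have "prob (S1 n \<union> S2 n) \<le> prob (S1 n) + prob (S2 n)"
      using True S1m S2 by (intro measure_Un_le) auto
    finally show ?thesis using S1p[OF True] S2(2)[OF True] S3p[OF True] by (simp add: algebra_simps)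
  qed (simp add: S_def)
  have "summable (\<lambda>n. (3 + 2 * real (p + q)) * real n powr (-2))"
    by (intro summable_mult) (simp add: summable_real_powr_iff)
  then have "summable (\<lambda>n. prob (S n))"
    by (rule summable_comparison_test_ev[rotated]) (use Sp in auto)
  then have ae: "AE \<omega> in M. eventually (\<lambda>n. \<omega> \<in> space M - S n) sequentially"
    by (intro borel_cantelli_AE1 Sm) (auto simp: emeasure_eq_measure)
  define a where "a = C2 + 1"
  define b where "b = real (p + q) * B\<^sup>2"
  have ab: "a \<ge> 0" "b \<ge> 0" using C2 by (auto simp: a_def b_def)
  \<comment> \<open>26 = 20 + 6: the net threshold plus the rounding term 3 (2 L) sqrt n. The terms
    4 B \<beta> and (a + b) B belong to the row sums; one constant serves both bounds.\<close>
  define C where "C = 26 * \<beta> + a + b + 4 * B * \<beta> + (a + b) * B"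
  have C: "C \<ge> 0" using ab \<beta> B by (simp add: C_def)
  have main: "(\<forall>v. L2_set (\<lambda>i. \<Sum>j<n. noise i j \<omega> * v j) {..<n} \<le> C * s n * L2_set v {..<n}) \<and>
     (\<forall>i<n. \<forall>k<p + q. \<bar>\<Sum>j<n. noise i j \<omega> * \<phi> (Z j \<omega>) $ k\<bar> \<le> C * s n)"
    if w: "\<omega> \<in> space M - S n" and n: "n \<ge> 3" for \<omega> n
  proof -
    have wM: "\<omega> \<in> space M" and w1: "\<omega> \<notin> S1 n" and w2: "\<omega> \<notin> S2 n" and w3: "\<omega> \<notin> S3 n"
      using w n by (auto simp: S_def)
    have L0: "L n \<ge> 0" using L[OF n] by simp
    \<comment> \<open>Off the diagonal truncation leaves the entries unchanged on the good event, so
      only the difference of the conditional means remains; on the diagonal \<open>D\<close> is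
      minus the conditional mean.\<close>
    define D where "D i j = noise i j \<omega> - trunc_noise (L n) i j \<omega>" for i j
    have P: "(\<Sum>l<p + q. \<phi> (Z i \<omega>) $ l * (if l < p then 1 else -1) * \<phi> (Z j \<omega>) $ l) = (\<integral>x. x \<partial>H (Z i \<omega>) (Z j \<omega>))" for i j
      using family.inner_Ipq[OF Z_space[OF wM] Z_space[OF wM]] family.H_mean[OF Z_space[OF wM] Z_space[OF wM]] by simp
    have small: "\<bar>A i j \<omega>\<bar> < L n" if ij: "i < n" "j < n" "i \<noteq> j" for i j
    proof -
      have "\<bar>A i j \<omega>\<bar> < L n" if "(i, j) \<in> upper_pairs n" for i j
        using w1 wM that by (force simp: S1_def not_le)
      from this[of i j] this[of j i] show ?thesis
        using ij A_sym[OF wM, of i j] by (auto simp: upper_pairs_def neq_iff)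
    qed
    have D: "\<bar>D i j\<bar> \<le> (if i = j then b else a / real n)" if ij: "i < n" "j < n" for i j
    proof (cases "i = j")
      case True
      have "\<bar>D i j\<bar> = \<bar>\<Sum>l<p + q. \<phi> (Z i \<omega>) $ l * (if l < p then 1 else -1) * \<phi> (Z i \<omega>) $ l\<bar>"
        using True A_diag[OF wM] by (simp add: D_def noise_def trunc_noise_def)
      also have "\<dots> \<le> (\<Sum>l<p + q. B\<^sup>2)"
      proof (rule order_trans[OF sum_abs], rule sum_mono)
        fix l assume "l \<in> {..<p + q}"
        then have "\<bar>\<phi> (Z i \<omega>) $ l\<bar> \<le> B" using \<phi>B Z_space[OF wM] by auto
        then have "\<bar>\<phi> (Z i \<omega>) $ l\<bar> * \<bar>\<phi> (Z i \<omega>) $ l\<bar> \<le> B * B" by (intro mult_mono) auto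
        then show "\<bar>\<phi> (Z i \<omega>) $ l * (if l < p then 1 else -1) * \<phi> (Z i \<omega>) $ l\<bar> \<le> B\<^sup>2"
          by (simp add: abs_mult power2_eq_square)
      qed
      finally show ?thesis using True by (simp add: b_def)
    next
      case False
      have z: "Z i \<omega> \<in> space F" "Z j \<omega> \<in> space F" using Z_space[OF wM] by auto
      have "trunc (L n) (A i j \<omega>) = A i j \<omega>" using small[OF ij False] by (simp add: trunc_def)
      then have "D i j = (\<integral>x. trunc (L n) x \<partial>H (Z i \<omega>) (Z j \<omega>)) - (\<integral>x. x \<partial>H (Z i \<omega>) (Z j \<omega>))"
        using False P by (simp add: D_def noise_def trunc_noise_def trunc_mean_def)
      \<comment> \<open>The free parameter of \<open>truncation_bias\<close> is taken to be n: the
        second moment is divided by n, and the tail n^(-5) easily absorbs the factor n.\<close>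
      then have "\<bar>D i j\<bar> \<le> ((\<integral>x. x\<^sup>2 \<partial>H (Z i \<omega>) (Z j \<omega>)) / real n + real n * measure (H (Z i \<omega>) (Z j \<omega>)) {x. L n \<le> \<bar>x\<bar>}) / 2"
        using truncation_bias[OF family.H_prob[OF z] family.sets_H[OF z] family.H_integrable[OF z] second(1)[OF z], of "real n" "L n"] n L0
        by simp
      also have "\<dots> \<le> (C2 / real n + real n * real n powr (-5)) / 2"
        using second(2)[OF z] tailL[OF z n] by (intro divide_right_mono add_mono mult_left_mono) auto
      also have "real n * real n powr (-5) = real n powr (1 + -5)" using n unfolding powr_add by simp
      also have "(C2 / real n + real n powr (1 + -5)) / 2 \<le> (C2 / real n + real n powr (-1)) / 2"
        using n by (intro divide_right_mono add_left_mono powr_mono) auto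
      also have "\<dots> = (C2 + 1) / real n / 2" using n by (simp add: powr_minus_divide add_divide_distrib)
      also have "\<dots> \<le> a / real n"
      proof -
        have half: "x / 2 \<le> x" if "0 \<le> x" for x :: real using that by simp
        have "0 \<le> a / real n" using ab by simp
        from half[OF this] show ?thesis unfolding a_def .
      qed
      finally show ?thesis using False by simp
    qed
    have nE: "noise i j \<omega> = trunc_noise (L n) i j \<omega> + D i j" for i j by (simp add: D_def)
    have op: "L2_set (\<lambda>i. \<Sum>j<n. trunc_noise (L n) i j \<omega> * v j) {..<n} \<le> (T2 n + 3 * (2 * L n) * sqrt n) * L2_set v {..<n}" for v
    proof (rule operator_bound_of_net)
      show "\<bar>trunc_noise (L n) i j \<omega>\<bar> \<le> 2 * L n" for i j by (rule abs_trunc_noise_le[OF wM L0])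
      show "\<bar>\<Sum>i<n. \<Sum>j<n. u i * trunc_noise (L n) i j \<omega> * w j\<bar> \<le> T2 n" if "u \<in> grid_net n" "w \<in> grid_net n" for u w
        using w2 wM that by (force simp: S2_def not_le)
    qed (use n L0 in auto)
    have T2s: "T2 n + 3 * (2 * L n) * sqrt n + a + b \<le> C * s n"
    proof -
      have "T2 n = 20 * (\<beta> * s n)" using Ls[OF n] by (simp add: T2_def)
      moreover have "3 * (2 * L n) * sqrt n \<le> 6 * (\<beta> * s n)" using Ls'[OF n] by simp
      moreover have "a + b \<le> (a + b) * s n" using s1[OF n] ab by (simp add: mult_le_cancel_left1)
      moreover have "0 \<le> (4 * B * \<beta> + (a + b) * B) * s n" using B \<beta> ab s1[OF n] by (intro mult_nonneg_nonneg) auto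
      ultimately show ?thesis by (simp add: C_def algebra_simps)
    qed
    have "L2_set (\<lambda>i. \<Sum>j<n. noise i j \<omega> * v j) {..<n} \<le> C * s n * L2_set v {..<n}" for v
    proof -
      have "L2_set (\<lambda>i. \<Sum>j<n. noise i j \<omega> * v j) {..<n} \<le> (T2 n + 3 * (2 * L n) * sqrt n + a + b) * L2_set v {..<n}"
        unfolding nE by (rule perturbed_operator_bound[OF D ab op])
      also have "\<dots> \<le> C * s n * L2_set v {..<n}" using T2s by (intro mult_right_mono) auto
      finally show ?thesis .
    qed
    moreover have "\<bar>\<Sum>j<n. noise i j \<omega> * \<phi> (Z j \<omega>) $ k\<bar> \<le> C * s n" if ik: "i < n" "k < p + q" for i k
    proof -
      have "\<bar>\<Sum>j<n. trunc_noise (L n) i j \<omega> * \<phi> (Z j \<omega>) $ k\<bar> \<le> T3 n"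
        using w3 wM ik by (force simp: S3_def R_def not_le)
      moreover have "\<bar>\<Sum>j<n. D i j * \<phi> (Z j \<omega>) $ k\<bar> \<le> (a + b) * B"
        by (rule perturbed_row_bound) (use D ik ab \<phi>B Z_space[OF wM] B in auto)
      moreover have "(\<Sum>j<n. noise i j \<omega> * \<phi> (Z j \<omega>) $ k) = (\<Sum>j<n. trunc_noise (L n) i j \<omega> * \<phi> (Z j \<omega>) $ k) + (\<Sum>j<n. D i j * \<phi> (Z j \<omega>) $ k)"
        unfolding nE by (simp add: distrib_right sum.distrib)
      moreover have "T3 n = 4 * B * (\<beta> * s n)" using Ls[OF n] by (simp add: T3_def)
      moreover have "(a + b) * B \<le> (a + b) * B * s n"
        using mult_left_mono[OF s1[OF n], of "(a + b) * B"] ab B by simp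
      moreover have "0 \<le> (26 * \<beta> + a + b) * s n" using \<beta> ab s1[OF n] by (intro mult_nonneg_nonneg) auto
      ultimately show ?thesis by (simp add: C_def algebra_simps)
    qed
    ultimately show ?thesis by blast
  qed
  show ?thesis
  proof (intro exI[of _ C] conjI C)
    show "AE \<omega> in M. eventually (\<lambda>n.
     (\<forall>v. L2_set (\<lambda>i. \<Sum>j<n. noise i j \<omega> * v j) {..<n}
        \<le> C * (sqrt (real n) * ln (real n) powr (\<alpha> + 1 / 2)) * L2_set v {..<n}) \<and>
     (\<forall>i<n. \<forall>k<p + q. \<bar>\<Sum>j<n. noise i j \<omega> * \<phi> (Z j \<omega>) $ k\<bar> \<le> C * (sqrt (real n) * ln (real n) powr (\<alpha> + 1 / 2))))
     sequentially"
      using ae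
    proof eventually_elim
      case (elim \<omega>)
      with eventually_ge_at_top[of 3] show ?case
        by eventually_elim (use main in \<open>simp add: s_def\<close>)
    qed
  qed
qed

end

section \<open>The second moment matrix\<close>

text \<open>The adjugate provides an explicit inverse, and \<kappa> is the sum of its absolute
  entries. This entrywise stability of the inverse is applied twice: to bound the latent positions
  and to make positive definiteness quantitative.\<close>

lemma bounded_inverse_of_full_rank:
  fixes D :: "nat \<Rightarrow> nat \<Rightarrow> real"
  assumes "vec_space.rank d (Matrix.mat d d (\<lambda>(i, j). D i j)) = d"
  obtains \<kappa> where "\<kappa> \<ge> 0"
    "\<forall>v m. (\<forall>i<d. \<bar>\<Sum>j<d. D i j * v j\<bar> \<le> m) \<longrightarrow> (\<forall>k<d. \<bar>v k\<bar> \<le> \<kappa> * m)"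
proof -
  define Dm where "Dm = Matrix.mat d d (\<lambda>(i, j). D i j)"
  have Dm: "Dm \<in> carrier_mat d d" by (simp add: Dm_def)
  have det: "Determinant.det Dm \<noteq> 0"
    using vec_space.det_rank_iff[OF Dm] assms unfolding Dm_def by simp
  define R where "R = (1 / Determinant.det Dm) \<cdot>\<^sub>m adj_mat Dm"
  have R: "R \<in> carrier_mat d d" using adj_mat(1)[OF Dm] by (simp add: R_def)
  have RD: "R * Dm = 1\<^sub>m d"
  proof -
    have "R * Dm = (1 / Determinant.det Dm) \<cdot>\<^sub>m (Determinant.det Dm \<cdot>\<^sub>m 1\<^sub>m d)"
      unfolding R_def adj_mat(3)[OF Dm, symmetric] by (rule mult_smult_assoc_mat[OF adj_mat(1)[OF Dm] Dm])
    also have "\<dots> = 1\<^sub>m d" using det by (intro eq_matI) auto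
    finally show ?thesis .
  qed
  define \<kappa> where "\<kappa> = (\<Sum>k<d. \<Sum>i<d. \<bar>R $$ (k, i)\<bar>)"
  have \<kappa>: "\<kappa> \<ge> 0" by (simp add: \<kappa>_def sum_nonneg)
  show ?thesis
  proof (rule that[OF \<kappa>], intro allI impI)
    fix v m k assume "\<forall>i<d. \<bar>\<Sum>j<d. D i j * v j\<bar> \<le> m" and k: "k < d"
    then have m: "\<And>i. i < d \<Longrightarrow> \<bar>\<Sum>j<d. D i j * v j\<bar> \<le> m" by blast
    have m0: "m \<ge> 0" using m[OF k] by linarith
    have RDe: "(\<Sum>i<d. R $$ (k, i) * D i j) = (if k = j then 1 else 0)" if "j < d" for j
    proof -
      have "(R * Dm) $$ (k, j) = (\<Sum>i<d. R $$ (k, i) * D i j)"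
        using that k R by (simp add: Dm_def scalar_prod_def atLeast0LessThan)
      then show ?thesis unfolding RD using that k by simp
    qed
    have "(\<Sum>i<d. R $$ (k, i) * (\<Sum>j<d. D i j * v j)) = (\<Sum>j<d. (\<Sum>i<d. R $$ (k, i) * D i j) * v j)"
      unfolding sum_distrib_left sum_distrib_right by (subst sum.swap) (simp add: mult_ac)
    also have "\<dots> = (\<Sum>j<d. if j = k then v j else 0)" by (intro sum.cong refl) (auto simp: RDe)
    also have "\<dots> = v k" using k by simp
    finally have "\<bar>v k\<bar> = \<bar>\<Sum>i<d. R $$ (k, i) * (\<Sum>j<d. D i j * v j)\<bar>" by simp
    also have "\<dots> \<le> (\<Sum>i<d. \<bar>R $$ (k, i)\<bar> * m)"
      by (rule order_trans[OF sum_abs], rule sum_mono) (use m in \<open>auto simp: abs_mult intro!: mult_left_mono\<close>)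
    also have "\<dots> = (\<Sum>i<d. \<bar>R $$ (k, i)\<bar>) * m" by (simp add: sum_distrib_right)
    also have "\<dots> \<le> \<kappa> * m" unfolding \<kappa>_def
      using k m0 by (intro mult_right_mono member_le_sum[where f = "\<lambda>k. \<Sum>i<d. \<bar>R $$ (k, i)\<bar>"]) (auto intro: sum_nonneg)
    finally show "\<bar>v k\<bar> \<le> \<kappa> * m" .
  qed
qed

lemma (in prob_space) square_expectation_le:
  assumes "integrable M f" "integrable M (\<lambda>x. (f x)\<^sup>2)"
  shows "(expectation f)\<^sup>2 \<le> expectation (\<lambda>x. (f x)\<^sup>2 :: real)"
  using variance_eq[OF assms] variance_positive[of f] by simp

context wgrdpg_family
begin

definition second_moment :: "nat \<Rightarrow> nat \<Rightarrow> real" where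
  "second_moment i j = (\<integral>z. \<phi> z $ i * \<phi> z $ j \<partial>F)"

text \<open>\<open>\<Delta> J \<phi> z = E (\<phi> Z (\<phi> Z)\<^sup>T J \<phi> z)\<close> is bounded because the conditional means are.\<close>

lemma latent_positions_bounded:
  assumes full: "full_rank_second_moment F \<phi> (p + q)" and means: "bounded_means F \<phi> p q"
  obtains B where "B > 0" "\<And>z k. z \<in> space F \<Longrightarrow> k < p + q \<Longrightarrow> \<bar>\<phi> z $ k\<bar> \<le> B"
proof -
  define d where "d = p + q"
  define J where "J l = (if l < p then 1 else (-1 :: real))" for l :: nat
  have int: "integrable F (\<lambda>z. \<phi> z $ i * \<phi> z $ j)" if "i < d" "j < d" for i j
    using full that by (auto simp: full_rank_second_moment_def d_def)
  have "vec_space.rank d (Matrix.mat d d (\<lambda>(i, j). second_moment i j)) = d"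
    using full by (simp add: full_rank_second_moment_def second_moment_def d_def)
  then obtain \<kappa> where \<kappa>: "\<kappa> \<ge> 0"
    "\<forall>v m. (\<forall>i<d. \<bar>\<Sum>j<d. second_moment i j * v j\<bar> \<le> m) \<longrightarrow> (\<forall>k<d. \<bar>v k\<bar> \<le> \<kappa> * m)"
    by (rule bounded_inverse_of_full_rank) (rule that; assumption)
  obtain a b where ab: "\<And>z1 z2. z1 \<in> space F \<Longrightarrow> z2 \<in> space F \<Longrightarrow> \<phi> z1 \<bullet> (Ipq p q *\<^sub>v \<phi> z2) \<in> {a..b}"
    using means unfolding bounded_means_def by blast
  define b0 where "b0 = \<bar>a\<bar> + \<bar>b\<bar>"
  have b0: "b0 \<ge> 0" by (simp add: b0_def)
  have inner: "(\<Sum>l<d. \<phi> z' $ l * (J l * \<phi> z $ l)) = \<phi> z' \<bullet> (Ipq p q *\<^sub>v \<phi> z)"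
    if "z \<in> space F" "z' \<in> space F" for z z'
    using inner_Ipq[OF that(2,1)] by (simp add: d_def J_def mult.assoc)
  have bnd: "\<bar>\<Sum>l<d. \<phi> z' $ l * (J l * \<phi> z $ l)\<bar> \<le> b0" if "z \<in> space F" "z' \<in> space F" for z z'
    using ab[OF that(2,1)] unfolding inner[OF that] b0_def by auto
  \<comment> \<open>Summing all diagonal moments gives one bound valid for every coordinate
    \<open>i\<close>.\<close>
  define m where "m = b0 * (1 + (\<Sum>k<d. second_moment k k))"
  have sm0: "second_moment k k \<ge> 0" for k by (simp add: second_moment_def)
  have "\<bar>\<phi> z $ k\<bar> \<le> \<kappa> * m" if z: "z \<in> space F" and k: "k < d" for z k
  proof -
    have "\<bar>\<Sum>l<d. second_moment i l * (J l * \<phi> z $ l)\<bar> \<le> m" if i: "i < d" for i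
    proof -
      have "(\<Sum>l<d. second_moment i l * (J l * \<phi> z $ l)) = (\<integral>z'. (\<Sum>l<d. (\<phi> z' $ i * \<phi> z' $ l) * (J l * \<phi> z $ l)) \<partial>F)"
        unfolding second_moment_def using int[OF i] by (simp add: Bochner_Integration.integral_sum)
      also have "\<dots> = (\<integral>z'. \<phi> z' $ i * (\<Sum>l<d. \<phi> z' $ l * (J l * \<phi> z $ l)) \<partial>F)"
        by (simp add: sum_distrib_left mult.assoc)
      finally have e: "(\<Sum>l<d. second_moment i l * (J l * \<phi> z $ l)) = (\<integral>z'. \<phi> z' $ i * (\<Sum>l<d. \<phi> z' $ l * (J l * \<phi> z $ l)) \<partial>F)" .
      have ii: "integrable F (\<lambda>z'. b0 * (1 + \<phi> z' $ i * \<phi> z' $ i))" using int[OF i i] by simp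
      have "\<bar>\<integral>z'. \<phi> z' $ i * (\<Sum>l<d. \<phi> z' $ l * (J l * \<phi> z $ l)) \<partial>F\<bar> \<le> (\<integral>z'. b0 * (1 + \<phi> z' $ i * \<phi> z' $ i) \<partial>F)"
      proof (rule order_trans[OF integral_abs_bound], rule integral_mono)
        have "integrable F (\<lambda>z'. \<Sum>l<d. (\<phi> z' $ i * \<phi> z' $ l) * (J l * \<phi> z $ l))"
          by (intro Bochner_Integration.integrable_sum integrable_mult_left int i) auto
        then show "integrable F (\<lambda>z'. \<bar>\<phi> z' $ i * (\<Sum>l<d. \<phi> z' $ l * (J l * \<phi> z $ l))\<bar>)"
          by (intro integrable_abs) (simp add: sum_distrib_left mult.assoc)
        show "integrable F (\<lambda>z'. b0 * (1 + \<phi> z' $ i * \<phi> z' $ i))" by (rule ii)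
        fix z' assume z': "z' \<in> space F"
        \<comment> \<open>The integrable quantities at hand are second moments, so |x| is dominated
          by 1 + x^2.\<close>
        have "(\<bar>\<phi> z' $ i\<bar> - 1)\<^sup>2 = \<phi> z' $ i * \<phi> z' $ i - 2 * \<bar>\<phi> z' $ i\<bar> + 1"
          by (simp add: power2_eq_square algebra_simps)
        then have "2 * \<bar>\<phi> z' $ i\<bar> \<le> 1 + \<phi> z' $ i * \<phi> z' $ i"
          using zero_le_power2[of "\<bar>\<phi> z' $ i\<bar> - 1"] by linarith
        then have "\<bar>\<phi> z' $ i\<bar> \<le> 1 + \<phi> z' $ i * \<phi> z' $ i" using abs_ge_zero[of "\<phi> z' $ i"] by linarith
        then have "\<bar>\<phi> z' $ i\<bar> * \<bar>\<Sum>l<d. \<phi> z' $ l * (J l * \<phi> z $ l)\<bar> \<le> (1 + \<phi> z' $ i * \<phi> z' $ i) * b0"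
          using bnd[OF z z'] by (intro mult_mono) auto
        then show "\<bar>\<phi> z' $ i * (\<Sum>l<d. \<phi> z' $ l * (J l * \<phi> z $ l))\<bar> \<le> b0 * (1 + \<phi> z' $ i * \<phi> z' $ i)"
          by (simp add: abs_mult mult.commute)
      qed
      also have "\<dots> = b0 * (1 + second_moment i i)"
        using int[OF i i] prob_space by (simp add: second_moment_def)
      also have "\<dots> \<le> m" unfolding m_def
        using b0 i sm0 by (intro mult_left_mono add_left_mono member_le_sum[where f = "\<lambda>k. second_moment k k"]) auto
      finally show ?thesis unfolding e .
    qed
    then have "\<bar>J k * \<phi> z $ k\<bar> \<le> \<kappa> * m"
      using \<kappa>(2)[THEN spec[of _ "\<lambda>l. J l * \<phi> z $ l"], THEN spec[of _ m]] k by blast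
    then show ?thesis by (simp add: abs_mult J_def split: if_splits)
  qed
  moreover have "\<kappa> * m \<ge> 0" using \<kappa> b0 sm0 by (simp add: m_def sum_nonneg)
  ultimately show ?thesis by (intro that[of "\<kappa> * m + 1"]) (auto simp: d_def intro: add_increasing2)
qed

text \<open>With w = <v, \<phi>> the quadratic form is E w^2, and each coordinate E(\<phi> i w) of
  the moment matrix applied to v is at most B sqrt (E w^2). Inverting the matrix bounds v by a
  multiple of sqrt (E w^2); no eigenvalues and no compactness enter.\<close>

lemma second_moment_positive_definite:
  assumes full: "full_rank_second_moment F \<phi> (p + q)"
    and B: "B > 0" "\<And>z k. z \<in> space F \<Longrightarrow> k < p + q \<Longrightarrow> \<bar>\<phi> z $ k\<bar> \<le> B"
  obtains c where "c > 0" "\<And>v. c * (\<Sum>k<p + q. (v k)\<^sup>2) \<le> (\<Sum>k<p + q. \<Sum>l<p + q. v k * second_moment k l * v l)"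
proof -
  define d where "d = p + q"
  have d: "real d > 0" using dim_pos by (simp add: d_def)
  have int: "integrable F (\<lambda>z. \<phi> z $ i * \<phi> z $ j)" if "i < d" "j < d" for i j
    using full that by (auto simp: full_rank_second_moment_def d_def)
  have "vec_space.rank d (Matrix.mat d d (\<lambda>(i, j). second_moment i j)) = d"
    using full by (simp add: full_rank_second_moment_def second_moment_def d_def)
  then obtain \<kappa> where \<kappa>: "\<kappa> \<ge> 0"
    "\<forall>v m. (\<forall>i<d. \<bar>\<Sum>j<d. second_moment i j * v j\<bar> \<le> m) \<longrightarrow> (\<forall>k<d. \<bar>v k\<bar> \<le> \<kappa> * m)"
    by (rule bounded_inverse_of_full_rank) (rule that; assumption)
  \<comment> \<open>The summand 1 keeps \<open>C\<close> positive even if \<kappa> is 0.\<close>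
  define C where "C = real d * (\<kappa> * B)\<^sup>2 + 1"
  have C: "C > 0" by (simp add: C_def add_nonneg_pos)
  show ?thesis
  proof (rule that[of "1 / C"])
    show "1 / C > 0" using C by simp
    fix v :: "nat \<Rightarrow> real"
    define w where "w z = (\<Sum>k<d. v k * \<phi> z $ k)" for z
    define Q where "Q = (\<Sum>k<d. \<Sum>l<d. v k * second_moment k l * v l)"
    have w2: "(w z)\<^sup>2 = (\<Sum>k<d. \<Sum>l<d. v k * v l * (\<phi> z $ k * \<phi> z $ l))" for z
      unfolding w_def power2_eq_square sum_product by (simp add: mult_ac)
    have iw2: "integrable F (\<lambda>z. (w z)\<^sup>2)" unfolding w2
      by (intro Bochner_Integration.integrable_sum integrable_mult_right int) auto
    have Qw: "Q = (\<integral>z. (w z)\<^sup>2 \<partial>F)"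
    proof -
      have "(\<integral>z. (w z)\<^sup>2 \<partial>F) = (\<Sum>k<d. (\<integral>z. (\<Sum>l<d. v k * v l * (\<phi> z $ k * \<phi> z $ l)) \<partial>F))"
        unfolding w2
        by (intro Bochner_Integration.integral_sum Bochner_Integration.integrable_sum integrable_mult_right int) auto
      also have "\<dots> = (\<Sum>k<d. \<Sum>l<d. (\<integral>z. v k * v l * (\<phi> z $ k * \<phi> z $ l) \<partial>F))"
        by (intro sum.cong refl Bochner_Integration.integral_sum integrable_mult_right int) auto
      also have "\<dots> = Q" by (simp add: Q_def second_moment_def mult_ac)
      finally show ?thesis by simp
    qed
    have wm: "w \<in> borel_measurable F"
      unfolding w_def using \<phi>_measurable by (auto simp: d_def intro!: borel_measurable_sum borel_measurable_times)
    have Q0: "Q \<ge> 0" unfolding Qw by simp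
    have "\<bar>\<Sum>j<d. second_moment i j * v j\<bar> \<le> B * sqrt Q" if i: "i < d" for i
    proof -
      have e: "(\<Sum>j<d. second_moment i j * v j) = (\<integral>z. \<phi> z $ i * w z \<partial>F)"
        unfolding w_def second_moment_def using int[OF i] by (simp add: sum_distrib_left mult_ac Bochner_Integration.integral_sum)
      have i1: "integrable F (\<lambda>z. \<phi> z $ i * w z)"
      proof -
        have "(\<lambda>z. \<phi> z $ i * w z) = (\<lambda>z. \<Sum>j<d. v j * (\<phi> z $ i * \<phi> z $ j))"
          by (simp add: w_def sum_distrib_left mult_ac)
        then show ?thesis by (simp only:) (intro Bochner_Integration.integrable_sum integrable_mult_right int i, auto)
      qed
      have le: "(\<phi> z $ i * w z)\<^sup>2 \<le> B\<^sup>2 * (w z)\<^sup>2" if "z \<in> space F" for z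
      proof -
        have "\<bar>\<phi> z $ i\<bar> \<le> B" using B(2)[OF that] i by (simp add: d_def)
        then have "(\<phi> z $ i)\<^sup>2 \<le> B\<^sup>2" by (metis abs_ge_zero power2_abs power_mono)
        then show ?thesis by (simp add: power_mult_distrib mult_right_mono)
      qed
      have i2: "integrable F (\<lambda>z. (\<phi> z $ i * w z)\<^sup>2)"
      proof (rule Bochner_Integration.integrable_bound[of F "\<lambda>z. B\<^sup>2 * (w z)\<^sup>2"])
        show "integrable F (\<lambda>z. B\<^sup>2 * (w z)\<^sup>2)" using iw2 by simp
        show "(\<lambda>z. (\<phi> z $ i * w z)\<^sup>2) \<in> borel_measurable F" using i1 by (auto intro: borel_measurable_power)
        show "AE z in F. norm ((\<phi> z $ i * w z)\<^sup>2) \<le> norm (B\<^sup>2 * (w z)\<^sup>2)" using le by (intro AE_I2) simp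
      qed
      have "(\<Sum>j<d. second_moment i j * v j)\<^sup>2 \<le> (\<integral>z. (\<phi> z $ i * w z)\<^sup>2 \<partial>F)"
        unfolding e by (rule square_expectation_le[OF i1 i2])
      also have "\<dots> \<le> (\<integral>z. B\<^sup>2 * (w z)\<^sup>2 \<partial>F)"
        using i2 iw2 le by (intro integral_mono) auto
      also have "\<dots> = (B * sqrt Q)\<^sup>2" using Q0 by (simp add: Qw[symmetric] power_mult_distrib)
      finally show ?thesis using B(1) Q0 by (metis abs_le_square_iff abs_of_nonneg mult_nonneg_nonneg less_imp_le real_sqrt_ge_zero)
    qed
    then have vk: "\<bar>v k\<bar> \<le> \<kappa> * (B * sqrt Q)" if "k < d" for k
      using \<kappa>(2)[THEN spec[of _ v], THEN spec[of _ "B * sqrt Q"]] that by blast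
    have "(\<Sum>k<d. (v k)\<^sup>2) \<le> (\<Sum>k<d. (\<kappa> * (B * sqrt Q))\<^sup>2)"
    proof (rule sum_mono)
      fix k assume "k \<in> {..<d}"
      then show "(v k)\<^sup>2 \<le> (\<kappa> * (B * sqrt Q))\<^sup>2" using vk[of k] by (metis abs_ge_zero lessThan_iff power2_abs power_mono)
    qed
    also have "\<dots> = real d * (\<kappa> * B)\<^sup>2 * Q" using Q0 by (simp add: power_mult_distrib)
    also have "\<dots> \<le> C * Q" using Q0 by (intro mult_right_mono) (auto simp: C_def)
    finally have "1 / C * (\<Sum>k<d. (v k)\<^sup>2) \<le> Q" using C by (simp add: field_simps)
    then show "1 / C * (\<Sum>k<p + q. (v k)\<^sup>2) \<le> (\<Sum>k<p + q. \<Sum>l<p + q. v k * second_moment k l * v l)"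
      by (simp add: d_def Q_def)
  qed
qed

end

section \<open>Almost sure lower bound for the sample Gram matrix\<close>

context wgrdpg
begin

text \<open>A strong law for bounded variables: Hoeffding's inequality gives geometrically decaying
  deviation probabilities, and Borel-Cantelli turns them into an almost sure statement for a fixed
  tolerance, which is all that the Gram bound asks for.\<close>

lemma sample_second_moment:
  assumes \<phi>B: "\<And>z k. z \<in> space F \<Longrightarrow> k < p + q \<Longrightarrow> \<bar>\<phi> z $ k\<bar> \<le> B" and B: "B > 0"
    and ij: "i < p + q" "j < p + q" and \<epsilon>: "\<epsilon> > 0"
  shows "AE \<omega> in M. eventually (\<lambda>n. \<bar>(\<Sum>k<n. \<phi> (Z k \<omega>) $ i * \<phi> (Z k \<omega>) $ j) - real n * family.second_moment i j\<bar> \<le> \<epsilon> * real n) sequentially"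
proof -
  define f where "f z = \<phi> z $ i * \<phi> z $ j" for z
  have fm: "f \<in> borel_measurable F"
    unfolding f_def using family.\<phi>_measurable ij by (auto intro!: borel_measurable_times)
  have fB: "\<bar>f z\<bar> \<le> B\<^sup>2" if "z \<in> space F" for z
  proof -
    have "\<bar>\<phi> z $ i\<bar> * \<bar>\<phi> z $ j\<bar> \<le> B * B" using \<phi>B[OF that] ij B by (intro mult_mono) auto
    then show ?thesis by (simp add: f_def abs_mult power2_eq_square)
  qed
  have fZm: "(\<lambda>\<omega>. f (Z k \<omega>)) \<in> borel_measurable M" for k
    using measurable_compose[OF Z_measurable fm] .
  have ex: "expectation (\<lambda>\<omega>. f (Z k \<omega>)) = family.second_moment i j" for k
  proof -
    have "expectation (\<lambda>\<omega>. f (Z k \<omega>)) = (\<integral>z. f z \<partial>distr M F (Z k))"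
      using fm by (subst integral_distr) auto
    then show ?thesis by (simp add: Z_distr family.second_moment_def f_def)
  qed
  define S where "S n = {\<omega>\<in>space M. \<epsilon> * real n \<le> \<bar>(\<Sum>k<n. f (Z k \<omega>)) - real n * family.second_moment i j\<bar>}" for n
  have Sm: "S n \<in> sets M" for n
    unfolding S_def using fZm by measurable
  \<comment> \<open>The exponent 2 (\<epsilon> n)^2 / (4 n B^4) of Hoeffding's bound is n times this
    one, so the tail is 2 r^n.\<close>
  define r where "r = exp (- (\<epsilon>\<^sup>2 / (2 * (B\<^sup>2)\<^sup>2)))"
  have r: "0 \<le> r" "r < 1" using \<epsilon> B by (auto simp: r_def)
  have Sp: "prob (S n) \<le> 2 * r ^ n" if n: "n \<ge> 1" for n
  proof -
    interpret Hf: Hoeffding_ineq M "{..<n}" "\<lambda>k \<omega>. f (Z k \<omega>)" "\<lambda>_. - B\<^sup>2" "\<lambda>_. B\<^sup>2" "real n * family.second_moment i j"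
    proof unfold_locales
      show "finite {..<n}" by simp
      have "indep_vars (\<lambda>_. F) Z {..<n}" using Z_indep by (rule indep_vars_subset) simp
      then show "indep_vars (\<lambda>_. borel) (\<lambda>k \<omega>. f (Z k \<omega>)) {..<n}"
        by (rule indep_vars_compose2) (rule fm)
      show "AE \<omega> in M. f (Z k \<omega>) \<in> {- B\<^sup>2..B\<^sup>2}" for k
        using fB[OF Z_space] by (intro AE_I2) (auto simp: abs_le_iff minus_le_iff)
      show "real n * family.second_moment i j \<equiv> \<Sum>k\<in>{..<n}. expectation (\<lambda>\<omega>. f (Z k \<omega>))"
        by (simp add: ex)
    qed
    have w: "(\<Sum>k<n. (B\<^sup>2 - - B\<^sup>2)\<^sup>2) = 4 * real n * (B\<^sup>2)\<^sup>2" by (simp add: power2_eq_square)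
    have "prob (S n) \<le> 2 * exp (- 2 * (\<epsilon> * real n)\<^sup>2 / (4 * real n * (B\<^sup>2)\<^sup>2))"
      using Hf.Hoeffding_ineq_abs_ge[of "\<epsilon> * real n"] \<epsilon> B n unfolding w S_def by simp
    also have "- 2 * (\<epsilon> * real n)\<^sup>2 / (4 * real n * (B\<^sup>2)\<^sup>2) = real n * (- (\<epsilon>\<^sup>2 / (2 * (B\<^sup>2)\<^sup>2)))"
      using n B by (simp add: power_mult_distrib power2_eq_square field_simps)
    also have "exp (real n * (- (\<epsilon>\<^sup>2 / (2 * (B\<^sup>2)\<^sup>2)))) = r ^ n"
      unfolding r_def by (rule exp_of_nat_mult)
    finally show ?thesis .
  qed
  have "summable (\<lambda>n. 2 * r ^ n)" using r by (intro summable_mult summable_geometric) auto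
  moreover have "eventually (\<lambda>n. norm (prob (S n)) \<le> 2 * r ^ n) sequentially"
    using eventually_ge_at_top[of 1] by eventually_elim (use Sp in auto)
  ultimately have "summable (\<lambda>n. prob (S n))" by (rule summable_comparison_test_ev[rotated])
  then have ae: "AE \<omega> in M. eventually (\<lambda>n. \<omega> \<in> space M - S n) sequentially"
    by (intro borel_cantelli_AE1 Sm) (auto simp: emeasure_eq_measure)
  then show ?thesis
  proof eventually_elim
    case (elim \<omega>)
    then show ?case by eventually_elim (auto simp: S_def f_def)
  qed
qed

text \<open>The almost sure statement concerns only the d^2 entries of \<open>X^T X\<close>;
  uniformity over all \<open>v\<close> is then deterministic, through closeness of quadratic
  forms.\<close>

lemma gram_lower_bound:
  assumes full: "full_rank_second_moment F \<phi> (p + q)"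
    and \<phi>B: "\<And>z k. z \<in> space F \<Longrightarrow> k < p + q \<Longrightarrow> \<bar>\<phi> z $ k\<bar> \<le> B" and B: "B > 0"
  shows "\<exists>c>0. AE \<omega> in M. eventually (\<lambda>n. \<forall>v. sqrt (c * real n) * L2_set v {..<p + q}
     \<le> L2_set (\<lambda>i. \<Sum>k<p + q. \<phi> (Z i \<omega>) $ k * v k) {..<n}) sequentially"
proof -
  define d where "d = p + q"
  have d: "real d > 0" using family.dim_pos by (simp add: d_def)
  obtain c where c: "c > 0" "\<And>v. c * (\<Sum>k<d. (v k)\<^sup>2) \<le> (\<Sum>k<d. \<Sum>l<d. v k * family.second_moment k l * v l)"
    using family.second_moment_positive_definite[OF full B \<phi>B] unfolding d_def by blast
  \<comment> \<open>Entrywise error \<epsilon> n shifts the quadratic form by at most \<epsilon> d n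
    = n c / 2 times |v|^2, so half of the lower bound survives.\<close>
  define \<epsilon> where "\<epsilon> = c / (2 * real d)"
  have \<epsilon>: "\<epsilon> > 0" using c d by (simp add: \<epsilon>_def)
  define G where "G n k l \<omega> = (\<Sum>i<n. \<phi> (Z i \<omega>) $ k * \<phi> (Z i \<omega>) $ l)" for n k l \<omega>
  have "AE \<omega> in M. \<forall>kl\<in>{..<d} \<times> {..<d}. eventually (\<lambda>n. \<bar>G n (fst kl) (snd kl) \<omega> - real n * family.second_moment (fst kl) (snd kl)\<bar> \<le> \<epsilon> * real n) sequentially"
    unfolding G_def
    by (intro AE_finite_allI finite_cartesian_product finite_lessThan sample_second_moment[OF \<phi>B B _ _ \<epsilon>]) (auto simp: d_def)
  then have "AE \<omega> in M. eventually (\<lambda>n. \<forall>v. sqrt (c / 2 * real n) * L2_set v {..<d}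
     \<le> L2_set (\<lambda>i. \<Sum>k<d. \<phi> (Z i \<omega>) $ k * v k) {..<n}) sequentially"
  proof eventually_elim
    case (elim \<omega>)
    then have "eventually (\<lambda>n. \<forall>kl\<in>{..<d} \<times> {..<d}. \<bar>G n (fst kl) (snd kl) \<omega> - real n * family.second_moment (fst kl) (snd kl)\<bar> \<le> \<epsilon> * real n) sequentially"
      by (intro eventually_ball_finite) auto
    then show ?case
    proof eventually_elim
      case (elim n)
      show ?case
      proof
        fix v :: "nat \<Rightarrow> real"
        define e where "e k l = G n k l \<omega> - real n * family.second_moment k l" for k l
        have e: "\<bar>e k l\<bar> \<le> \<epsilon> * real n" if "k < d" "l < d" for k l
          using elim that by (auto simp: e_def)
        have "(\<Sum>i<n. (\<Sum>k<d. \<phi> (Z i \<omega>) $ k * v k)\<^sup>2) = (\<Sum>i<n. \<Sum>k<d. \<Sum>l<d. v k * (\<phi> (Z i \<omega>) $ k * \<phi> (Z i \<omega>) $ l) * v l)"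
          unfolding power2_eq_square sum_product by (simp add: mult_ac)
        also have "\<dots> = (\<Sum>k<d. \<Sum>l<d. \<Sum>i<n. v k * (\<phi> (Z i \<omega>) $ k * \<phi> (Z i \<omega>) $ l) * v l)"
          by (subst sum.swap, rule sum.cong[OF refl], rule sum.swap)
        also have "\<dots> = (\<Sum>k<d. \<Sum>l<d. v k * G n k l \<omega> * v l)"
          by (simp add: G_def sum_distrib_left sum_distrib_right)
        also have "\<dots> = (\<Sum>k<d. \<Sum>l<d. v k * e k l * v l + real n * (v k * family.second_moment k l * v l))"
          by (intro sum.cong refl) (simp add: e_def algebra_simps)
        also have "\<dots> = (\<Sum>k<d. \<Sum>l<d. v k * e k l * v l) + real n * (\<Sum>k<d. \<Sum>l<d. v k * family.second_moment k l * v l)"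
          by (simp add: sum.distrib sum_distrib_left)
        finally have eq: "(\<Sum>i<n. (\<Sum>k<d. \<phi> (Z i \<omega>) $ k * v k)\<^sup>2) = \<dots>" .
        have "\<bar>\<Sum>k<d. \<Sum>l<d. v k * e k l * v l\<bar> \<le> \<epsilon> * real n * real d * (\<Sum>k<d. (v k)\<^sup>2)"
          using e \<epsilon> by (intro abs_bilinear_le) auto
        also have "\<dots> = real n * (c / 2 * (\<Sum>k<d. (v k)\<^sup>2))" using d by (simp add: \<epsilon>_def)
        finally have "- (real n * (c / 2 * (\<Sum>k<d. (v k)\<^sup>2))) \<le> (\<Sum>k<d. \<Sum>l<d. v k * e k l * v l)" by linarith
        moreover have "real n * (c * (\<Sum>k<d. (v k)\<^sup>2)) \<le> real n * (\<Sum>k<d. \<Sum>l<d. v k * family.second_moment k l * v l)"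
          using c(2)[of v] by (intro mult_left_mono) auto
        ultimately have "c / 2 * real n * (\<Sum>k<d. (v k)\<^sup>2) \<le> (\<Sum>i<n. (\<Sum>k<d. \<phi> (Z i \<omega>) $ k * v k)\<^sup>2)"
          unfolding eq by (simp add: algebra_simps)
        then have "sqrt (c / 2 * real n * (\<Sum>k<d. (v k)\<^sup>2)) \<le> sqrt (\<Sum>i<n. (\<Sum>k<d. \<phi> (Z i \<omega>) $ k * v k)\<^sup>2)"
          by (rule real_sqrt_le_mono)
        then show "sqrt (c / 2 * real n) * L2_set v {..<d} \<le> L2_set (\<lambda>i. \<Sum>k<d. \<phi> (Z i \<omega>) $ k * v k) {..<n}"
          unfolding L2_set_def real_sqrt_mult[symmetric] .
      qed
    qed
  qed
  then show ?thesis using c(1) unfolding d_def by (intro exI[of _ "c / 2"]) simp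
qed

end

section \<open>Alignment\<close>

lemma one_mem_indefinite_orthogonal: "1\<^sub>m (p + q) \<in> indefinite_orthogonal p q"
proof -
  have "Ipq p q \<in> carrier_mat (p + q) (p + q)" by (simp add: Ipq_def)
  then show ?thesis by (simp add: indefinite_orthogonal_def)
qed

text \<open>A subset of a separable space is separable: for each tolerance 1/(k + 1) and each
  rational array within that tolerance of the group, one group element near the array is selected.
  Any \<open>Q\<close> is approximated through a rational array close to it, at total cost 2/(k +
  1).\<close>

lemma countable_dense_indefinite_orthogonal:
  obtains q' :: "nat \<Rightarrow> real mat" where "\<And>k. q' k \<in> indefinite_orthogonal p q"
    "\<And>Q \<epsilon>. Q \<in> indefinite_orthogonal p q \<Longrightarrow> \<epsilon> > 0 \<Longrightarrow>
        \<exists>k. \<forall>i<p + q. \<forall>j<p + q. \<bar>q' k $$ (i, j) - Q $$ (i, j)\<bar> < \<epsilon>"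
proof -
  define d where "d = p + q"
  define O' where "O' = indefinite_orthogonal p q"
  define I where "I = {..<d} \<times> {..<d}"
  define near where "near k f Q \<longleftrightarrow> (\<forall>e\<in>I. \<bar>Q $$ e - f e\<bar> < 1 / real (Suc k))"
    for k :: nat and f :: "nat \<times> nat \<Rightarrow> real" and Q :: "real mat"
  define S where "S = {(k, f). f \<in> Pi\<^sub>E I (\<lambda>_. \<rat>) \<and> (\<exists>Q\<in>O'. near k f Q)}"
  define T where "T = (\<lambda>(k, f). SOME Q. Q \<in> O' \<and> near k f Q) ` S"
  have "countable S"
  proof (rule countable_subset)
    show "S \<subseteq> UNIV \<times> Pi\<^sub>E I (\<lambda>_. \<rat>)" by (auto simp: S_def)
    show "countable ((UNIV :: nat set) \<times> Pi\<^sub>E I (\<lambda>_. \<rat> :: real set))"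
      by (intro countable_SIGMA countable_PiE) (auto simp: I_def countable_rat)
  qed
  then have cT: "countable T" unfolding T_def by (rule countable_image)
  have some: "(SOME Q. Q \<in> O' \<and> near k f Q) \<in> O' \<and> near k f (SOME Q. Q \<in> O' \<and> near k f Q)"
    if "(k, f) \<in> S" for k f
    by (rule someI_ex) (use that in \<open>simp add: S_def Bex_def\<close>)
  have TO: "T \<subseteq> O'" using some by (auto simp: T_def)
  have dense: "\<exists>R\<in>T. \<forall>i<d. \<forall>j<d. \<bar>R $$ (i, j) - Q $$ (i, j)\<bar> < \<epsilon>" if Q: "Q \<in> O'" and e: "\<epsilon> > 0" for Q \<epsilon>
  proof -
    obtain k where k: "1 / real (Suc k) < \<epsilon> / 2" using e nat_approx_posE[of "\<epsilon> / 2"] by auto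
    have "\<exists>r\<in>\<rat>. \<bar>Q $$ e - r\<bar> < 1 / real (Suc k)" for e
    proof -
      obtain r where "r \<in> \<rat>" "Q $$ e < r" "r < Q $$ e + 1 / real (Suc k)"
        using Rats_dense_in_real[of "Q $$ e" "Q $$ e + 1 / real (Suc k)"] by auto
      then show ?thesis by (intro bexI[of _ r]) auto
    qed
    then obtain f where f: "\<And>e. f e \<in> \<rat>" "\<And>e. \<bar>Q $$ e - f e\<bar> < 1 / real (Suc k)" by metis
    define f' where "f' = restrict f I"
    have "near k f' Q" using f(2) by (simp add: near_def f'_def del: of_nat_Suc)
    then have S: "(k, f') \<in> S" using f(1) Q by (auto simp: S_def f'_def)
    define R where "R = (SOME Q. Q \<in> O' \<and> near k f' Q)"
    have "R \<in> T" using S by (auto simp: T_def R_def intro!: image_eqI[of _ _ "(k, f')"])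
    moreover have "\<bar>R $$ (i, j) - Q $$ (i, j)\<bar> < \<epsilon>" if "i < d" "j < d" for i j
    proof -
      have "(i, j) \<in> I" using that by (simp add: I_def)
      then have "\<bar>R $$ (i, j) - f (i, j)\<bar> < 1 / real (Suc k)"
        using some[OF S] by (auto simp: near_def R_def f'_def)
      then show ?thesis using f(2)[of "(i, j)"] k by linarith
    qed
    ultimately show ?thesis by auto
  qed
  have "1\<^sub>m d \<in> O'" unfolding O'_def d_def by (rule one_mem_indefinite_orthogonal)
  then have "T \<noteq> {}" using dense[of "1\<^sub>m d" 1] by auto
  show ?thesis
  proof (rule that[of "from_nat_into T"])
    show "from_nat_into T k \<in> indefinite_orthogonal p q" for k
      using from_nat_into[OF \<open>T \<noteq> {}\<close>, of k] TO by (auto simp: O'_def)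
    fix Q \<epsilon> assume "Q \<in> indefinite_orthogonal p q" "(\<epsilon>::real) > 0"
    then obtain R where R: "R \<in> T" "\<forall>i<d. \<forall>j<d. \<bar>R $$ (i, j) - Q $$ (i, j)\<bar> < \<epsilon>"
      using dense[of Q \<epsilon>] unfolding O'_def by blast
    obtain k where "from_nat_into T k = R" using from_nat_into_surj[OF cT R(1)] by auto
    with R show "\<exists>k. \<forall>i<p + q. \<forall>j<p + q. \<bar>from_nat_into T k $$ (i, j) - Q $$ (i, j)\<bar> < \<epsilon>"
      by (auto simp: d_def)
  qed
qed

lemma two_inf_norm_eq:
  "two_inf_norm B = Max ((\<lambda>i. L2_set (\<lambda>j. B $$ (i, j)) {..<dim_col B}) ` {..<dim_row B})"
  unfolding two_inf_norm_def
  by (intro arg_cong[where f = Max] image_cong refl)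
     (simp add: scalar_prod_def atLeast0LessThan L2_set_def power2_eq_square)

lemma two_inf_norm_nonneg: "B \<in> carrier_mat n d \<Longrightarrow> n > 0 \<Longrightarrow> two_inf_norm B \<ge> 0"
  unfolding two_inf_norm_eq
  by (rule order_trans[OF _ Max_ge[of _ "L2_set (\<lambda>j. B $$ (0, j)) {..<dim_col B}"]]) auto

lemma two_inf_norm_le:
  assumes B: "B \<in> carrier_mat n d" and n: "n > 0"
    and b: "\<And>i j. i < n \<Longrightarrow> j < d \<Longrightarrow> \<bar>B $$ (i, j)\<bar> \<le> b"
  shows "two_inf_norm B \<le> real d * b"
proof -
  have "L2_set (\<lambda>j. B $$ (i, j)) {..<d} \<le> real d * b" if "i < n" for i
    by (rule order_trans[OF L2_set_le_sum_abs]) (use sum_bounded_above[of "{..<d}" "\<lambda>j. \<bar>B $$ (i, j)\<bar>" b] b that in auto)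
  then show ?thesis using B n unfolding two_inf_norm_eq by (subst Max_le_iff) auto
qed

text \<open>Since \<open>indefinite_orthogonal p q\<close> is separable, near-minimisers of the error can be chosen measurably.\<close>

lemma measurable_near_minimiser:
  fixes Y X :: "'w \<Rightarrow> real mat"
  assumes n: "n > 0" and e: "\<epsilon> > 0"
    and Y: "\<And>\<omega>. \<omega> \<in> space M \<Longrightarrow> Y \<omega> \<in> carrier_mat n (p + q)"
    and X: "random_matrix M n (p + q) X"
  shows "\<exists>Q. (\<forall>\<omega>. Q \<omega> \<in> indefinite_orthogonal p q) \<and>
      (random_matrix M n (p + q) Y \<longrightarrow> random_matrix M (p + q) (p + q) Q) \<and>
      (\<forall>\<omega>\<in>space M. \<forall>R\<in>indefinite_orthogonal p q. \<forall>b.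
        (\<forall>i<n. \<forall>j<p + q. \<bar>(Y \<omega> * R) $$ (i, j) - X \<omega> $$ (i, j)\<bar> \<le> b) \<longrightarrow>
        two_inf_norm (Y \<omega> * Q \<omega> - X \<omega>) \<le> real (p + q) * b + \<epsilon>)"
proof -
  define d where "d = p + q"
  obtain q' :: "nat \<Rightarrow> real mat" where q': "\<And>k. q' k \<in> indefinite_orthogonal p q"
    and dense: "\<And>Q \<epsilon>. Q \<in> indefinite_orthogonal p q \<Longrightarrow> \<epsilon> > 0 \<Longrightarrow>
        \<exists>k. \<forall>i<d. \<forall>j<d. \<bar>q' k $$ (i, j) - Q $$ (i, j)\<bar> < \<epsilon>"
    unfolding d_def using countable_dense_indefinite_orthogonal[of p q] by blast
  have q'c: "q' k \<in> carrier_mat d d" for k using q'[of k] by (simp add: indefinite_orthogonal_def d_def)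
  have Xc: "X \<omega> \<in> carrier_mat n d" if "\<omega> \<in> space M" for \<omega> using X that by (simp add: random_matrix_def d_def)
  have Yc: "Y \<omega> \<in> carrier_mat n d" if "\<omega> \<in> space M" for \<omega> using Y[OF that] by (simp add: d_def)
  define f where "f k \<omega> = two_inf_norm (Y \<omega> * q' k - X \<omega>)" for k \<omega>
  have fc: "Y \<omega> * q' k - X \<omega> \<in> carrier_mat n d" if "\<omega> \<in> space M" for k \<omega>
    using Yc[OF that] Xc[OF that] q'c[of k] by auto
  have f0: "f k \<omega> \<ge> 0" if "\<omega> \<in> space M" for k \<omega>
    unfolding f_def by (rule two_inf_norm_nonneg[OF fc[OF that] n])
  have bdd: "bdd_below (range (\<lambda>k. f k \<omega>))" if "\<omega> \<in> space M" for \<omega>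
    using f0[OF that] by (intro bdd_belowI[of _ 0]) auto
  define m where "m \<omega> = (INF k. f k \<omega>)" for \<omega>
  \<comment> \<open>The least near-minimising index depends measurably on the outcome once all the
    errors \<open>f k\<close> do, and a function of an index from a countable set is then measurable
    without further conditions.\<close>
  define K where "K \<omega> = (LEAST k. f k \<omega> \<le> m \<omega> + \<epsilon> / 2)" for \<omega>
  have K: "f (K \<omega>) \<omega> \<le> m \<omega> + \<epsilon> / 2" if w: "\<omega> \<in> space M" for \<omega>
    unfolding K_def
  proof (rule LeastI_ex)
    have "\<exists>k. f k \<omega> < m \<omega> + \<epsilon> / 2"
      using cINF_less_iff[OF _ bdd[OF w], of "m \<omega> + \<epsilon> / 2"] e by (simp add: m_def)
    then show "\<exists>k. f k \<omega> \<le> m \<omega> + \<epsilon> / 2" by (blast intro: less_imp_le)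
  qed
  show ?thesis
  proof (rule exI[of _ "\<lambda>\<omega>. q' (K \<omega>)"], intro conjI allI ballI impI)
    show "q' (K \<omega>) \<in> indefinite_orthogonal p q" for \<omega> by (rule q')
  next
    assume "random_matrix M n (p + q) Y"
    then have Ym: "(\<lambda>\<omega>. Y \<omega> $$ (i, j)) \<in> borel_measurable M" if "i < n" "j < d" for i j
      using that by (simp add: random_matrix_def d_def)
    have Xm: "(\<lambda>\<omega>. X \<omega> $$ (i, j)) \<in> borel_measurable M" if "i < n" "j < d" for i j
      using X that by (simp add: random_matrix_def d_def)
    have fm: "f k \<in> borel_measurable M" for k
    proof -
      have "(\<lambda>\<omega>. Max ((\<lambda>i. sqrt (\<Sum>j<d. ((\<Sum>l<d. Y \<omega> $$ (i, l) * q' k $$ (l, j)) - X \<omega> $$ (i, j))\<^sup>2)) ` {..<n})) \<in> borel_measurable M"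
        using n Ym Xm by (intro borel_measurable_Max borel_measurable_sqrt[THEN measurable_compose[rotated]] borel_measurable_sum
           borel_measurable_power borel_measurable_diff borel_measurable_times) auto
      also have "?this \<longleftrightarrow> ?thesis"
      proof (rule measurable_cong)
        fix \<omega> assume w: "\<omega> \<in> space M"
        have "(Y \<omega> * q' k - X \<omega>) $$ (i, j) = (\<Sum>l<d. Y \<omega> $$ (i, l) * q' k $$ (l, j)) - X \<omega> $$ (i, j)"
          if "i < n" "j < d" for i j
          using Yc[OF w] Xc[OF w] q'c[of k] that by (simp add: scalar_prod_def atLeast0LessThan)
        then show "Max ((\<lambda>i. sqrt (\<Sum>j<d. ((\<Sum>l<d. Y \<omega> $$ (i, l) * q' k $$ (l, j)) - X \<omega> $$ (i, j))\<^sup>2)) ` {..<n}) = f k \<omega>"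
          unfolding f_def two_inf_norm_eq L2_set_def carrier_matD[OF fc[OF w, of k]]
          by (intro arg_cong[where f = Max] image_cong refl arg_cong[where f = sqrt] sum.cong) (simp only: lessThan_iff)
      qed
      finally show ?thesis .
    qed
    have "m \<in> borel_measurable M"
      unfolding m_def using fm bdd by (intro borel_measurable_cINF) auto
    then have Km: "K \<in> M \<rightarrow>\<^sub>M count_space UNIV"
      unfolding K_def using fm by (intro measurable_Least) (simp add: pred_def)
    have "(\<lambda>\<omega>. q' (K \<omega>) $$ (i, j)) \<in> borel_measurable M" for i j
      by (rule measurable_compose[OF Km]) simp
    then show "random_matrix M (p + q) (p + q) (\<lambda>\<omega>. q' (K \<omega>))"
      using q'c unfolding random_matrix_def d_def by auto
  next
    fix \<omega> R b
    assume w: "\<omega> \<in> space M" and R: "R \<in> indefinite_orthogonal p q"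
      and b: "\<forall>i<n. \<forall>j<p + q. \<bar>(Y \<omega> * R) $$ (i, j) - X \<omega> $$ (i, j)\<bar> \<le> b"
    have Rc: "R \<in> carrier_mat d d" using R by (simp add: indefinite_orthogonal_def d_def)
    define s where "s = (\<Sum>i<n. \<Sum>l<d. \<bar>Y \<omega> $$ (i, l)\<bar>)"
    have s: "s \<ge> 0" by (simp add: s_def sum_nonneg)
    \<comment> \<open>Small enough that replacing \<open>R\<close> by a member of the dense sequence
      costs at most \<epsilon>/2 after the factor d; the other \<epsilon>/2 is the slack in the
      choice of \<open>K\<close>. The added ones avoid division by 0.\<close>
    define \<gamma> where "\<gamma> = \<epsilon> / (2 * (real d + 1) * (s + 1))"
    have \<gamma>: "\<gamma> > 0" using e s by (simp add: \<gamma>_def)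
    obtain k where k: "\<forall>i<d. \<forall>j<d. \<bar>q' k $$ (i, j) - R $$ (i, j)\<bar> < \<gamma>" using dense[OF R \<gamma>] by auto
    have "\<bar>(Y \<omega> * q' k - X \<omega>) $$ (i, j)\<bar> \<le> b + s * \<gamma>" if ij: "i < n" "j < d" for i j
    proof -
      have "(Y \<omega> * q' k - X \<omega>) $$ (i, j) = ((Y \<omega> * R) $$ (i, j) - X \<omega> $$ (i, j)) + (\<Sum>l<d. Y \<omega> $$ (i, l) * (q' k $$ (l, j) - R $$ (l, j)))"
        using Yc[OF w] Xc[OF w] q'c[of k] Rc ij
        by (simp add: scalar_prod_def atLeast0LessThan right_diff_distrib sum_subtractf)
      moreover have "\<bar>\<Sum>l<d. Y \<omega> $$ (i, l) * (q' k $$ (l, j) - R $$ (l, j))\<bar> \<le> s * \<gamma>"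
      proof -
        have "\<bar>\<Sum>l<d. Y \<omega> $$ (i, l) * (q' k $$ (l, j) - R $$ (l, j))\<bar> \<le> (\<Sum>l<d. \<bar>Y \<omega> $$ (i, l)\<bar> * \<gamma>)"
        proof (rule order_trans[OF sum_abs], rule sum_mono)
          fix l assume "l \<in> {..<d}"
          then have "\<bar>q' k $$ (l, j) - R $$ (l, j)\<bar> \<le> \<gamma>" using k ij by (auto intro: less_imp_le)
          then show "\<bar>Y \<omega> $$ (i, l) * (q' k $$ (l, j) - R $$ (l, j))\<bar> \<le> \<bar>Y \<omega> $$ (i, l)\<bar> * \<gamma>"
            unfolding abs_mult by (intro mult_left_mono) auto
        qed
        also have "\<dots> = (\<Sum>l<d. \<bar>Y \<omega> $$ (i, l)\<bar>) * \<gamma>" by (simp add: sum_distrib_right)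
        also have "\<dots> \<le> s * \<gamma>" unfolding s_def using ij \<gamma>
          by (intro mult_right_mono member_le_sum[where f = "\<lambda>i. \<Sum>l<d. \<bar>Y \<omega> $$ (i, l)\<bar>"]) (auto intro: sum_nonneg)
        finally show ?thesis .
      qed
      moreover have "\<bar>(Y \<omega> * R) $$ (i, j) - X \<omega> $$ (i, j)\<bar> \<le> b" using b ij by (simp add: d_def)
      ultimately show ?thesis by linarith
    qed
    then have "f k \<omega> \<le> real d * (b + s * \<gamma>)" unfolding f_def by (rule two_inf_norm_le[OF fc[OF w] n])
    also have "\<dots> \<le> real d * b + \<epsilon> / 2"
    proof -
      have "real d * (s * \<gamma>) \<le> (real d + 1) * ((s + 1) * \<gamma>)" using s \<gamma> by (intro mult_mono) auto
      also have "\<dots> = \<epsilon> / 2"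
      proof -
        have cancel: "x * (y * (\<epsilon> / (2 * x * y))) = \<epsilon> / 2" if "x \<noteq> 0" "y \<noteq> 0" for x y :: real using that by simp
        show ?thesis unfolding \<gamma>_def by (rule cancel) (use s in auto)
      qed
      finally show ?thesis by (simp add: distrib_left)
    qed
    finally have "f k \<omega> \<le> real d * b + \<epsilon> / 2" .
    moreover have "m \<omega> \<le> f k \<omega>" unfolding m_def by (rule cINF_lower[OF bdd[OF w]]) simp
    ultimately show "two_inf_norm (Y \<omega> * q' (K \<omega>) - X \<omega>) \<le> real (p + q) * b + \<epsilon>"
      using K[OF w] unfolding f_def d_def by linarith
  qed
qed

text \<open>The deterministic estimate is applied along almost every sample path with \<eta> =
  \<theta> = C1 s n. The matrix obtained may depend on the outcome in an arbitrary way;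
  measurability is restored afterwards.\<close>

lemma (in wgrdpg) exists_alignment:
  assumes cond_i: "full_rank_second_moment F \<phi> (p + q)"
    and cond_ii: "bounded_means F \<phi> p q"
    and cond_iii: "log_tails F H \<alpha>"
    and embedding: "\<And>n \<omega>. n \<ge> p + q \<Longrightarrow> \<omega> \<in> space M \<Longrightarrow>
      spectral_embedding (p + q) (adjacency A n \<omega>) (XA n \<omega>)"
  shows "\<exists>C\<ge>0. AE \<omega> in M. eventually (\<lambda>n. \<exists>Q\<in>indefinite_orthogonal p q. \<forall>i<n. \<forall>l<p + q.
     \<bar>(XA n \<omega> * Q) $$ (i, l) - \<phi> (Z i \<omega>) $ l\<bar>
       \<le> C * (real n powr (- 1 / 2) * ln (real n) powr (3 * \<alpha> + 3 / 2))) sequentially"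
proof -
  have \<alpha>: "\<alpha> > 0" using cond_iii by (simp add: log_tails_def)
  obtain B where B: "B > 0" and \<phi>B: "\<And>z k. z \<in> space F \<Longrightarrow> k < p + q \<Longrightarrow> \<bar>\<phi> z $ k\<bar> \<le> B"
    using family.latent_positions_bounded[OF cond_i cond_ii] by blast
  obtain c where c: "c > 0" and gram: "AE \<omega> in M. eventually (\<lambda>n. \<forall>v. sqrt (c * real n) * L2_set v {..<p + q}
     \<le> L2_set (\<lambda>i. \<Sum>k<p + q. \<phi> (Z i \<omega>) $ k * v k) {..<n}) sequentially"
    using gram_lower_bound[OF cond_i \<phi>B B] by blast
  define s where "s n = sqrt (real n) * ln (real n) powr (\<alpha> + 1 / 2)" for n :: nat
  obtain C1 where C1: "C1 \<ge> 0" and noise: "AE \<omega> in M. eventually (\<lambda>n.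
     (\<forall>v. L2_set (\<lambda>i. \<Sum>j<n. noise i j \<omega> * v j) {..<n} \<le> C1 * s n * L2_set v {..<n}) \<and>
     (\<forall>i<n. \<forall>k<p + q. \<bar>\<Sum>j<n. noise i j \<omega> * \<phi> (Z j \<omega>) $ k\<bar> \<le> C1 * s n)) sequentially"
    using noise_bounds[OF cond_iii \<phi>B B] unfolding s_def by blast
  obtain C \<delta> where C: "C \<ge> 0" and \<delta>: "\<delta> > 0" and det:
    "\<And>n A Y X \<eta> \<theta>. A \<in> carrier_mat n n \<Longrightarrow> transpose_mat A = A \<Longrightarrow> p + q \<le> n \<Longrightarrow> spectral_embedding (p + q) A Y \<Longrightarrow>
      (\<And>i l. i < n \<Longrightarrow> l < p + q \<Longrightarrow> \<bar>X i l\<bar> \<le> B) \<Longrightarrow>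
      (\<And>v. sqrt (c * real n) * L2_set v {..<p + q} \<le> L2_set (\<lambda>i. \<Sum>k<p + q. X i k * v k) {..<n}) \<Longrightarrow>
      (\<And>v. L2_set (\<lambda>i. \<Sum>j<n. (A $$ (i, j) - (\<Sum>l<p + q. X i l * (if l < p then 1 else -1) * X j l)) * v j) {..<n} \<le> \<eta> * L2_set v {..<n}) \<Longrightarrow>
      (\<And>i l. i < n \<Longrightarrow> l < p + q \<Longrightarrow> \<bar>\<Sum>j<n. (A $$ (i, j) - (\<Sum>l<p + q. X i l * (if l < p then 1 else -1) * X j l)) * X j l\<bar> \<le> \<theta>) \<Longrightarrow>
      0 \<le> \<eta> \<Longrightarrow> \<eta> \<le> \<delta> * real n \<Longrightarrow> 0 \<le> \<theta> \<Longrightarrow>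
      \<exists>Q\<in>indefinite_orthogonal p q. \<forall>i<n. \<forall>l<p + q.
        \<bar>(Y * Q) $$ (i, l) - X i l\<bar> \<le> C * (\<eta> / real n + \<theta> / real n + \<eta>\<^sup>2 / (real n * sqrt (real n)))"
    by (rule spectral_embedding_error[of p q B c]) (use family.dim_pos B c in auto)
  define rate where "rate n = real n powr (- 1 / 2) * ln (real n) powr (3 * \<alpha> + 3 / 2)" for n :: nat
  define C' where "C' = C * (2 * C1 + C1\<^sup>2)"
  note lnn = ln_ge_one
  have sn: "s n / real n = real n powr (- 1 / 2) * ln (real n) powr (\<alpha> + 1 / 2)" if "n \<ge> 3" for n
  proof -
    have "sqrt (real n) / real n = real n powr (1 / 2) / real n powr 1" using that by (simp add: powr_half_sqrt)
    also have "\<dots> = real n powr (- 1 / 2)" unfolding powr_diff[symmetric] by simp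
    finally have "sqrt (real n) / real n = real n powr (- 1 / 2)" .
    moreover have "s n / real n = sqrt (real n) / real n * ln (real n) powr (\<alpha> + 1 / 2)" by (simp add: s_def)
    ultimately show ?thesis by (simp only:)
  qed
  \<comment> \<open>The first-order terms carry the log power \<alpha> + 1/2 and the second-order
    term 2\<alpha> + 1. Both are at most 3\<alpha> + 3/2, and the powers of ln n compare accordingly
    because ln n \<ge> 1.\<close>
  have r1: "s n / real n \<le> rate n" if n: "n \<ge> 3" for n
    unfolding sn[OF n] rate_def using lnn[OF n] \<alpha> by (intro mult_left_mono powr_mono) auto
  have r2: "(s n)\<^sup>2 / (real n * sqrt (real n)) \<le> rate n" if n: "n \<ge> 3" for n
  proof -
    have sq: "(s n)\<^sup>2 = real n * ln (real n) powr (2 * \<alpha> + 1)"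
      using n lnn[OF n] by (simp add: s_def power_mult_distrib powr_power distrib_left)
    have "1 / sqrt (real n) = real n powr (- 1 / 2)" by (simp add: powr_minus_divide powr_half_sqrt)
    then have "(s n)\<^sup>2 / (real n * sqrt (real n)) = real n powr (- 1 / 2) * ln (real n) powr (2 * \<alpha> + 1)"
      unfolding sq using n by (simp add: divide_simps)
    also have "\<dots> \<le> rate n" unfolding rate_def using lnn[OF n] \<alpha> by (intro mult_left_mono powr_mono) auto
    finally show ?thesis .
  qed
  \<comment> \<open>Secures the smallness condition \<open>\<eta> \<le> \<delta> * n\<close> of the
    deterministic estimate for all large n.\<close>
  have lim: "(\<lambda>n. C1 * s n / real n) \<longlonglongrightarrow> 0" unfolding s_def by real_asymp
  have small: "eventually (\<lambda>n. C1 * s n / real n < \<delta>) sequentially"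
    by (rule order_tendstoD(2)[OF lim \<delta>])
  have "AE \<omega> in M. eventually (\<lambda>n. \<exists>Q\<in>indefinite_orthogonal p q. \<forall>i<n. \<forall>l<p + q.
     \<bar>(XA n \<omega> * Q) $$ (i, l) - \<phi> (Z i \<omega>) $ l\<bar> \<le> C' * rate n) sequentially"
    using gram noise AE_space
  proof eventually_elim
    case (elim \<omega>)
    note w = elim(3)
    show ?case
      using elim(1,2) small eventually_ge_at_top[of "max 3 (p + q)"]
    proof eventually_elim
      case (elim n)
      then have n: "n \<ge> 3" and dn: "p + q \<le> n" by auto
      have s0: "s n \<ge> 0" by (simp add: s_def)
      have adj: "adjacency A n \<omega> \<in> carrier_mat n n" by (simp add: adjacency_def)
      have sym: "transpose_mat (adjacency A n \<omega>) = adjacency A n \<omega>"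
        using A_sym[OF w] by (intro eq_matI) (auto simp: adjacency_def)
      have E: "adjacency A n \<omega> $$ (i, j) - (\<Sum>l<p + q. \<phi> (Z i \<omega>) $ l * (if l < p then 1 else -1) * \<phi> (Z j \<omega>) $ l) = noise i j \<omega>"
        if "i < n" "j < n" for i j
        using that by (simp add: adjacency_def noise_def)
      have "\<exists>Q\<in>indefinite_orthogonal p q. \<forall>i<n. \<forall>l<p + q.
        \<bar>(XA n \<omega> * Q) $$ (i, l) - (\<lambda>i l. \<phi> (Z i \<omega>) $ l) i l\<bar>
          \<le> C * (C1 * s n / real n + C1 * s n / real n + (C1 * s n)\<^sup>2 / (real n * sqrt (real n)))"
      proof (rule det[OF adj sym dn embedding[OF dn w]])
        show "\<bar>\<phi> (Z i \<omega>) $ l\<bar> \<le> B" if "l < p + q" for i l using \<phi>B[OF Z_space[OF w] that] .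
        show "sqrt (c * real n) * L2_set v {..<p + q} \<le> L2_set (\<lambda>i. \<Sum>k<p + q. \<phi> (Z i \<omega>) $ k * v k) {..<n}" for v
          using elim(1) by blast
        show "L2_set (\<lambda>i. \<Sum>j<n. (adjacency A n \<omega> $$ (i, j) - (\<Sum>l<p + q. \<phi> (Z i \<omega>) $ l * (if l < p then 1 else -1) * \<phi> (Z j \<omega>) $ l)) * v j) {..<n}
           \<le> C1 * s n * L2_set v {..<n}" for v
        proof -
          have "L2_set (\<lambda>i. \<Sum>j<n. (adjacency A n \<omega> $$ (i, j) - (\<Sum>l<p + q. \<phi> (Z i \<omega>) $ l * (if l < p then 1 else -1) * \<phi> (Z j \<omega>) $ l)) * v j) {..<n}
            = L2_set (\<lambda>i. \<Sum>j<n. noise i j \<omega> * v j) {..<n}"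
            by (intro L2_set_cong sum.cong refl) (simp only: E lessThan_iff)
          then show ?thesis using elim(2) by simp
        qed
        show "\<bar>\<Sum>j<n. (adjacency A n \<omega> $$ (i, j) - (\<Sum>l<p + q. \<phi> (Z i \<omega>) $ l * (if l < p then 1 else -1) * \<phi> (Z j \<omega>) $ l)) * \<phi> (Z j \<omega>) $ l\<bar> \<le> C1 * s n"
          if "i < n" "l < p + q" for i l
        proof -
          have "(\<Sum>j<n. (adjacency A n \<omega> $$ (i, j) - (\<Sum>l<p + q. \<phi> (Z i \<omega>) $ l * (if l < p then 1 else -1) * \<phi> (Z j \<omega>) $ l)) * \<phi> (Z j \<omega>) $ l)
            = (\<Sum>j<n. noise i j \<omega> * \<phi> (Z j \<omega>) $ l)"
            by (intro sum.cong refl) (simp only: E[OF that(1)] lessThan_iff)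
          then show ?thesis using elim(2) that by simp
        qed
        show "0 \<le> C1 * s n" using C1 s0 by simp
        then show "0 \<le> C1 * s n" .
        show "C1 * s n \<le> \<delta> * real n" using elim(3) n by (simp add: pos_divide_less_eq)
      qed
      then obtain Q where Q: "Q \<in> indefinite_orthogonal p q"
        "\<And>i l. i < n \<Longrightarrow> l < p + q \<Longrightarrow> \<bar>(XA n \<omega> * Q) $$ (i, l) - \<phi> (Z i \<omega>) $ l\<bar>
          \<le> C * (C1 * s n / real n + C1 * s n / real n + (C1 * s n)\<^sup>2 / (real n * sqrt (real n)))"
        by blast
      have "C1 * s n / real n + C1 * s n / real n + (C1 * s n)\<^sup>2 / (real n * sqrt (real n))
        = C1 * (s n / real n) + C1 * (s n / real n) + C1\<^sup>2 * ((s n)\<^sup>2 / (real n * sqrt (real n)))"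
        by (simp add: power_mult_distrib)
      also have "\<dots> \<le> C1 * rate n + C1 * rate n + C1\<^sup>2 * rate n"
        using r1[OF n] r2[OF n] C1 by (intro add_mono mult_left_mono) auto
      also have "\<dots> = (2 * C1 + C1\<^sup>2) * rate n" by (simp add: algebra_simps)
      finally have "C * (C1 * s n / real n + C1 * s n / real n + (C1 * s n)\<^sup>2 / (real n * sqrt (real n))) \<le> C' * rate n"
        using C unfolding C'_def mult.assoc by (intro mult_left_mono) auto
      with Q show ?case by (intro bexI[of _ Q] allI impI) (auto intro: order_trans)
    qed
  qed
  moreover have "C' \<ge> 0" using C C1 by (simp add: C'_def)
  ultimately show ?thesis unfolding rate_def by blast
qed

theorem theorem1:
  fixes M :: "'w measure" and F :: "'z measure"
    and H :: "'z \<Rightarrow> 'z \<Rightarrow> real measure" and \<phi> :: "'z \<Rightarrow> real vec"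
    and p q :: nat and \<alpha> :: real
    and Z :: "nat \<Rightarrow> 'w \<Rightarrow> 'z" and A :: "nat \<Rightarrow> nat \<Rightarrow> 'w \<Rightarrow> real"
    and XA :: "nat \<Rightarrow> 'w \<Rightarrow> real mat"
  assumes model: "wgrdpg M F H \<phi> p q Z A"
    and cond_i: "full_rank_second_moment F \<phi> (p + q)"
    and cond_ii: "bounded_means F \<phi> p q"
    and cond_iii: "log_tails F H \<alpha>"
    and embedding: "\<And>n \<omega>. n \<ge> p + q \<Longrightarrow> \<omega> \<in> space M \<Longrightarrow>
      spectral_embedding (p + q) (adjacency A n \<omega>) (XA n \<omega>)"
  shows "\<exists>Q :: nat \<Rightarrow> 'w \<Rightarrow> real mat.
    (\<forall>n. \<forall>\<omega>\<in>space M. Q n \<omega> \<in> indefinite_orthogonal p q) \<and>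
    (\<forall>n. random_matrix M n (p + q) (XA n) \<longrightarrow> random_matrix M (p + q) (p + q) (Q n)) \<and>
    (AE \<omega> in M.
      (\<lambda>n. two_inf_norm (XA n \<omega> * Q n \<omega> - point_cloud \<phi> (p + q) Z n \<omega>))
        \<in> O(\<lambda>n. real n powr (- 1 / 2) * ln (real n) powr (3 * \<alpha> + 3 / 2)))"
proof -
  interpret wgrdpg M F H \<phi> p q Z A by (rule model)
  have \<alpha>: "\<alpha> > 0" using cond_iii by (simp add: log_tails_def)
  define X where "X n = point_cloud \<phi> (p + q) Z n" for n
  define rate where "rate n = real n powr (- 1 / 2) * ln (real n) powr (3 * \<alpha> + 3 / 2)" for n :: nat
  have Xe: "X n \<omega> $$ (i, l) = \<phi> (Z i \<omega>) $ l" if "i < n" "l < p + q" for n \<omega> i l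
    using that by (simp add: X_def point_cloud_def)
  have X: "random_matrix M n (p + q) (X n)" for n
    unfolding random_matrix_def
  proof (intro conjI ballI allI impI)
    show "X n \<omega> \<in> carrier_mat n (p + q)" for \<omega> by (simp add: X_def point_cloud_def)
    show "(\<lambda>\<omega>. X n \<omega> $$ (i, j)) \<in> borel_measurable M" if "i < n" "j < p + q" for i j
      unfolding Xe[OF that] using measurable_compose[OF Z_measurable family.\<phi>_measurable[OF that(2)]] .
  qed
  have XAc: "XA n \<omega> \<in> carrier_mat n (p + q)" if "n \<ge> p + q" "\<omega> \<in> space M" for n \<omega>
    using spectral_embedding_entries[OF embedding[OF that], of n] by (auto simp: adjacency_def)
  \<comment> \<open>The slack 1/n is within the claimed rate. For n below p + q, where nothing is
    assumed of \<open>XA\<close>, the identity serves as a measurable member of the group.\<close>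
  have "\<exists>Q. (\<forall>\<omega>. Q \<omega> \<in> indefinite_orthogonal p q) \<and>
      (random_matrix M n (p + q) (XA n) \<longrightarrow> random_matrix M (p + q) (p + q) Q) \<and>
      (n \<ge> p + q \<longrightarrow> (\<forall>\<omega>\<in>space M. \<forall>R\<in>indefinite_orthogonal p q. \<forall>b.
        (\<forall>i<n. \<forall>j<p + q. \<bar>(XA n \<omega> * R) $$ (i, j) - X n \<omega> $$ (i, j)\<bar> \<le> b) \<longrightarrow>
        two_inf_norm (XA n \<omega> * Q \<omega> - X n \<omega>) \<le> real (p + q) * b + 1 / real n))" for n
  proof (cases "n \<ge> p + q")
    case True
    then have n: "n > 0" using family.dim_pos by simp
    then have "1 / real n > 0" by simp
    from measurable_near_minimiser[OF n this XAc[OF True] X[of n]] True show ?thesis by simp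
  next
    case False
    then show ?thesis using one_mem_indefinite_orthogonal[of p q]
      by (intro exI[of _ "\<lambda>_. 1\<^sub>m (p + q)"]) (auto simp: random_matrix_def)
  qed
  then obtain Q where Q: "\<And>n \<omega>. Q n \<omega> \<in> indefinite_orthogonal p q"
    "\<And>n. random_matrix M n (p + q) (XA n) \<Longrightarrow> random_matrix M (p + q) (p + q) (Q n)"
    "\<And>n \<omega> R b. n \<ge> p + q \<Longrightarrow> \<omega> \<in> space M \<Longrightarrow> R \<in> indefinite_orthogonal p q \<Longrightarrow>
        \<forall>i<n. \<forall>j<p + q. \<bar>(XA n \<omega> * R) $$ (i, j) - X n \<omega> $$ (i, j)\<bar> \<le> b \<Longrightarrow>
        two_inf_norm (XA n \<omega> * Q n \<omega> - X n \<omega>) \<le> real (p + q) * b + 1 / real n"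
    by metis
  obtain C where C: "C \<ge> 0" and ae: "AE \<omega> in M. eventually (\<lambda>n. \<exists>R\<in>indefinite_orthogonal p q. \<forall>i<n. \<forall>l<p + q.
     \<bar>(XA n \<omega> * R) $$ (i, l) - \<phi> (Z i \<omega>) $ l\<bar> \<le> C * rate n) sequentially"
    using exists_alignment[OF cond_i cond_ii cond_iii embedding] unfolding rate_def by blast
  have rate1: "1 / real n \<le> rate n" if n: "n \<ge> 3" for n
  proof -
    note ln1 = ln_ge_one[OF n]
    have "1 / real n = real n powr (-1) * 1" using n by (simp add: powr_minus_divide)
    also have "\<dots> \<le> rate n" unfolding rate_def
      using n ln1 \<alpha> by (intro mult_mono powr_mono ge_one_powr_ge_zero) auto
    finally show ?thesis .
  qed
  have "AE \<omega> in M. (\<lambda>n. two_inf_norm (XA n \<omega> * Q n \<omega> - X n \<omega>)) \<in> O(rate)"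
    using ae AE_space
  proof eventually_elim
    case (elim \<omega>)
    note w = elim(2)
    show ?case
    proof (rule bigoI[where c = "real (p + q) * C + 1"])
      show "eventually (\<lambda>n. norm (two_inf_norm (XA n \<omega> * Q n \<omega> - X n \<omega>)) \<le> (real (p + q) * C + 1) * norm (rate n)) sequentially"
        using elim(1) eventually_ge_at_top[of "max 3 (p + q)"]
      proof eventually_elim
        case (elim n)
        then have n: "n \<ge> 3" and dn: "n \<ge> p + q" by auto
        from elim(1) obtain R where R: "R \<in> indefinite_orthogonal p q"
          "\<forall>i<n. \<forall>l<p + q. \<bar>(XA n \<omega> * R) $$ (i, l) - \<phi> (Z i \<omega>) $ l\<bar> \<le> C * rate n" by blast
        have "two_inf_norm (XA n \<omega> * Q n \<omega> - X n \<omega>) \<le> real (p + q) * (C * rate n) + 1 / real n"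
          using R(2) by (intro Q(3)[OF dn w R(1)]) (simp add: Xe)
        also have "\<dots> \<le> (real (p + q) * C + 1) * rate n" using rate1[OF n] by (simp add: algebra_simps)
        finally have le: "two_inf_norm (XA n \<omega> * Q n \<omega> - X n \<omega>) \<le> (real (p + q) * C + 1) * rate n" .
        have "Q n \<omega> \<in> carrier_mat (p + q) (p + q)" using Q(1)[of n \<omega>] by (simp add: indefinite_orthogonal_def)
        then have "XA n \<omega> * Q n \<omega> - X n \<omega> \<in> carrier_mat n (p + q)"
          by (simp add: X_def point_cloud_def minus_carrier_mat)
        then have "two_inf_norm (XA n \<omega> * Q n \<omega> - X n \<omega>) \<ge> 0" using n by (intro two_inf_norm_nonneg) auto
        moreover have "rate n \<ge> 0" by (simp add: rate_def)
        ultimately show ?case using le by simp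
      qed
    qed
  qed
  then show ?thesis using Q(1,2) unfolding X_def rate_def[abs_def] by (intro exI[of _ Q]) auto
qed

end
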